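(* Let $C$ be a geometrically integral curve over $K$ and let $P\in C$ be a point lying under a singularity $P^{\overline{K}}$ of $C^{\overline{K}}$. If $[\mathbf{k}(C,P):K]$ belongs to $\Gamma_{C,P}$, then $C$ is regular at $P$.
   Context: $K$ is a non-perfect, separably closed field of characteristic $p>0$ with algebraic closure $\overline{K}$. $\mathcal{O}_{C,P}$ is the local ring of $C$ at the (closed) point $P$ and $\mathbf{k}(C,P)$ is its residue field. $C^{\overline{K}}=C\times_{\operatorname{Spec}K}\operatorname{Spec}\overline{K}$, $P^{\overline{K}}$ is the unique point of $C^{\overline{K}}$ over $P$, $\widetilde{C^{\overline{K}}}$ is the normalization of $C^{\overline{K}}$ and $\widetilde{P^{\overline{K}}}$ is the unique point of it lying over $P$. Let $\nu_0$ be the (normalized) discrete valuation of $K(C)\overline{K}|\overline{K}$ with valuation ring $\mathcal{O}_{\widetilde{C^{\overline{K}}},\widetilde{P^{\overline{K}}}}$. Then $\Gamma_{C,P}=\{l\in\mathbb{Z} : l=\nu_0(x)\text{ for some }x\in\mathcal{O}_{C,P}\}$. *)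

theory Defs
  imports
    "HOL-Algebra.Algebraic_Closure"
    "HOL-Algebra.Generated_Rings"
    "HOL-Algebra.Generated_Fields"
    "HOL-Algebra.Free_Abelian_Groups"
    "HOL-Library.Extended_Nat"
begin

text \<open>
  Integral separated schemes of finite type over a field \<open>k\<close> are represented in the classical way of
  Chevalley (EGA I, section 8): such a scheme with function field \<open>F\<close> is the set of its local
  rings, which are subrings of \<open>F\<close>; its affine open subschemes are the sets of all localizations
  \<open>A\<^sub>q\<close> at primes of finitely generated \<open>k\<close>-subalgebras \<open>A\<close> of \<open>F\<close> with \<open>Frac A = F\<close>.
  A point therefore \<^emph>\<open>is\<close> its local ring. Everything takes place inside one ambient field \<open>L\<close>,
  and a subring \<open>A\<close> of \<open>L\<close> is viewed as the ring \<open>L\<lparr>carrier := A\<rparr>\<close>.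
\<close>

section \<open>Separability\<close>

text \<open>In this section \<open>E\<close> is an algebraic closure of its subfield \<open>K\<close>.\<close>

definition separable_elt :: "('a, 'm) ring_scheme \<Rightarrow> 'a set \<Rightarrow> 'a \<Rightarrow> bool" where
  "separable_elt E K x \<longleftrightarrow>
     (ring.algebraic E over K) x \<and> (\<forall>y \<in> carrier E. ring.alg_mult E (ring.Irr E K x) y \<le> 1)"

definition separably_closed :: "('a, 'm) ring_scheme \<Rightarrow> 'a set \<Rightarrow> bool" where
  "separably_closed E K \<longleftrightarrow> (\<forall>x \<in> carrier E. separable_elt E K x \<longrightarrow> x \<in> K)"

definition perfect_field :: "('a, 'm) ring_scheme \<Rightarrow> 'a set \<Rightarrow> bool" where
  "perfect_field E K \<longleftrightarrow> (\<forall>x \<in> carrier E. separable_elt E K x)"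


section \<open>Local rings\<close>

definition local_ring :: "('a, 'm) ring_scheme \<Rightarrow> bool" where
  "local_ring R \<longleftrightarrow> cring R \<and> (\<exists>!I. maximalideal I R)"

definition max_ideal :: "('a, 'm) ring_scheme \<Rightarrow> 'a set" where
  "max_ideal R = (THE I. maximalideal I R)"

definition krull_dim :: "('a, 'm) ring_scheme \<Rightarrow> enat" where
  "krull_dim R = Sup {enat n | n. \<exists>q :: nat \<Rightarrow> 'a set.
     (\<forall>i \<le> n. primeideal (q i) R) \<and> (\<forall>i < n. q i \<subset> q (Suc i))}"

definition regular_local_ring :: "('a, 'm) ring_scheme \<Rightarrow> bool" where
  "regular_local_ring R \<longleftrightarrow> noetherian_ring R \<and> local_ring R \<and>
     (\<exists>S \<subseteq> carrier R. finite S \<and> max_ideal R = genideal R S \<and> enat (card S) = krull_dim R)"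

text \<open>For points of schemes this says that \<open>Q\<close> is mapped to \<open>P\<close> (domination of local rings).\<close>

definition lies_over :: "('a, 'm) ring_scheme \<Rightarrow> 'a set \<Rightarrow> 'a set \<Rightarrow> bool" where
  "lies_over L Q P \<longleftrightarrow>
     P \<subseteq> Q \<and> max_ideal (L\<lparr>carrier := Q\<rparr>) \<inter> P = max_ideal (L\<lparr>carrier := P\<rparr>)"

definition residue_field :: "('a, 'm) ring_scheme \<Rightarrow> 'a set \<Rightarrow> 'a set ring" where
  "residue_field L P = L\<lparr>carrier := P\<rparr> Quot max_ideal (L\<lparr>carrier := P\<rparr>)"

text \<open>The residue field of \<open>P\<close> has finite degree \<open>d\<close> over (the image of) \<open>K\<close>.\<close>

definition residue_degree :: "('a, 'm) ring_scheme \<Rightarrow> 'a set \<Rightarrow> 'a set \<Rightarrow> nat \<Rightarrow> bool" where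
  "residue_degree L K P d \<longleftrightarrow>
     ring.dimension (residue_field L P) d
       ((\<lambda>x. max_ideal (L\<lparr>carrier := P\<rparr>) +>\<^bsub>L\<lparr>carrier := P\<rparr>\<^esub> x) ` K)
       (carrier (residue_field L P))"


section \<open>Curves as sets of local rings\<close>

definition localization_at :: "('a, 'm) ring_scheme \<Rightarrow> 'a set \<Rightarrow> 'a set \<Rightarrow> 'a set" where
  "localization_at L A q = {a \<otimes>\<^bsub>L\<^esub> inv\<^bsub>L\<^esub> s | a s. a \<in> A \<and> s \<in> A - q}"

definition affine_model :: "('a, 'm) ring_scheme \<Rightarrow> 'a set \<Rightarrow> 'a set set" where
  "affine_model L A = {localization_at L A q | q. primeideal q (L\<lparr>carrier := A\<rparr>)}"

definition fin_gen_algebra :: "('a, 'm) ring_scheme \<Rightarrow> 'a set \<Rightarrow> 'a set \<Rightarrow> bool" where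
  "fin_gen_algebra L k A \<longleftrightarrow>
     (\<exists>S. finite S \<and> S \<subseteq> carrier L \<and> A = generate_ring L (k \<union> S))"

text \<open>The coordinate rings of the affine open subschemes of \<open>Y\<close>.\<close>

definition affine_charts ::
    "('a, 'm) ring_scheme \<Rightarrow> 'a set \<Rightarrow> 'a set \<Rightarrow> 'a set set \<Rightarrow> 'a set set" where
  "affine_charts L k F Y =
     {A. fin_gen_algebra L k A \<and> generate_field L A = F \<and> affine_model L A \<subseteq> Y}"

text \<open>
  An integral curve over \<open>k\<close> with function field \<open>F\<close>. The second condition is separatedness: distinct
  points are never dominated by a common local ring. The last one says that the scheme has
  dimension 1, the dimension of a scheme being the supremum of the dimensions of its local rings.
\<close>

definition curve :: "('a, 'm) ring_scheme \<Rightarrow> 'a set \<Rightarrow> 'a set \<Rightarrow> 'a set set \<Rightarrow> bool" where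
  "curve L k F C \<longleftrightarrow>
     (\<exists>\<A>. finite \<A> \<and> \<A> \<subseteq> affine_charts L k F C \<and> C = (\<Union>A \<in> \<A>. affine_model L A)) \<and>
     (\<forall>P \<in> C. \<forall>Q \<in> C. P \<noteq> Q \<longrightarrow>
        \<not> (\<exists>R. subring R L \<and> local_ring (L\<lparr>carrier := R\<rparr>) \<and> lies_over L R P \<and> lies_over L R Q)) \<and>
     (SUP P \<in> C. krull_dim (L\<lparr>carrier := P\<rparr>)) = 1"

text \<open>The specializations of \<open>P\<close> are the points \<open>Q\<close> whose local ring is contained in that of \<open>P\<close>.\<close>

definition closed_point :: "'a set set \<Rightarrow> 'a set \<Rightarrow> bool" where
  "closed_point C P \<longleftrightarrow> P \<in> C \<and> (\<forall>Q \<in> C. Q \<subseteq> P \<longrightarrow> Q = P)"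


section \<open>Base change and geometric integrality\<close>

text \<open>
  For subrings \<open>A\<close> and \<open>B\<close> of \<open>L\<close> containing \<open>K\<close>, the tensor product of \<open>A\<close> and \<open>B\<close> over \<open>K\<close> is the
  free abelian group on \<open>A \<times> B\<close> modulo the subgroup generated by the following elements.
\<close>

definition tensor_relations ::
    "('a, 'm) ring_scheme \<Rightarrow> 'a set \<Rightarrow> 'a set \<Rightarrow> 'a set \<Rightarrow> ('a \<times> 'a \<Rightarrow>\<^sub>0 int) set" where
  "tensor_relations L K A B =
     {frag_of (a \<oplus>\<^bsub>L\<^esub> a', b) - frag_of (a, b) - frag_of (a', b) | a a' b.
        a \<in> A \<and> a' \<in> A \<and> b \<in> B} \<union>
     {frag_of (a, b \<oplus>\<^bsub>L\<^esub> b') - frag_of (a, b) - frag_of (a, b') | a b b'.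
        a \<in> A \<and> b \<in> B \<and> b' \<in> B} \<union>
     {frag_of (a \<otimes>\<^bsub>L\<^esub> c, b) - frag_of (a, c \<otimes>\<^bsub>L\<^esub> b) | a b c.
        a \<in> A \<and> b \<in> B \<and> c \<in> K}"

definition tensor_eval :: "('a, 'm) ring_scheme \<Rightarrow> ('a \<times> 'a \<Rightarrow>\<^sub>0 int) \<Rightarrow> 'a" where
  "tensor_eval L z =
     finsum L (\<lambda>(a, b). [Poly_Mapping.lookup z (a, b)] \<cdot>\<^bsub>L\<^esub> (a \<otimes>\<^bsub>L\<^esub> b)) (Poly_Mapping.keys z)"

text \<open>
  Injectivity of the ring homomorphism from the tensor product to \<open>L\<close> that sends the class of
  \<open>(a, b)\<close> to \<open>a \<otimes> b\<close>. Its image is the subring generated by \<open>A \<union> B\<close>.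
\<close>

definition tensor_embeds :: "('a, 'm) ring_scheme \<Rightarrow> 'a set \<Rightarrow> 'a set \<Rightarrow> 'a set \<Rightarrow> bool" where
  "tensor_embeds L K A B \<longleftrightarrow>
     {z \<in> carrier (free_Abelian_group (A \<times> B)). tensor_eval L z = \<zero>\<^bsub>L\<^esub>} =
     generate (free_Abelian_group (A \<times> B)) (tensor_relations L K A B)"

text \<open>
  \<open>C\<close> is geometrically integral over \<open>K\<close>, and \<open>L\<close> is the function field of its base change to the
  algebraic closure \<open>Kb\<close>: for each affine open \<open>Spec A\<close> of \<open>C\<close> the tensor product of \<open>A\<close> and \<open>Kb\<close>
  over \<open>K\<close> is a domain, namely a subring of the field \<open>L\<close>, and \<open>L\<close> is the compositum of \<open>F\<close> and
  \<open>Kb\<close>, hence the fraction field of that domain.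
\<close>

definition geometrically_integral_curve ::
    "('a, 'm) ring_scheme \<Rightarrow> 'a set \<Rightarrow> 'a set \<Rightarrow> 'a set \<Rightarrow> 'a set set \<Rightarrow> bool" where
  "geometrically_integral_curve L K Kb F C \<longleftrightarrow>
     curve L K F C \<and> generate_field L (F \<union> Kb) = carrier L \<and>
     (\<forall>A \<in> affine_charts L K F C. tensor_embeds L K A Kb)"

text \<open>
  The fibre product is glued from the spectra of the tensor products of the coordinate rings \<open>A\<close>
  with \<open>Kb\<close>, which are identified with the subrings of \<open>L\<close> generated by \<open>A \<union> Kb\<close>.
\<close>

definition base_change ::
    "('a, 'm) ring_scheme \<Rightarrow> 'a set \<Rightarrow> 'a set \<Rightarrow> 'a set \<Rightarrow> 'a set set \<Rightarrow> 'a set set" where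
  "base_change L K Kb F C =
     (\<Union>A \<in> affine_charts L K F C. affine_model L (generate_ring L (A \<union> Kb)))"


section \<open>Normalization and valuations\<close>

definition integral_closure_in :: "('a, 'm) ring_scheme \<Rightarrow> 'a set \<Rightarrow> 'a set \<Rightarrow> 'a set" where
  "integral_closure_in L A F =
     {x \<in> F. \<exists>f \<in> carrier (A [X]\<^bsub>L\<^esub>). f \<noteq> [] \<and> lead_coeff f = \<one>\<^bsub>L\<^esub> \<and> ring.eval L f x = \<zero>\<^bsub>L\<^esub>}"

definition normalization ::
    "('a, 'm) ring_scheme \<Rightarrow> 'a set \<Rightarrow> 'a set \<Rightarrow> 'a set set \<Rightarrow> 'a set set" where
  "normalization L k F Y =
     (\<Union>A \<in> affine_charts L k F Y. affine_model L (integral_closure_in L A F))"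

text \<open>
  A normalized discrete valuation \<open>v\<close> of \<open>L|k\<close>. The value of \<open>v\<close> at zero, which should be infinite,
  is left unspecified and never used.
\<close>

definition normalized_discrete_valuation ::
    "('a, 'm) ring_scheme \<Rightarrow> 'a set \<Rightarrow> ('a \<Rightarrow> int) \<Rightarrow> bool" where
  "normalized_discrete_valuation L k v \<longleftrightarrow>
     (\<forall>x \<in> carrier L - {\<zero>\<^bsub>L\<^esub>}. \<forall>y \<in> carrier L - {\<zero>\<^bsub>L\<^esub>}.
        v (x \<otimes>\<^bsub>L\<^esub> y) = v x + v y \<and>
        (x \<oplus>\<^bsub>L\<^esub> y \<noteq> \<zero>\<^bsub>L\<^esub> \<longrightarrow> min (v x) (v y) \<le> v (x \<oplus>\<^bsub>L\<^esub> y))) \<and>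
     (\<forall>c \<in> k - {\<zero>\<^bsub>L\<^esub>}. v c = 0) \<and>
     v ` (carrier L - {\<zero>\<^bsub>L\<^esub>}) = UNIV"

definition valuation_ring :: "('a, 'm) ring_scheme \<Rightarrow> ('a \<Rightarrow> int) \<Rightarrow> 'a set" where
  "valuation_ring L v = {x \<in> carrier L. x = \<zero>\<^bsub>L\<^esub> \<or> 0 \<le> v x}"

definition value_semigroup :: "('a, 'm) ring_scheme \<Rightarrow> ('a \<Rightarrow> int) \<Rightarrow> 'a set \<Rightarrow> int set" where
  "value_semigroup L v P = v ` (P - {\<zero>\<^bsub>L\<^esub>})"

end

theory Submission
  imports Defs
begin

text \<open>
  Let \<open>V\<close> be the valuation ring of \<open>v\<close>, let \<open>m\<close> be the maximal ideal of \<open>P\<close>, and let \<open>x \<in> P\<close> have value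
  \<open>d\<close>, the residue degree. The residue field of \<open>V\<close> is \<open>Kb\<close>, so that \<open>V / x V\<close> has \<open>Kb\<close>-length \<open>d\<close>. The
  \<open>Kb\<close>-span \<open>N\<close> of \<open>P\<close> has finite colength in \<open>V\<close>; comparing \<open>N / x\<^sup>j N\<close> with \<open>V / x\<^sup>j V\<close> for large \<open>j\<close>
  shows that \<open>N / x N\<close> has length at most \<open>d\<close> as well. If \<open>x P\<close> were smaller than \<open>m\<close>, there would be a
  chain of \<open>K\<close>-subspaces from \<open>x P\<close> via \<open>m\<close> to \<open>P\<close> with \<open>d + 1\<close> strict steps. Geometric integrality makes
  \<open>Kb\<close> linearly disjoint from the function field of \<open>C\<close> over \<open>K\<close>, so the steps stay strict in the
  \<open>Kb\<close>-spans, a contradiction. Hence \<open>m\<close> is generated by \<open>x\<close>.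

  The colength of \<open>N\<close> is finite for two reasons. A valuation ring that dominates \<open>P\<close> dominates a point of
  the normalization over \<open>P\<close>, hence contains \<open>V\<close> because that point is unique; therefore \<open>V\<close> is integral
  over \<open>P\<close>. And the coordinate ring of an affine curve has finite colength in its integral closure, as
  one sees by counting the functions with poles of bounded order at infinity.
\<close>

section \<open>Valuation rings and integrality\<close>

text \<open>Everything is expressed through valuation rings of the whole ambient field: Chevalley's
  extension theorem replaces the lying-over theorems, and Zariski's lemma is deduced from it as
  well. The obstacle is that \<open>P\<close>, \<open>V\<close> and their spans are
  infinite-dimensional and that no length is known to be finite beforehand. Upper bounds on lengths
  are therefore bounds on all strict chains of subspaces (\<open>len_le\<close>), lower bounds are
  explicit chains (\<open>flag\<close>). The power \<open>j\<close> makes the unknown colength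
  \<open>e\<close> of the span negligible: a chain of length \<open>n\<close> from
  \<open>x N\<close> to \<open>N\<close> yields \<open>j n \<le> e + j d\<close>, and
  \<open>j = e + 1\<close> already forces \<open>n \<le> d\<close>. That the residue field of
  \<open>V\<close> is \<open>Kb\<close> also comes from finiteness: a residue class outside
  \<open>Kb\<close> would have independent powers and hence arbitrarily long chains. Valuation rings
  over \<open>P\<close> are automatically valuation rings over \<open>Kb\<close>, because
  \<open>Kb\<close> is algebraic over \<open>K\<close>. Once the maximal ideal is generated by
  \<open>x\<close>, an element of least value generates any given ideal, which makes
  \<open>P\<close> Noetherian.\<close>

context field
begin

lemma inv_nz [simp]:
  assumes "x \<in> carrier R" "x \<noteq> \<zero>"
  shows "inv x \<in> carrier R" "inv x \<noteq> \<zero>" "x \<otimes> inv x = \<one>" "inv x \<otimes> x = \<one>" "inv (inv x) = x"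
proof -
  have u: "x \<in> Units R" using assms field_Units by auto
  show "inv x \<in> carrier R" "x \<otimes> inv x = \<one>" "inv x \<otimes> x = \<one>" "inv (inv x) = x"
    using u by auto
  then show "inv x \<noteq> \<zero>" using assms by (metis r_null zero_not_one)
qed

lemma mult_inv_cancel [simp]:
  assumes "x \<in> carrier R" "x \<noteq> \<zero>" "y \<in> carrier R"
  shows "x \<otimes> (inv x \<otimes> y) = y" "inv x \<otimes> (x \<otimes> y) = y"
    "y \<otimes> x \<otimes> inv x = y" "y \<otimes> inv x \<otimes> x = y"
  using assms by (simp_all flip: m_assoc) (simp_all add: m_assoc)

lemma pow_nz [simp]: "x \<in> carrier R \<Longrightarrow> x \<noteq> \<zero> \<Longrightarrow> x [^] (n::nat) \<noteq> \<zero>"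
  by (induction n) (auto simp: integral_iff)

lemma mult_nz: "x \<in> carrier R \<Longrightarrow> y \<in> carrier R \<Longrightarrow> x \<noteq> \<zero> \<Longrightarrow> y \<noteq> \<zero> \<Longrightarrow> x \<otimes> y \<noteq> \<zero>"
  using integral_iff by blast

lemma inv_mult_field:
  assumes "x \<in> carrier R" "x \<noteq> \<zero>" "y \<in> carrier R" "y \<noteq> \<zero>"
  shows "inv (x \<otimes> y) = inv x \<otimes> inv y"
proof -
  have "x \<otimes> y \<in> Units R" "x \<in> Units R" "y \<in> Units R" using assms field_Units integral_iff by auto
  moreover have "(inv x \<otimes> inv y) \<otimes> (x \<otimes> y) = (inv x \<otimes> x) \<otimes> (inv y \<otimes> y)"
    using assms by (simp add: m_ac)
  ultimately show ?thesis using assms by (intro inv_unique' [symmetric]) (auto simp: m_ac)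
qed

lemma eq_mult_inv_iff:
  assumes "x \<in> carrier R" "x \<noteq> \<zero>" "y \<in> carrier R" "z \<in> carrier R"
  shows "y = z \<otimes> inv x \<longleftrightarrow> y \<otimes> x = z"
  using assms by auto

text \<open>The ambient field itself is allowed, as the trivial valuation ring.\<close>

definition valring :: "'a set \<Rightarrow> bool" where
  "valring W \<longleftrightarrow> subring W R \<and> (\<forall>x \<in> carrier R - {\<zero>}. x \<in> W \<or> inv x \<in> W)"

text \<open>The alternative \<open>x = \<zero>\<close> is explicit because
  \<open>inv \<zero>\<close> is an unspecified value. The set makes sense for every subring; it is
  an ideal exactly when the ring is local.\<close>

definition nonunits :: "'a set \<Rightarrow> 'a set" where
  "nonunits W = {x \<in> W. x = \<zero> \<or> inv x \<notin> W}"

lemma valringE: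
  assumes "valring W"
  shows "subring W R" "\<And>x. x \<in> carrier R \<Longrightarrow> x \<notin> W \<Longrightarrow> x \<noteq> \<zero> \<and> inv x \<in> W"
  using assms subringE(2) unfolding valring_def by blast+

lemma nonunits_zero: "subring W R \<Longrightarrow> \<zero> \<in> nonunits W"
  by (simp add: nonunits_def subringE)

lemma one_notin_nonunits: "subring W R \<Longrightarrow> \<one> \<notin> nonunits W"
  by (simp add: nonunits_def subringE)

lemma nonunits_mult:
  assumes W: "subring W R" and x: "x \<in> nonunits W" and w: "w \<in> W"
  shows "w \<otimes> x \<in> nonunits W"
proof (rule ccontr)
  have c: "x \<in> carrier R" "w \<in> carrier R" "x \<in> W" using assms subringE(1)[OF W] by (auto simp: nonunits_def)
  assume "w \<otimes> x \<notin> nonunits W"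
  then have nz: "w \<otimes> x \<noteq> \<zero>" "inv (w \<otimes> x) \<in> W"
    using subringE(6)[OF W w] c by (auto simp: nonunits_def)
  then have "w \<noteq> \<zero>" "x \<noteq> \<zero>" using c by auto
  then have "inv x = inv (w \<otimes> x) \<otimes> w" using c by (simp add: inv_mult_field m_ac)
  then have "inv x \<in> W" using subringE(6)[OF W nz(2) w] by simp
  then show False using x \<open>x \<noteq> \<zero>\<close> by (simp add: nonunits_def)
qed

lemma nonunits_mult':
  assumes W: "subring W R" and x: "x \<in> nonunits W" and w: "w \<in> W"
  shows "x \<otimes> w \<in> nonunits W"
proof -
  have "x \<in> carrier R" "w \<in> carrier R" using assms subringE(1)[OF W] by (auto simp: nonunits_def)
  then have "x \<otimes> w = w \<otimes> x" by (rule m_comm)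
  then show ?thesis using nonunits_mult[OF assms] by metis
qed

text \<open>One of \<open>x / y\<close> and \<open>y / x\<close> lies in \<open>W\<close>, so the
  sum is a \<open>W\<close>-multiple of \<open>y\<close> or of \<open>x\<close>. This is the point
  where the valuation property makes \<open>W\<close> local.\<close>

lemma nonunits_add:
  assumes W: "valring W" and x: "x \<in> nonunits W" and y: "y \<in> nonunits W"
  shows "x \<oplus> y \<in> nonunits W"
proof -
  note sub = valringE(1)[OF W]
  have c: "x \<in> carrier R" "y \<in> carrier R" "x \<in> W" "y \<in> W" using assms subringE(1)[OF sub]
    by (auto simp: nonunits_def)
  consider "x = \<zero>" | "y = \<zero>" | "x \<noteq> \<zero>" "y \<noteq> \<zero>" by blast
  then show ?thesis
  proof cases
    case 3
    have *: "x \<otimes> inv y \<in> W \<or> y \<otimes> inv x \<in> W"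
    proof (cases "x \<otimes> inv y \<in> W")
      case False
      then have "inv (x \<otimes> inv y) \<in> W" using valringE(2)[OF W, of "x \<otimes> inv y"] c 3 by auto
      then show ?thesis using c 3 by (simp add: inv_mult_field m_ac)
    qed auto
    have 1: "x \<oplus> y = (x \<otimes> inv y \<oplus> \<one>) \<otimes> y" "x \<oplus> y = (\<one> \<oplus> y \<otimes> inv x) \<otimes> x"
      using c 3 by (simp_all add: l_distr)
    from * show ?thesis
    proof
      assume "x \<otimes> inv y \<in> W"
      then have "x \<otimes> inv y \<oplus> \<one> \<in> W" using subringE(3,7)[OF sub] by blast
      then show ?thesis unfolding 1(1) by (rule nonunits_mult[OF sub y])
    next
      assume "y \<otimes> inv x \<in> W"
      then have "\<one> \<oplus> y \<otimes> inv x \<in> W" using subringE(3,7)[OF sub] by blast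
      then show ?thesis unfolding 1(2) by (rule nonunits_mult[OF sub x])
    qed
  qed (use c x y in auto)
qed

lemma nonunits_minus:
  assumes W: "subring W R" and x: "x \<in> nonunits W"
  shows "\<ominus> x \<in> nonunits W"
proof -
  have "x \<in> carrier R" using assms subringE(1)[OF W] by (auto simp: nonunits_def)
  then have "\<ominus> x = (\<ominus> \<one>) \<otimes> x" by algebra
  then show ?thesis using nonunits_mult[OF W x subringE(5)[OF W subringE(3)[OF W]]] by metis
qed

lemma unitsD:
  assumes "x \<in> W" "x \<notin> nonunits W"
  shows "x \<noteq> \<zero>" "inv x \<in> W"
  using assms by (auto simp: nonunits_def)

lemma nonunits_prime:
  assumes W: "subring W R" and "x \<in> W" "y \<in> W" "x \<otimes> y \<in> nonunits W"
  shows "x \<in> nonunits W \<or> y \<in> nonunits W"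
proof (rule ccontr)
  assume "\<not> ?thesis"
  then have "x \<noteq> \<zero>" "y \<noteq> \<zero>" "inv x \<in> W" "inv y \<in> W" using assms unitsD by auto
  then show False using assms subringE(1,6)[OF W]
    by (auto simp: nonunits_def inv_mult_field integral_iff subset_iff)
qed

lemma inv_nonunit: "x \<in> nonunits W \<Longrightarrow> x \<noteq> \<zero> \<Longrightarrow> inv x \<notin> W"
  by (auto simp: nonunits_def)

lemma valring_notin:
  assumes "valring W" "x \<in> carrier R" "x \<notin> W"
  shows "x \<noteq> \<zero>" "inv x \<in> nonunits W"
  using valringE(2)[OF assms] assms by (auto simp: nonunits_def)

section \<open>Extended ideals and Chevalley's extension theorem\<close>

text \<open>The ideal of \<open>W\<close> generated by \<open>I\<close>, built one term at a time. A
  membership involves finitely many elements of \<open>W\<close> and is monotone in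
  \<open>W\<close>; hence the condition that \<open>\<one>\<close> is not a member passes to unions
  of chains, as Zorn's lemma demands.\<close>

inductive_set extended_ideal :: "'a set \<Rightarrow> 'a set \<Rightarrow> 'a set" for W I where
  zero: "\<zero> \<in> extended_ideal W I"
| lin: "i \<in> I \<Longrightarrow> w \<in> W \<Longrightarrow> h \<in> extended_ideal W I \<Longrightarrow> i \<otimes> w \<oplus> h \<in> extended_ideal W I"

lemma extended_ideal_subset:
  assumes "subring W R" "I \<subseteq> W"
  shows "extended_ideal W I \<subseteq> W"
proof
  fix x assume "x \<in> extended_ideal W I"
  then show "x \<in> W" by induction (use assms subringE(2,6,7)[OF assms(1)] in auto)
qed

lemma extended_ideal_mono:
  assumes W: "W \<subseteq> W'"
  shows "extended_ideal W I \<subseteq> extended_ideal W' I"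
proof
  fix x assume "x \<in> extended_ideal W I"
  then show "x \<in> extended_ideal W' I"
    by induction (use W in \<open>auto intro: extended_ideal.intros\<close>)
qed

lemma extended_ideal_add:
  assumes "subring W R" "I \<subseteq> W" "x \<in> extended_ideal W I" "y \<in> extended_ideal W I"
  shows "x \<oplus> y \<in> extended_ideal W I"
  using assms(3)
proof induction
  case zero
  then show ?case using assms extended_ideal_subset subringE(1) by (metis l_zero subsetD)
next
  case (lin i w h)
  then have "i \<in> carrier R" "w \<in> carrier R" "h \<in> carrier R" "y \<in> carrier R"
    using assms extended_ideal_subset[OF assms(1,2)] subringE(1)[OF assms(1)] by auto
  then have "i \<otimes> w \<oplus> h \<oplus> y = i \<otimes> w \<oplus> (h \<oplus> y)" by (simp add: a_assoc)
  then show ?case using lin extended_ideal.lin by metis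
qed

lemma extended_ideal_mult:
  assumes "subring W R" "I \<subseteq> W" "x \<in> extended_ideal W I" "y \<in> W"
  shows "y \<otimes> x \<in> extended_ideal W I"
  using assms(3)
proof induction
  case zero
  then show ?case using assms subringE(1) extended_ideal.zero by (metis r_null subsetD)
next
  case (lin i w h)
  then have "i \<in> carrier R" "w \<in> carrier R" "h \<in> carrier R" "y \<in> carrier R"
    using assms extended_ideal_subset[OF assms(1,2)] subringE(1)[OF assms(1)] by auto
  then have "y \<otimes> (i \<otimes> w \<oplus> h) = i \<otimes> (y \<otimes> w) \<oplus> y \<otimes> h" by algebra
  then show ?case using lin extended_ideal.lin subringE(6)[OF assms(1)] assms(4) by metis
qed

lemma extended_ideal_incl:
  assumes "subring W R" "I \<subseteq> W"
  shows "I \<subseteq> extended_ideal W I"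
proof
  fix i assume i: "i \<in> I"
  then have "i \<otimes> \<one> \<oplus> \<zero> \<in> extended_ideal W I"
    using extended_ideal.intros subringE(3)[OF assms(1)] by metis
  then show "i \<in> extended_ideal W I" using i assms subringE(1)[OF assms(1)] by auto
qed

text \<open>Here \<open>simple_extension J x\<close> is the set of values at \<open>x\<close> of polynomials with coefficients
  in \<open>J\<close>, where \<open>J\<close> is an ideal rather than a ring.\<close>

lemma extended_ideal_simple_extension:
  assumes W: "subring W R" and I: "I \<subseteq> W" and x: "x \<in> carrier R"
  shows "extended_ideal (simple_extension W x) I \<subseteq> simple_extension (extended_ideal W I) x"
proof -
  define J where "J = extended_ideal W I"
  define E where "E = simple_extension J x"
  have Jc: "J \<subseteq> carrier R" using extended_ideal_subset[OF W I] subringE(1)[OF W] by (auto simp: J_def)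
  have Ec: "E \<subseteq> carrier R" unfolding E_def using simple_extension_in_carrier[OF Jc x] .
  have Ep: "J \<subseteq> E" unfolding E_def using simple_extension_incl[OF Jc x] .
  have J0: "\<zero> \<in> J" by (simp add: J_def extended_ideal.zero)
  have Eadd: "a \<oplus> b \<in> E" if "a \<in> E" "b \<in> E" for a b
    using that unfolding E_def
  proof (induction arbitrary: b)
    case zero then show ?case using Ec by (auto simp: E_def)
  next
    case (lin k1 k2)
    show ?case using lin(4)
    proof cases
      case zero
      then show ?thesis using lin Ec Jc x simple_extension.lin by (auto simp: E_def subset_iff)
    next
      case (lin l1 l2)
      have "k1 \<in> carrier R" "l1 \<in> carrier R" "k2 \<in> carrier R" "l2 \<in> carrier R"
        using lin \<open>k1 \<in> _\<close> \<open>k2 \<in> _\<close> Ec Jc by (auto simp: E_def)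
      then have "k1 \<otimes> x \<oplus> k2 \<oplus> b = (k1 \<oplus> l1) \<otimes> x \<oplus> (k2 \<oplus> l2)"
        using lin x by algebra
      moreover have "k2 \<oplus> l2 \<in> J" using lin \<open>k2 \<in> J\<close> extended_ideal_add[OF W I] by (simp add: J_def)
      ultimately show ?thesis
        using simple_extension.lin[of "k1 \<oplus> l1" J x "k2 \<oplus> l2"] lin \<open>\<And>b. _ \<Longrightarrow> k1 \<oplus> b \<in> _\<close> by auto
    qed
  qed
  have Ex: "a \<otimes> x \<in> E" if "a \<in> E" for a
    using simple_extension.lin[of a J x \<zero>] that J0 Ec x by (auto simp: E_def)
  have Ew: "a \<otimes> w \<in> E" if "a \<in> E" "w \<in> W" for a w
    using that(1) unfolding E_def
  proof induction
    case zero
    then show ?case using that subringE(1)[OF W] by auto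
  next
    case (lin k1 k2)
    have "k1 \<in> carrier R" "k2 \<in> carrier R" "w \<in> carrier R"
      using lin Ec Jc that subringE(1)[OF W] by (auto simp: E_def)
    then have "(k1 \<otimes> x \<oplus> k2) \<otimes> w = (k1 \<otimes> w) \<otimes> x \<oplus> w \<otimes> k2" using x by algebra
    moreover have "w \<otimes> k2 \<in> J" using lin(2) extended_ideal_mult[OF W I _ that(2)] by (simp add: J_def)
    ultimately show ?case using simple_extension.lin[OF lin(3)] by simp
  qed
  have Er: "a \<otimes> r \<in> E" if r: "r \<in> simple_extension W x" and a: "a \<in> E" for a r
    using r
  proof induction
    case zero
    have "a \<otimes> \<zero> = \<zero>" using a Ec by auto
    then show ?case using J0 Ep by auto
  next
    case (lin k1 k2)
    have "k1 \<in> carrier R" "k2 \<in> carrier R" "a \<in> carrier R"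
      using lin Ec a simple_extension_in_carrier[OF subringE(1)[OF W] x] subringE(1)[OF W] by auto
    then have "a \<otimes> (k1 \<otimes> x \<oplus> k2) = (a \<otimes> k1) \<otimes> x \<oplus> a \<otimes> k2" using x by algebra
    then show ?case using Eadd Ex Ew a lin by auto
  qed
  have "h \<in> E" if "h \<in> extended_ideal (simple_extension W x) I" for h
    using that
  proof induction
    case zero
    then show ?case using J0 Ep by auto
  next
    case (lin i w h)
    have "i \<in> E" using lin extended_ideal_incl[OF W I] Ep J_def by auto
    then show ?case using Er Eadd lin by auto
  qed
  then show ?thesis unfolding E_def J_def by auto
qed

text \<open>Raw coefficient lists replace normalized polynomials from here on: the head may be zero,
  and the coefficients may come from an ideal \<open>J\<close>, for which there is no polynomial
  ring.\<close>

lemma simple_extension_eval: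
  assumes "J \<subseteq> carrier R" "x \<in> carrier R" "h \<in> simple_extension J x"
  obtains cs where "set cs \<subseteq> J" "eval cs x = h"
proof -
  obtain p where "p \<in> carrier (J[X])" "eval p x = h"
    using simple_extension_as_eval_img[OF assms(1,2)] assms(3) by auto
  then show thesis using that polynomial_incl[of J p] univ_poly_carrier[of R J p] by auto
qed

lemma eval_Cons: "eval (c # cs) x = c \<otimes> x [^] length cs \<oplus> eval cs x"
  by simp

text \<open>The reciprocal polynomial. A list of length \<open>n\<close> has formal degree
  \<open>n - 1\<close>; the extra factor \<open>x\<close> on the left avoids the subtraction, so the
  empty list needs no exception.\<close>

lemma eval_rev:
  assumes "set cs \<subseteq> carrier R" "x \<in> carrier R" "x \<noteq> \<zero>"
  shows "x \<otimes> eval (rev cs) x = x [^] length cs \<otimes> eval cs (inv x)"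
  using assms(1)
proof (induction cs)
  case (Cons c cs)
  have c: "c \<in> carrier R" "eval (rev cs) x \<in> carrier R" "eval cs (inv x) \<in> carrier R"
    using Cons assms eval_in_carrier by auto
  have "x \<otimes> eval (rev (c # cs)) x = x \<otimes> (eval (rev cs) x \<otimes> x \<oplus> c)"
    using eval_append_aux[of "rev cs" c x] Cons assms by auto
  also have "\<dots> = x \<otimes> c \<oplus> x \<otimes> (x \<otimes> eval (rev cs) x)" using c assms by algebra
  also have "\<dots> = x \<otimes> c \<oplus> x \<otimes> (x [^] length cs \<otimes> eval cs (inv x))" using Cons by auto
  also have "\<dots> = x [^] Suc (length cs) \<otimes> (c \<otimes> inv x [^] length cs \<oplus> eval cs (inv x))"
  proof -
    have "x [^] length cs \<otimes> inv x [^] length cs = \<one>"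
      using assms by (simp flip: nat_pow_distrib)
    then have "x \<otimes> c = x [^] Suc (length cs) \<otimes> (c \<otimes> inv x [^] length cs)"
      using c assms by (simp add: m_ac)
    then show ?thesis using c assms by (simp add: r_distr m_ac)
  qed
  finally show ?case by simp
qed (use assms in auto)

lemma eval_map_mult:
  assumes "set p \<subseteq> carrier R" "a \<in> carrier R" "x \<in> carrier R"
  shows "eval (map ((\<otimes>) a) p) x = a \<otimes> eval p x"
  using assms(1)
proof (induction p)
  case (Cons c p)
  then have "c \<in> carrier R" "eval p x \<in> carrier R" using assms eval_in_carrier by auto
  then show ?case using Cons assms by (simp add: r_distr m_assoc)
qed (use assms in auto)

lemma eval_replicate_zero: "x \<in> carrier R \<Longrightarrow> eval (replicate n \<zero>) x = \<zero>"
  using eval_replicate[of "[]" x n] by simp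

lemma eval_extended_ideal:
  assumes "subring W R" "I \<subseteq> W" "set cs \<subseteq> extended_ideal W I" "x \<in> W"
  shows "eval cs x \<in> extended_ideal W I"
  using assms(3)
proof (induction cs)
  case (Cons c cs)
  have "x [^] n \<in> W" for n :: nat
    using assms(4) subringE(3,6)[OF assms(1)] by (induction n) auto
  moreover have "c \<in> carrier R" using Cons assms extended_ideal_subset[OF assms(1,2)] subringE(1)[OF assms(1)] by auto
  moreover have "x [^] n \<in> carrier R" for n :: nat using assms(4) subringE(1)[OF assms(1)] by auto
  ultimately have "c \<otimes> x [^] n \<in> extended_ideal W I" for n :: nat
    using Cons(2) extended_ideal_mult[OF assms(1,2), of c "x [^] n"] m_comm[of c "x [^] n"] by auto
  then show ?case using Cons extended_ideal_add[OF assms(1,2)] by auto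
qed (auto intro: extended_ideal.zero)

text \<open>The classical descent behind Chevalley's theorem. Since
  \<open>\<one> \<ominus> b\<close> is a unit for the constant coefficient \<open>b\<close> of
  \<open>bs\<close>, the relation in \<open>inv x\<close> expresses a power of \<open>x\<close>
  through lower powers with coefficients in the ideal. Substituting this for the leading power in
  the longer relation \<open>as\<close> makes it shorter.\<close>

lemma no_two_sided_relation:
  assumes W: "subring W R" and I: "I \<subseteq> W"
    and units: "\<And>j. j \<in> extended_ideal W I \<Longrightarrow> \<one> \<ominus> j \<noteq> \<zero> \<and> inv (\<one> \<ominus> j) \<in> W"
  shows "x \<in> carrier R \<Longrightarrow> x \<noteq> \<zero> \<Longrightarrow> set as \<subseteq> extended_ideal W I \<Longrightarrow> set bs \<subseteq> extended_ideal W I \<Longrightarrow>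
    eval as x = \<one> \<Longrightarrow> eval bs (inv x) = \<one> \<Longrightarrow> False"
proof (induction "length as + length bs" arbitrary: as bs x rule: less_induct)
  case less
  let ?J = "extended_ideal W I"
  have Jc: "?J \<subseteq> carrier R" using extended_ideal_subset[OF W I] subringE(1)[OF W] by auto
  \<comment> \<open>The situation is symmetric under exchanging \<open>x\<close> with
    \<open>inv x\<close>, so only the case where \<open>as\<close> is at least as long is treated.
    The lists \<open>as0\<close> and \<open>bs0\<close> fix the induction measure, so that both
    orientations can use it.\<close>
  have main: False
    if x: "x \<in> carrier R" "x \<noteq> \<zero>" and J: "set as \<subseteq> ?J" "set bs \<subseteq> ?J"
      and e: "eval as x = \<one>" "eval bs (inv x) = \<one>"
      and le: "length bs \<le> length as" and len: "length as + length bs = length as0 + length bs0"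
      and hyp: "\<And>as bs x. length as + length bs < length as0 + length bs0 \<Longrightarrow> x \<in> carrier R \<Longrightarrow> x \<noteq> \<zero> \<Longrightarrow>
         set as \<subseteq> ?J \<Longrightarrow> set bs \<subseteq> ?J \<Longrightarrow> eval as x = \<one> \<Longrightarrow> eval bs (inv x) = \<one> \<Longrightarrow> False"
    for x as bs as0 bs0
  proof -
    have "as \<noteq> []" "bs \<noteq> []" using e by auto
    then obtain a as' b bs' where as: "as = a # as'" and bs: "bs = bs' @ [b]"
      by (metis neq_Nil_conv rev_exhaust)
    have c: "a \<in> carrier R" "b \<in> carrier R" "set as' \<subseteq> carrier R" "set bs' \<subseteq> carrier R"
      using J Jc as bs by auto
    define s where "s = \<one> \<ominus> b"
    have s: "s \<noteq> \<zero>" "inv s \<in> W" "s \<in> carrier R" using units[of b] J bs c by (auto simp: s_def)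
    have ev: "eval bs' (inv x) \<in> carrier R" using c x eval_in_carrier by auto
    have "eval bs' (inv x) \<otimes> inv x \<oplus> b = \<one>"
      using e(2) eval_append_aux[of bs' b "inv x"] c x bs by auto
    then have sx: "eval bs' (inv x) \<otimes> inv x = s"
      unfolding s_def using c ev x by (metis add.m_assoc inv_nz(1) m_closed minus_eq r_neg r_zero a_inv_closed)
    define ds where "ds = map ((\<otimes>) (inv s)) bs'"
    have ds: "set ds \<subseteq> ?J" "length ds = length bs'"
      using J bs extended_ideal_mult[OF W I _ s(2)] by (auto simp: ds_def)
    then have dsc: "set ds \<subseteq> carrier R" "set (rev ds) \<subseteq> carrier R" using Jc by auto
    have "eval ds (inv x) = inv s \<otimes> eval bs' (inv x)" using eval_map_mult c x s by (simp add: ds_def)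
    also have "eval bs' (inv x) = s \<otimes> x" using sx x ev by auto
    finally have dsx: "eval ds (inv x) = x" using x s by auto
    have "x \<otimes> eval (rev ds) x = x \<otimes> x [^] length ds"
      using eval_rev[OF dsc(1) x] x unfolding dsx by (simp add: m_comm)
    then have rds: "eval (rev ds) x = x [^] length ds"
      using x dsc(2) m_lcancel eval_in_carrier by auto
    \<comment> \<open>Multiplication by \<open>x [^] k\<close> shifts the expression for
      \<open>x [^] length ds\<close> to the exponent \<open>length as'\<close>, which is that of the
      leading term of \<open>as\<close>.\<close>
    define k where "k = length as' - length ds"
    have k: "length as' = length ds + k" using le as bs ds k_def by auto
    define es where "es = map ((\<otimes>) a) (rev ds) @ replicate k \<zero>"
    have esl: "length es = length as'" using k by (simp add: es_def)
    have aJ: "a \<in> ?J" using J as by auto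
    have esJ: "set es \<subseteq> ?J"
    proof -
      have "a \<in> W" using aJ extended_ideal_subset[OF W I] by auto
      then have "a \<otimes> z \<in> ?J" if "z \<in> set ds" for z using extended_ideal_mult[OF W I] ds(1) that by auto
      then show ?thesis using extended_ideal.zero[of W I] by (auto simp: es_def)
    qed
    have ese: "eval es x = a \<otimes> x [^] length as'"
    proof -
      have 1: "set (map ((\<otimes>) a) (rev ds)) \<subseteq> carrier R" using dsc c by auto
      have "set (replicate k \<zero>) \<subseteq> carrier R" by auto
      then have "eval es x = eval (map ((\<otimes>) a) (rev ds)) x \<otimes> x [^] k \<oplus> \<zero>"
        unfolding es_def using eval_append[OF 1 _ x(1), of "replicate k \<zero>"] eval_replicate_zero[OF x(1)] by simp
      also have "eval (map ((\<otimes>) a) (rev ds)) x = a \<otimes> x [^] length ds"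
        using eval_map_mult[OF dsc(2) c(1) x(1)] rds by simp
      finally show ?thesis using x c k by (simp add: m_assoc nat_pow_mult)
    qed
    define fs where "fs = poly_add es as'"
    have fe: "fs = normalize (map2 (\<oplus>) es as')" using esl by (simp add: fs_def)
    have "set (map2 (\<oplus>) es as') \<subseteq> ?J"
    proof
      fix z assume "z \<in> set (map2 (\<oplus>) es as')"
      then obtain p q where pq: "(p, q) \<in> set (zip es as')" "z = p \<oplus> q" by auto
      then have "p \<in> ?J" "q \<in> ?J" using esJ J as set_zip_leftD[OF pq(1)] set_zip_rightD[OF pq(1)] by auto
      then show "z \<in> ?J" using extended_ideal_add[OF W I] pq by simp
    qed
    then have fJ: "set fs \<subseteq> ?J" unfolding fe using normalize_gives_polynomial polynomial_incl by blast
    have fl: "length fs < length as"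
      unfolding fe using normalize_length_le[of "map2 (\<oplus>) es as'"] esl as by simp
    have "eval fs x = \<one>"
      unfolding fs_def using eval_poly_add[of es as' x] ese e(1) as esJ Jc c x by auto
    then show False using hyp[of fs bs x] fJ fl J x e len by auto
  qed
  show False
  proof (cases "length bs \<le> length as")
    case True
    show ?thesis by (rule main[of x as bs as bs]) (use less True in auto)
  next
    case False
    show ?thesis by (rule main[of "inv x" bs as as bs]) (use less False in auto)
  qed
qed

text \<open>Chevalley's extension theorem. A maximal subring above \<open>A\<close> in which
  \<open>I\<close> does not generate the unit ideal is a valuation ring: otherwise some
  \<open>x\<close> and \<open>inv x\<close> are both outside it, and maximality supplies the two
  relations excluded by \<open>no_two_sided_relation\<close>.\<close>

theorem valring_exists:
  assumes A: "subring A R" and I: "I \<subseteq> A" and one: "\<one> \<notin> extended_ideal A I"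
  obtains W where "valring W" "A \<subseteq> W" "I \<subseteq> nonunits W"
proof -
  define \<A> where "\<A> = {W. subring W R \<and> A \<subseteq> W \<and> \<one> \<notin> extended_ideal W I}"
  have "\<exists>M\<in>\<A>. \<forall>U\<in>\<A>. M \<subseteq> U \<longrightarrow> U = M"
  proof (rule subset_Zorn_nonempty)
    show "\<A> \<noteq> {}" using assms by (auto simp: \<A>_def)
    fix \<C> assume ne: "\<C> \<noteq> {}" and ch: "subset.chain \<A> \<C>"
    have sub: "\<And>W. W \<in> \<C> \<Longrightarrow> subring W R \<and> A \<subseteq> W \<and> \<one> \<notin> extended_ideal W I"
      using ch by (auto simp: subset.chain_def \<A>_def)
    have dir: "\<exists>W\<in>\<C>. U \<subseteq> W \<and> U1 \<subseteq> W" if "U \<in> \<C>" "U1 \<in> \<C>" for U U1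
    proof -
      have "U \<subseteq> U1 \<or> U1 \<subseteq> U" using ch that by (simp add: subset_chain_def)
      then show ?thesis using that by blast
    qed
    have dir2: "\<exists>W\<in>\<C>. x \<in> W \<and> y \<in> W" if xy: "x \<in> \<Union>\<C>" "y \<in> \<Union>\<C>" for x y
    proof -
      obtain U where "U \<in> \<C>" "x \<in> U" using xy by blast
      moreover obtain U1 where "U1 \<in> \<C>" "y \<in> U1" using xy by blast
      ultimately show ?thesis using dir[of U U1] by auto
    qed
    have 1: "subring (\<Union>\<C>) R"
    proof (rule subringI)
      show "\<Union>\<C> \<subseteq> carrier R" using subringE(1)[OF conjunct1[OF sub]] by auto
      show "\<one> \<in> \<Union>\<C>" using ne subringE(3)[OF conjunct1[OF sub]] by auto
      show "\<ominus> h \<in> \<Union>\<C>" if "h \<in> \<Union>\<C>" for h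
        using that subringE(5)[OF conjunct1[OF sub]] by auto
      show "h1 \<otimes> h2 \<in> \<Union>\<C>" if "h1 \<in> \<Union>\<C>" "h2 \<in> \<Union>\<C>" for h1 h2
        using dir2[OF that] subringE(6)[OF conjunct1[OF sub]] by auto
      show "h1 \<oplus> h2 \<in> \<Union>\<C>" if "h1 \<in> \<Union>\<C>" "h2 \<in> \<Union>\<C>" for h1 h2
        using dir2[OF that] subringE(7)[OF conjunct1[OF sub]] by auto
    qed
    have 2: "A \<subseteq> \<Union>\<C>" using ne sub by blast
    have "\<exists>W\<in>\<C>. h \<in> extended_ideal W I" if "h \<in> extended_ideal (\<Union>\<C>) I" for h
      using that
    proof induction
      case zero
      then show ?case using ne extended_ideal.zero by blast
    next
      case (lin i w h)
      then obtain U U1 where "U \<in> \<C>" "w \<in> U" "U1 \<in> \<C>" "h \<in> extended_ideal U1 I" by auto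
      then obtain U2 where "U2 \<in> \<C>" "w \<in> U2" "h \<in> extended_ideal U2 I"
        using dir[of U U1] extended_ideal_mono by (meson subsetD)
      then show ?case using lin(1) extended_ideal.lin by blast
    qed
    then show "\<Union>\<C> \<in> \<A>" using 1 2 sub by (auto simp: \<A>_def)
  qed
  then obtain W where W: "subring W R" "A \<subseteq> W" "\<one> \<notin> extended_ideal W I"
    and max: "\<And>U. U \<in> \<A> \<Longrightarrow> W \<subseteq> U \<Longrightarrow> U = W" by (auto simp: \<A>_def)
  have IW: "I \<subseteq> W" using I W by auto
  let ?J = "extended_ideal W I"
  have Jc: "?J \<subseteq> carrier R" using extended_ideal_subset[OF W(1) IW] subringE(1)[OF W(1)] by auto
  \<comment> \<open>By maximality \<open>I\<close> generates the unit ideal of the ring obtained by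
    adjoining \<open>x\<close>; collecting powers of \<open>x\<close> gives a relation whose
    coefficients lie in the extended ideal.\<close>
  have ext: "\<exists>cs. set cs \<subseteq> ?J \<and> eval cs x = \<one>" if x: "x \<in> carrier R" "x \<notin> W" for x
  proof -
    let ?W' = "simple_extension W x"
    have W': "subring ?W' R" "W \<subseteq> ?W'" "x \<in> ?W'"
      using simple_extension_is_subring[OF W(1) x(1)] simple_extension_incl[OF subringE(1)[OF W(1)] x(1)]
        simple_extension_mem[OF W(1) x(1)] by auto
    then have "?W' \<notin> \<A>" using max x by blast
    then have "\<one> \<in> extended_ideal ?W' I" using W W' by (auto simp: \<A>_def)
    then have "\<one> \<in> simple_extension ?J x" using extended_ideal_simple_extension[OF W(1) IW x(1)] by auto
    then show ?thesis using simple_extension_eval[OF Jc x(1)] by metis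
  qed
  have Jm: "y \<otimes> x \<in> ?J" if "x \<in> ?J" "y \<in> W" for x y
    using extended_ideal_mult[OF W(1) IW that] .
  have J1: "j \<in> ?J \<Longrightarrow> \<ominus> j \<in> ?J" for j
    using Jm[of j "\<ominus> \<one>"] subringE(3,5)[OF W(1)] Jc by (auto simp: l_minus)
  have units: "\<one> \<ominus> j \<noteq> \<zero> \<and> inv (\<one> \<ominus> j) \<in> W" if j: "j \<in> ?J" for j
  proof -
    define s where "s = \<one> \<ominus> j"
    have jc: "j \<in> carrier R" "j \<in> W" using j Jc extended_ideal_subset[OF W(1) IW] by auto
    have sW: "s \<in> W" "s \<in> carrier R" using jc subringE(3,5,7)[OF W(1)] by (auto simp: s_def a_minus_def)
    have s0: "s \<noteq> \<zero>"
    proof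
      assume "s = \<zero>"
      then have "\<one> = j" using jc by (simp add: s_def)
      then show False using j W by simp
    qed
    \<comment> \<open>Otherwise the relation for \<open>inv s\<close>, cleared of denominators, puts
      a power of \<open>s\<close> into the extended ideal. But \<open>s\<close> is congruent to
      \<open>\<one>\<close> modulo this ideal, and so are its powers.\<close>
    have "inv s \<in> W"
    proof (rule ccontr)
      assume "inv s \<notin> W"
      then obtain cs where cs: "set cs \<subseteq> ?J" "eval cs (inv s) = \<one>" using ext[of "inv s"] sW s0 by auto
      have csc: "set cs \<subseteq> carrier R" using cs Jc by auto
      have "s \<otimes> eval (rev cs) s = s [^] length cs"
        using eval_rev[OF csc sW(2) s0] cs sW by simp
      moreover have "eval (rev cs) s \<in> ?J"
        using eval_extended_ideal[OF W(1) IW _ sW(1), of "rev cs"] cs by auto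
      ultimately have p: "s [^] length cs \<in> ?J" using Jm sW by metis
      have pw: "\<one> \<ominus> s [^] n \<in> ?J" for n :: nat
      proof (induction n)
        case 0
        then show ?case using extended_ideal.zero by (simp add: minus_eq r_neg)
      next
        case (Suc n)
        have "\<one> \<ominus> s [^] Suc n = (\<one> \<ominus> s [^] n) \<oplus> s [^] n \<otimes> (\<one> \<ominus> s)"
        proof -
          define z where "z = s [^] n"
          have "z \<in> carrier R" using sW by (simp add: z_def)
          then have "\<one> \<ominus> z \<otimes> s = (\<one> \<ominus> z) \<oplus> z \<otimes> (\<one> \<ominus> s)" using sW(2) by algebra
          then show ?thesis by (simp add: z_def)
        qed
        moreover have "\<one> \<ominus> s = j" unfolding s_def using jc by algebra
        moreover have "s [^] n \<in> W" using sW subringE(3,6)[OF W(1)] by (induction n) auto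
        ultimately show ?case using Suc extended_ideal_add[OF W(1) IW] Jm j by metis
      qed
      have "s [^] length cs \<in> carrier R" using sW by simp
      then have "\<one> = (\<one> \<ominus> s [^] length cs) \<oplus> s [^] length cs" by algebra
      then show False using extended_ideal_add[OF W(1) IW pw p] W(3) by metis
    qed
    then show ?thesis using s0 by (simp add: s_def)
  qed
  have "valring W"
    unfolding valring_def
  proof (intro conjI ballI W(1))
    fix x assume x: "x \<in> carrier R - {\<zero>}"
    show "x \<in> W \<or> inv x \<in> W"
    proof (rule ccontr)
      assume "\<not> ?thesis"
      then obtain as bs where "set as \<subseteq> ?J" "eval as x = \<one>" "set bs \<subseteq> ?J" "eval bs (inv x) = \<one>"
        using ext[of x] ext[of "inv x"] x by auto
      then show False using no_two_sided_relation[OF W(1) IW units, of x as bs] x by auto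
    qed
  qed
  moreover have "I \<subseteq> nonunits W"
  proof
    fix i assume i: "i \<in> I"
    have "i = \<zero> \<or> inv i \<notin> W"
    proof (rule ccontr)
      assume "\<not> ?thesis"
      then have "inv i \<otimes> i \<in> ?J" "i \<noteq> \<zero>" using Jm i extended_ideal_incl[OF W(1) IW] by auto
      then show False using W(3) i IW subringE(1)[OF W(1)] by auto
    qed
    then show "i \<in> nonunits W" using i IW by (auto simp: nonunits_def)
  qed
  ultimately show thesis using that W by auto
qed

section \<open>Integral elements as the members of all valuation rings\<close>

text \<open>Dividing a polynomial in \<open>x\<close> by its top power leaves a polynomial in
  \<open>inv x\<close>. As in \<open>eval_rev\<close>, the factor \<open>x\<close> accounts for the
  length exceeding the degree by one.\<close>

lemma eval_inverse_in:
  assumes W: "subring W R" and x: "x \<in> carrier R" "x \<noteq> \<zero>" "inv x \<in> W" and cs: "set cs \<subseteq> W"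
  shows "\<exists>w\<in>W. eval cs x \<otimes> x = w \<otimes> x [^] length cs"
  using cs
proof (induction cs)
  case Nil
  then show ?case using x subringE(2)[OF W] by force
next
  case (Cons c cs)
  have Wc: "W \<subseteq> carrier R" using subringE(1)[OF W] .
  from Cons obtain w where w: "w \<in> W" "eval cs x \<otimes> x = w \<otimes> x [^] length cs" by auto
  have c: "c \<in> carrier R" "w \<in> carrier R" "eval cs x \<in> carrier R" "set cs \<subseteq> carrier R"
    using Cons w Wc x eval_in_carrier[of cs x] by auto
  have "eval (c # cs) x \<otimes> x = c \<otimes> x [^] length cs \<otimes> x \<oplus> w \<otimes> x [^] length cs"
    using c x w by (simp add: l_distr)
  also have "w \<otimes> x [^] length cs = w \<otimes> inv x \<otimes> (x [^] length cs \<otimes> x)"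
    using c x by (simp add: m_ac)
  finally have "eval (c # cs) x \<otimes> x = (c \<oplus> w \<otimes> inv x) \<otimes> x [^] length (c # cs)"
    using c x by (simp add: l_distr m_assoc)
  moreover have "c \<oplus> w \<otimes> inv x \<in> W" using Cons w x subringE(6,7)[OF W] by auto
  ultimately show ?case by blast
qed

text \<open>If \<open>x\<close> were outside \<open>W\<close>, dividing the equation by
  \<open>x [^] (length cs - 1)\<close> would give \<open>a \<otimes> x \<oplus> w = \<zero>\<close>
  with \<open>w \<in> W\<close>, and \<open>a\<close> is a unit. A unit as leading coefficient is
  allowed, not only \<open>\<one>\<close>, since leading coefficients often become units only in the
  valuation ring at hand.\<close>

lemma valring_root:
  assumes W: "valring W" and a: "a \<in> W" "a \<notin> nonunits W" and cs: "set cs \<subseteq> W"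
    and x: "x \<in> carrier R" "eval (a # cs) x = \<zero>"
  shows "x \<in> W"
proof (rule ccontr)
  assume "x \<notin> W"
  then have nz: "x \<noteq> \<zero>" "inv x \<in> W" using valringE(2)[OF W x(1)] by auto
  note sub = valringE(1)[OF W]
  have Wc: "W \<subseteq> carrier R" using subringE(1)[OF sub] .
  have "\<exists>w\<in>W. eval cs x \<otimes> x = w \<otimes> x [^] length cs" using eval_inverse_in[OF sub x(1) nz cs] .
  then obtain w where w: "w \<in> W" "eval cs x \<otimes> x = w \<otimes> x [^] length cs" by auto
  have c: "a \<in> carrier R" "w \<in> carrier R" "eval cs x \<in> carrier R" "x [^] length cs \<in> carrier R"
    using a w Wc x eval_in_carrier[of cs x] cs by auto
  have "\<zero> = (a \<otimes> x [^] length cs \<oplus> eval cs x) \<otimes> x" using x by simp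
  also have "\<dots> = (a \<otimes> x \<oplus> w) \<otimes> x [^] length cs"
  proof -
    have "(a \<otimes> x [^] length cs \<oplus> eval cs x) \<otimes> x = a \<otimes> x [^] length cs \<otimes> x \<oplus> w \<otimes> x [^] length cs"
      using c x(1) w(2) by (simp add: l_distr)
    also have "\<dots> = (a \<otimes> x \<oplus> w) \<otimes> x [^] length cs" using c x(1) by algebra
    finally show ?thesis .
  qed
  finally have "a \<otimes> x \<oplus> w = \<zero>"
    using c x(1) pow_nz[OF x(1) nz(1)] integral_iff[of "a \<otimes> x \<oplus> w" "x [^] length cs"] by (metis a_closed m_closed)
  then have "a \<otimes> x = \<ominus> w" using c x by (metis minus_equality m_closed a_comm)
  then have "x = inv a \<otimes> (\<ominus> w)" using c x unitsD[OF a] by (metis mult_inv_cancel(2))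
  then have "x \<in> W" using unitsD[OF a] w subringE(5,6)[OF sub] by metis
  then show False using \<open>x \<notin> W\<close> by simp
qed

definition integral_over :: "'a set \<Rightarrow> 'a \<Rightarrow> bool" where
  "integral_over A x \<longleftrightarrow> x \<in> carrier R \<and> (\<exists>cs. set cs \<subseteq> A \<and> eval (\<one> # cs) x = \<zero>)"

lemma integral_over_valring:
  assumes "integral_over A x" "valring W" "A \<subseteq> W"
  shows "x \<in> W"
  using assms valring_root[OF assms(2), of \<one>] subringE(3)[OF valringE(1)[OF assms(2)]]
    one_notin_nonunits[OF valringE(1)[OF assms(2)]]
  unfolding integral_over_def by (meson order_trans)

text \<open>With \<open>y = inv x\<close>, the elements of \<open>M\<close> together with
  \<open>y\<close> generate a proper ideal of \<open>A[y]\<close>, and a valuation ring in which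
  they are nonunits cannot contain \<open>x\<close>. For \<open>M = {}\<close> this characterizes
  integral elements; for a local ring and \<open>M\<close> its nonunits, the valuation ring can
  moreover be chosen to dominate.\<close>

lemma not_integral_valring:
  assumes A: "subring A R" and M: "M \<subseteq> A"
    and units: "\<And>m. m \<in> extended_ideal A M \<Longrightarrow> \<one> \<ominus> m \<noteq> \<zero> \<and> inv (\<one> \<ominus> m) \<in> A"
    and x: "x \<in> carrier R" "\<not> integral_over A x"
  obtains W where "valring W" "A \<subseteq> W" "M \<subseteq> nonunits W" "x \<notin> W"
proof -
  have Ac: "A \<subseteq> carrier R" using subringE(1)[OF A] .
  have x0: "x \<noteq> \<zero>"
  proof
    assume "x = \<zero>"
    then have "set [\<zero>] \<subseteq> A \<and> eval [\<one>, \<zero>] x = \<zero>" using subringE(2)[OF A] by simp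
    then show False using x unfolding integral_over_def by blast
  qed
  define y where "y = inv x"
  have y: "y \<in> carrier R" "y \<noteq> \<zero>" using x x0 by (auto simp: y_def)
  let ?A = "simple_extension A y"
  have A': "subring ?A R" "A \<subseteq> ?A" "y \<in> ?A"
    using simple_extension_is_subring[OF A y(1)] simple_extension_incl[OF Ac y(1)]
      simple_extension_mem[OF A y(1)] by auto
  have A'c: "?A \<subseteq> carrier R" using subringE(1)[OF A'(1)] .
  \<comment> \<open>Modulo \<open>y\<close> only constant terms remain, and those of the generators
    from \<open>M\<close> stay in the ideal that \<open>M\<close> generates in
    \<open>A\<close>.\<close>
  have ideal_form: "\<exists>g\<in>?A. \<exists>m\<in>extended_ideal A M. h = g \<otimes> y \<oplus> m"
    if "h \<in> extended_ideal ?A (insert y M)" for h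
    using that
  proof induction
    case zero
    have "\<zero> = \<zero> \<otimes> y \<oplus> \<zero>" using y by simp
    then show ?case using subringE(2)[OF A'(1)] extended_ideal.zero by blast
  next
    case (lin i w h)
    then obtain g m where gm: "g \<in> ?A" "m \<in> extended_ideal A M" "h = g \<otimes> y \<oplus> m" by auto
    have c: "g \<in> carrier R" "w \<in> carrier R" "m \<in> carrier R" "i \<in> carrier R"
      using gm lin A'c extended_ideal_subset[OF A M] Ac M y by auto
    show ?case
    proof (cases "i = y")
      case True
      then have "i \<otimes> w \<oplus> h = (w \<oplus> g) \<otimes> y \<oplus> m" using c y gm by algebra
      then show ?thesis using gm lin subringE(7)[OF A'(1)] by blast
    next
      case False
      then have i: "i \<in> M" using lin by auto
      from lin(2) show ?thesis
      proof cases
        case zero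
        then have "i \<otimes> w \<oplus> h = h" using gm c y by simp
        then show ?thesis using gm by blast
      next
        case (lin k1 k2)
        have c': "k1 \<in> carrier R" "k2 \<in> carrier R" using lin A'c Ac by auto
        have "i \<otimes> w \<oplus> h = (i \<otimes> k1 \<oplus> g) \<otimes> y \<oplus> (i \<otimes> k2 \<oplus> m)"
          using c c' y gm lin by algebra
        moreover have "i \<otimes> k1 \<oplus> g \<in> ?A" using i M A'(2) gm lin subringE(6,7)[OF A'(1)] by auto
        moreover have "i \<otimes> k2 \<oplus> m \<in> extended_ideal A M"
          using extended_ideal.lin i lin gm by blast
        ultimately show ?thesis by blast
      qed
    qed
  qed
  have "\<one> \<notin> extended_ideal ?A (insert y M)"
  proof
    assume "\<one> \<in> extended_ideal ?A (insert y M)"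
    then obtain g m where gm: "g \<in> ?A" "m \<in> extended_ideal A M" "\<one> = g \<otimes> y \<oplus> m" using ideal_form by blast
    have c: "g \<in> carrier R" "m \<in> carrier R" using gm A'c Ac extended_ideal_subset[OF A M] by auto
    \<comment> \<open>As \<open>s\<close> is a unit of \<open>A\<close>, the relation
      \<open>s = g \<otimes> y\<close> writes \<open>x\<close> as a polynomial in
      \<open>y = inv x\<close> over \<open>A\<close>; multiplying by a power of \<open>x\<close>
      makes it an integral equation.\<close>
    define s where "s = \<one> \<ominus> m"
    have s: "s \<noteq> \<zero>" "inv s \<in> A" "s \<in> carrier R" using units[OF gm(2)] c by (auto simp: s_def)
    have "s = g \<otimes> y"
      unfolding s_def using gm(3) c y
      by (metis add.m_assoc m_closed minus_eq r_neg r_zero a_inv_closed)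
    then have "inv s \<otimes> g \<otimes> y = \<one>" using s c y by (simp add: m_assoc)
    moreover have "\<one> \<otimes> inv y = x" using x x0 by (simp add: y_def)
    ultimately have gx: "inv s \<otimes> g = x" using s c y by (metis eq_mult_inv_iff inv_nz(1) m_closed one_closed)
    have "inv s \<otimes> g \<in> ?A" using s(2) gm(1) A'(2) subringE(6)[OF A'(1)] by blast
    then obtain cs where cs: "set cs \<subseteq> A" "eval cs y = x"
      using simple_extension_eval[OF Ac y(1)] gx by metis
    have csc: "set cs \<subseteq> carrier R" "set (rev cs) \<subseteq> carrier R" using cs Ac by auto
    have "x \<otimes> eval (rev cs) x = x \<otimes> x [^] length cs"
      using eval_rev[OF csc(1) x(1) x0] cs x unfolding y_def by (simp add: m_comm)
    then have rds: "eval (rev cs) x = x [^] length cs"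
      using x x0 csc(2) m_lcancel eval_in_carrier by auto
    define ds where "ds = map ((\<otimes>) (\<ominus> \<one>)) (rev cs)"
    have "set ds \<subseteq> A" using cs subringE(3,5,6)[OF A] by (auto simp: ds_def)
    moreover have "eval (\<one> # ds) x = \<zero>"
      using eval_map_mult[OF csc(2), of "\<ominus> \<one>" x] x rds by (simp add: ds_def l_minus r_neg)
    ultimately show False using x unfolding integral_over_def by blast
  qed
  then obtain W where W: "valring W" "?A \<subseteq> W" "insert y M \<subseteq> nonunits W"
    using valring_exists[OF A'(1), of "insert y M"] M A' by auto
  moreover have "x \<notin> W" using W(3) inv_nonunit[of y W] y x x0 by (auto simp: y_def)
  ultimately show thesis using that A' by blast
qed

text \<open>The case \<open>M = {}\<close>, where the unit hypothesis only concerns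
  \<open>\<one>\<close> itself. It turns closure properties of integral elements into trivialities
  about intersections of rings.\<close>

lemma integral_over_iff_valring:
  assumes "subring A R"
  shows "integral_over A x \<longleftrightarrow> x \<in> carrier R \<and> (\<forall>W. valring W \<and> A \<subseteq> W \<longrightarrow> x \<in> W)"
proof -
  have e: "extended_ideal A {} = {\<zero>}"
    using extended_ideal.zero by (auto elim: extended_ideal.cases)
  have "\<one> \<ominus> m \<noteq> \<zero> \<and> inv (\<one> \<ominus> m) \<in> A" if "m \<in> extended_ideal A {}" for m
    using that subringE(3)[OF assms] by (auto simp: e minus_eq)
  then show ?thesis
    using not_integral_valring[OF assms, of "{}" x] integral_over_valring[of A x]
    unfolding integral_over_def[of A x] by (metis empty_subsetI integral_over_def)
qed

section \<open>Lengths of chains of subspaces\<close>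

lemma subspaceE:
  assumes "subalgebra K U R"
  shows "U \<subseteq> carrier R" "\<zero> \<in> U" "\<And>x y. x \<in> U \<Longrightarrow> y \<in> U \<Longrightarrow> x \<oplus> y \<in> U"
    "\<And>x. x \<in> U \<Longrightarrow> \<ominus> x \<in> U" "\<And>k x. k \<in> K \<Longrightarrow> x \<in> U \<Longrightarrow> k \<otimes> x \<in> U"
    "\<And>x. x \<in> U \<Longrightarrow> x \<in> carrier R"
proof -
  have sg: "subgroup U (add_monoid R)" using assms by (simp add: subalgebra_def)
  show "U \<subseteq> carrier R" "\<zero> \<in> U" "\<And>x y. x \<in> U \<Longrightarrow> y \<in> U \<Longrightarrow> x \<oplus> y \<in> U" "\<And>x. x \<in> U \<Longrightarrow> \<ominus> x \<in> U"
    using add.subgroupE[OF sg] subgroup.one_closed[OF sg] by (auto simp: a_inv_def)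
  then show "\<And>x. x \<in> U \<Longrightarrow> x \<in> carrier R" by auto
  show "\<And>k x. k \<in> K \<Longrightarrow> x \<in> U \<Longrightarrow> k \<otimes> x \<in> U" using subalgebra.smult_closed[OF assms] .
qed

lemma subspaceI:
  assumes K: "subring K R" and U: "U \<subseteq> carrier R" "\<zero> \<in> U"
    and add: "\<And>x y. x \<in> U \<Longrightarrow> y \<in> U \<Longrightarrow> x \<oplus> y \<in> U" and mult: "\<And>k x. k \<in> K \<Longrightarrow> x \<in> U \<Longrightarrow> k \<otimes> x \<in> U"
  shows "subalgebra K U R"
proof -
  have "\<ominus> x \<in> U" if "x \<in> U" for x
    using mult[OF subringE(5)[OF K subringE(3)[OF K]] that] that U by (auto simp: l_minus)
  then have "subgroup U (add_monoid R)"
    using U add by (intro add.subgroupI) (auto simp: a_inv_def)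
  then show ?thesis using mult by (simp add: subalgebra_def subalgebra_axioms_def)
qed

lemma subspace_inter: "subalgebra K U R \<Longrightarrow> subalgebra K M R \<Longrightarrow> subalgebra K (U \<inter> M) R"
  by (rule subalgebra_inter)

lemma set_add_iff: "x \<in> U <+>\<^bsub>R\<^esub> M \<longleftrightarrow> (\<exists>u\<in>U. \<exists>m\<in>M. x = u \<oplus> m)"
  by (auto simp: set_add_def')

lemma subspace_sum:
  assumes K: "subring K R" and U: "subalgebra K U R" and M: "subalgebra K M R"
  shows "subalgebra K (U <+>\<^bsub>R\<^esub> M) R"
proof (rule subspaceI[OF K])
  note E = subspaceE[OF U] subspaceE[OF M]
  show "U <+>\<^bsub>R\<^esub> M \<subseteq> carrier R" using E by (auto simp: set_add_iff)
  have "\<zero> = \<zero> \<oplus> \<zero>" by simp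
  then show "\<zero> \<in> U <+>\<^bsub>R\<^esub> M" using E(2,8) unfolding set_add_iff by blast
  fix x y assume "x \<in> U <+>\<^bsub>R\<^esub> M" "y \<in> U <+>\<^bsub>R\<^esub> M"
  then obtain u m u' m' where *: "u \<in> U" "m \<in> M" "u' \<in> U" "m' \<in> M" "x = u \<oplus> m" "y = u' \<oplus> m'"
    by (auto simp: set_add_iff)
  then have c: "u \<in> carrier R" "m \<in> carrier R" "u' \<in> carrier R" "m' \<in> carrier R" using E by auto
  have "x \<oplus> y = (u \<oplus> u') \<oplus> (m \<oplus> m')" using c * by algebra
  moreover have "u \<oplus> u' \<in> U" "m \<oplus> m' \<in> M" using * E(3,9) by auto
  ultimately show "x \<oplus> y \<in> U <+>\<^bsub>R\<^esub> M" unfolding set_add_iff by blast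
next
  note E = subspaceE[OF U] subspaceE[OF M]
  fix k x assume k: "k \<in> K" and "x \<in> U <+>\<^bsub>R\<^esub> M"
  then obtain u m where *: "u \<in> U" "m \<in> M" "x = u \<oplus> m" by (auto simp: set_add_iff)
  then have "k \<otimes> x = k \<otimes> u \<oplus> k \<otimes> m" using E(6,12) k subringE(1)[OF K] r_distr by auto
  moreover have "k \<otimes> u \<in> U" "k \<otimes> m \<in> M" using * E(5,11) k by auto
  ultimately show "k \<otimes> x \<in> U <+>\<^bsub>R\<^esub> M" unfolding set_add_iff by blast
qed

lemma subspace_line_extension:
  assumes K: "subfield K R" and "subalgebra K U R" "u \<in> carrier R"
  shows "subalgebra K (line_extension K u U) R" "U \<subseteq> line_extension K u U" "u \<in> line_extension K u U"
proof -
  note E = subspaceE[OF assms(2)]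
  note KE = subringE[OF subfieldE(1)[OF K]]
  have "subgroup U (add_monoid R)" using assms(2) by (simp add: subalgebra_def)
  then show "subalgebra K (line_extension K u U) R"
    using line_extension_is_subgroup[OF K, of U u] line_extension_smult_closed[OF K, of U u] E assms(3)
    by (simp add: subalgebra_def subalgebra_axioms_def)
  have "w = \<zero> \<otimes> u \<oplus> w" if "w \<in> U" for w using that E assms(3) by auto
  then show "U \<subseteq> line_extension K u U" using KE(2) line_extension_mem_iff by blast
  have "u = \<one> \<otimes> u \<oplus> \<zero>" using assms(3) by simp
  then show "u \<in> line_extension K u U" using KE(3) E(2) line_extension_mem_iff by blast
qed

lemma line_extension_least:
  assumes "subalgebra K U R" "u \<in> U" "Y \<subseteq> U"
  shows "line_extension K u Y \<subseteq> U"
proof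
  fix w assume "w \<in> line_extension K u Y"
  then obtain k v where kv: "k \<in> K" "v \<in> Y" "w = k \<otimes> u \<oplus> v" using line_extension_mem_iff by blast
  then have "v \<in> U" using assms(3) by auto
  then show "w \<in> U" using kv subspaceE(3,5)[OF assms(1)] assms(2) by simp
qed

text \<open>A chain may start strictly above \<open>Y\<close>, which need not be a subspace; so \<open>n\<close> is only a lower bound
  for the length of \<open>U / Y\<close>.\<close>

inductive flag :: "'a set \<Rightarrow> 'a set \<Rightarrow> 'a set \<Rightarrow> nat \<Rightarrow> bool" for K Y where
  flag_0: "subalgebra K U R \<Longrightarrow> Y \<subseteq> U \<Longrightarrow> flag K Y U 0"
| flag_Suc: "flag K Y U n \<Longrightarrow> subalgebra K U' R \<Longrightarrow> U \<subset> U' \<Longrightarrow> flag K Y U' (Suc n)"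

text \<open>Chains may begin anywhere above \<open>Y\<close> and end anywhere inside
  \<open>Z\<close>, so the bound is monotone in both arguments and \<open>Z\<close> need not be a
  subspace. Finiteness of the length is part of the assertion.\<close>

definition len_le :: "'a set \<Rightarrow> 'a set \<Rightarrow> 'a set \<Rightarrow> nat \<Rightarrow> bool" where
  "len_le K Y Z n \<longleftrightarrow> (\<forall>U m. flag K Y U m \<longrightarrow> U \<subseteq> Z \<longrightarrow> m \<le> n)"

lemma flagD: "flag K Y U n \<Longrightarrow> subalgebra K U R \<and> Y \<subseteq> U"
  by (induction rule: flag.induct) auto

lemma flag_mono_bot: "flag K Y U n \<Longrightarrow> Y' \<subseteq> Y \<Longrightarrow> flag K Y' U n"
  by (induction rule: flag.induct) (auto intro: flag.intros)

lemma flag_mono_top: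
  assumes "flag K Y U n" "U \<subseteq> U'" "subalgebra K U' R"
  shows "flag K Y U' n"
  using assms
proof cases
  case flag_0
  then show ?thesis using assms by (auto intro: flag.intros)
next
  case (flag_Suc U0 m)
  then show ?thesis using assms flag.flag_Suc[of K Y U0 m U'] by auto
qed

lemma flag_trans:
  assumes "flag K Y U n" "flag K U Z m"
  shows "flag K Y Z (n + m)"
  using assms(2)
proof induction
  case (flag_0 Z)
  then show ?case using assms(1) flag_mono_top by simp
next
  case (flag_Suc Z m Z')
  then show ?case using flag.flag_Suc by simp
qed

text \<open>The modular law: a strict step from \<open>U\<close> to \<open>U'\<close> stays strict
  after intersection with \<open>M\<close> or after adding \<open>M\<close>. Every step is thus
  counted in at least one of the two chains.\<close>

lemma flag_inter_sum:
  assumes K: "subring K R" and M: "subalgebra K M R" and Y: "Y \<subseteq> M" and "flag K Y U r"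
  shows "\<exists>a b. r \<le> a + b \<and> flag K Y (U \<inter> M) a \<and> flag K M (U <+>\<^bsub>R\<^esub> M) b"
  using assms(4)
proof induction
  case (flag_0 U)
  have "M \<subseteq> U <+>\<^bsub>R\<^esub> M"
  proof
    fix m assume "m \<in> M"
    then have "m = \<zero> \<oplus> m" using subspaceE(1)[OF M] by auto
    then show "m \<in> U <+>\<^bsub>R\<^esub> M" using \<open>m \<in> M\<close> subspaceE(2)[OF flag_0(1)] set_add_iff by blast
  qed
  then have "flag K Y (U \<inter> M) 0" "flag K M (U <+>\<^bsub>R\<^esub> M) 0"
    using flag_0 Y M subspace_inter subspace_sum[OF K] by (auto intro: flag.intros)
  then show ?case by force
next
  case (flag_Suc U n U')
  then obtain a b where ab: "n \<le> a + b" "flag K Y (U \<inter> M) a" "flag K M (U <+>\<^bsub>R\<^esub> M) b" by auto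
  have U: "subalgebra K U R" using flagD flag_Suc by auto
  have iU: "subalgebra K (U' \<inter> M) R" "subalgebra K (U' <+>\<^bsub>R\<^esub> M) R"
    using flag_Suc M subspace_inter subspace_sum[OF K] by auto
  have sub: "U \<inter> M \<subseteq> U' \<inter> M" "U <+>\<^bsub>R\<^esub> M \<subseteq> U' <+>\<^bsub>R\<^esub> M"
    using flag_Suc(3) by (auto simp: set_add_def')
  show ?case
  proof (cases "U \<inter> M = U' \<inter> M")
    case False
    then have "flag K Y (U' \<inter> M) (Suc a)" using ab(2) iU(1) sub by (intro flag.flag_Suc) auto
    moreover have "flag K M (U' <+>\<^bsub>R\<^esub> M) b" using flag_mono_top ab iU sub by auto
    ultimately show ?thesis using ab(1) by (intro exI[of _ "Suc a"] exI[of _ b]) auto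
  next
    case True
    obtain u where u: "u \<in> U'" "u \<notin> U" using flag_Suc by auto
    note E = subspaceE[OF U] subspaceE[OF M] subspaceE[OF flag_Suc(2)]
    have "u \<notin> U <+>\<^bsub>R\<^esub> M"
    proof
      assume "u \<in> U <+>\<^bsub>R\<^esub> M"
      then obtain w m where wm: "w \<in> U" "m \<in> M" "u = w \<oplus> m" by (auto simp: set_add_iff)
      then have "w \<in> carrier R" "m \<in> carrier R" using E by auto
      then have "m = \<ominus> w \<oplus> u" using wm by algebra
      moreover have "w \<in> U'" using wm flag_Suc by auto
      then have "\<ominus> w \<oplus> u \<in> U'" using u E(15,16) by blast
      ultimately have "m \<in> U'" by metis
      then have "m \<in> U" using wm True by auto
      then show False using wm u E by auto
    qed
    moreover have "u \<in> U' <+>\<^bsub>R\<^esub> M"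
    proof -
      have "u = u \<oplus> \<zero>" using u E by auto
      then show ?thesis using u E(8) set_add_iff by blast
    qed
    ultimately have "flag K M (U' <+>\<^bsub>R\<^esub> M) (Suc b)" using ab(3) iU(2) sub by (intro flag.flag_Suc) auto
    moreover have "flag K Y (U' \<inter> M) a" using True ab by simp
    ultimately show ?thesis using ab(1) by (intro exI[of _ a] exI[of _ "Suc b"]) auto
  qed
qed

lemma len_leD: "len_le K Y Z n \<Longrightarrow> flag K Y U m \<Longrightarrow> U \<subseteq> Z \<Longrightarrow> m \<le> n"
  by (auto simp: len_le_def)

lemma len_le_trans:
  assumes K: "subring K R" and M: "subalgebra K M R" and Z: "subalgebra K Z R" and "Y \<subseteq> M" "M \<subseteq> Z"
    and a: "len_le K Y M a" and b: "len_le K M Z b"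
  shows "len_le K Y Z (a + b)"
  unfolding len_le_def
proof (intro allI impI)
  fix U m assume f: "flag K Y U m" and U: "U \<subseteq> Z"
  obtain i j where ij: "m \<le> i + j" "flag K Y (U \<inter> M) i" "flag K M (U <+>\<^bsub>R\<^esub> M) j"
    using flag_inter_sum[OF K M assms(4) f] by auto
  have "U <+>\<^bsub>R\<^esub> M \<subseteq> Z" 
    using subspaceE(3)[OF Z] U assms(5) unfolding set_add_iff subset_iff by metis
  then show "m \<le> a + b" using ij len_leD[OF a ij(2)] len_leD[OF b ij(3)] by auto
qed

lemma len_le_refl: "len_le K Z Z 0"
  unfolding len_le_def
proof (intro allI impI)
  fix U m assume "flag K Z U m" "U \<subseteq> Z"
  then show "m \<le> 0" by cases (auto dest: flagD)
qed

lemma len_le_mono: "len_le K Y Z n \<Longrightarrow> Y \<subseteq> Y' \<Longrightarrow> Z' \<subseteq> Z \<Longrightarrow> n \<le> n' \<Longrightarrow> len_le K Y' Z' n'"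
  unfolding len_le_def
proof (intro allI impI)
  fix U m assume *: "\<forall>U m. flag K Y U m \<longrightarrow> U \<subseteq> Z \<longrightarrow> m \<le> n" "Y \<subseteq> Y'" "Z' \<subseteq> Z" "n \<le> n'"
    "flag K Y' U m" "U \<subseteq> Z'"
  then have "flag K Y U m" "U \<subseteq> Z" using flag_mono_bot by auto
  then show "m \<le> n'" using * by fastforce
qed

lemma len_le_diff:
  assumes "len_le K Y Z n" "flag K Y M m"
  shows "len_le K M Z (n - m)"
  unfolding len_le_def
proof (intro allI impI)
  fix U i assume "flag K M U i" "U \<subseteq> Z"
  then have "m + i \<le> n" using assms flag_trans len_leD by blast
  then show "i \<le> n - m" by simp
qed

lemma len_le_line_extension:
  assumes K: "subfield K R" and Z: "subalgebra K Z R" and u: "u \<in> carrier R"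
  shows "len_le K Z (line_extension K u Z) 1"
  unfolding len_le_def
proof (intro allI impI)
  let ?L = "line_extension K u Z"
  fix U m assume "flag K Z U m" "U \<subseteq> ?L"
  \<comment> \<open>Strengthened for the induction: after one strict step the chain has already
    exhausted the line extension, so no second one can follow.\<close>
  then have "m = 0 \<or> m = 1 \<and> ?L \<subseteq> U"
  proof induction
    case (flag_Suc U n U')
    note E = subspaceE[OF flag_Suc(2)]
    have ZU: "Z \<subseteq> U" using flagD flag_Suc by auto
    show ?case
    proof (cases "n = 0")
      case True
      obtain w where w: "w \<in> U'" "w \<notin> U" using flag_Suc by auto
      then obtain k z where kz: "k \<in> K" "z \<in> Z" "w = k \<otimes> u \<oplus> z"
        using flag_Suc(5) line_extension_mem_iff by blast
      have c: "k \<in> carrier R" "z \<in> carrier R" using kz subspaceE(1)[OF Z] subfieldE(3)[OF K] by auto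
      have k0: "k \<noteq> \<zero>" using w kz ZU u c by auto
      have "k \<otimes> u = w \<oplus> (\<ominus> z)" using kz c u by algebra
      moreover have "z \<in> U'" using kz ZU flag_Suc by auto
      ultimately have "k \<otimes> u \<in> U'" using w E by auto
      then have "inv k \<otimes> (k \<otimes> u) \<in> U'" using E(5) subfield_m_inv(1)[OF K, of k] kz k0 by auto
      then have "u \<in> U'" using c k0 u by auto
      then have "?L \<subseteq> U'" using line_extension_least[OF flag_Suc(2)] ZU flag_Suc(3) by blast
      then show ?thesis using True by auto
    next
      case False
      then have "?L \<subseteq> U" using flag_Suc by auto
      then show ?thesis using flag_Suc by auto
    qed
  qed auto
  then show "m \<le> 1" by auto
qed

lemma subspace_scale:
  assumes K: "subring K R" and U: "subalgebra K U R" and a: "a \<in> carrier R"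
  shows "subalgebra K ((\<otimes>) a ` U) R"
proof (rule subspaceI[OF K])
  note E = subspaceE[OF U]
  show "(\<otimes>) a ` U \<subseteq> carrier R" using E a by auto
  show "\<zero> \<in> (\<otimes>) a ` U" using E(2) a by (auto intro!: image_eqI[of _ _ \<zero>])
  fix x y assume "x \<in> (\<otimes>) a ` U" "y \<in> (\<otimes>) a ` U"
  then obtain u w where "x = a \<otimes> u" "y = a \<otimes> w" "u \<in> U" "w \<in> U" by auto
  moreover have "a \<otimes> u \<oplus> a \<otimes> w = a \<otimes> (u \<oplus> w)" if "u \<in> U" "w \<in> U" for u w
    using E(6)[OF that(1)] E(6)[OF that(2)] a r_distr by auto
  ultimately show "x \<oplus> y \<in> (\<otimes>) a ` U" using E(3) by auto
next
  note E = subspaceE[OF U]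
  fix k x assume "k \<in> K" "x \<in> (\<otimes>) a ` U"
  then obtain u where *: "x = a \<otimes> u" "u \<in> U" "k \<in> K" by auto
  moreover have "k \<in> carrier R" "u \<in> carrier R" using * E(6) subringE(1)[OF K] by auto
  ultimately have "k \<otimes> x = a \<otimes> (k \<otimes> u)" using a m_lcomm by auto
  then show "k \<otimes> x \<in> (\<otimes>) a ` U" using * E(5) by auto
qed

lemma inj_on_scale: "a \<in> carrier R \<Longrightarrow> a \<noteq> \<zero> \<Longrightarrow> U \<subseteq> carrier R \<Longrightarrow> inj_on ((\<otimes>) a) U"
  by (rule inj_onI) (metis m_lcancel subsetD)

lemma scale_scale_inv:
  assumes "a \<in> carrier R" "a \<noteq> \<zero>" "U \<subseteq> carrier R"
  shows "(\<otimes>) a ` (\<otimes>) (inv a) ` U = U" "(\<otimes>) (inv a) ` (\<otimes>) a ` U = U"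
  using assms by (force simp: image_image)+

lemma flag_scale:
  assumes K: "subring K R" and a: "a \<in> carrier R" "a \<noteq> \<zero>" and "flag K Y U n"
  shows "flag K ((\<otimes>) a ` Y) ((\<otimes>) a ` U) n"
  using assms(4)
proof induction
  case (flag_0 U)
  then show ?case using subspace_scale[OF K flag_0(1) a(1)] by (auto intro: flag.intros)
next
  case (flag_Suc U n U')
  have "(\<otimes>) a ` U \<subset> (\<otimes>) a ` U'"
    using inj_on_scale[OF a subspaceE(1)[OF flag_Suc(2)]] flag_Suc(3)
    by (metis image_strict_mono)
  then show ?case using flag_Suc subspace_scale[OF K flag_Suc(2) a(1)] flag.flag_Suc by metis
qed

lemma len_le_scale:
  assumes K: "subring K R" and a: "a \<in> carrier R" "a \<noteq> \<zero>" and c: "Y \<subseteq> carrier R" "Z \<subseteq> carrier R"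
    and "len_le K Y Z n"
  shows "len_le K ((\<otimes>) a ` Y) ((\<otimes>) a ` Z) n"
  unfolding len_le_def
proof (intro allI impI)
  fix U m assume f: "flag K ((\<otimes>) a ` Y) U m" "U \<subseteq> (\<otimes>) a ` Z"
  then have "flag K Y ((\<otimes>) (inv a) ` U) m"
    using flag_scale[OF K _ _ f(1), of "inv a"] a scale_scale_inv[OF a c(1)] by simp
  moreover have "(\<otimes>) (inv a) ` U \<subseteq> Z"
    using image_mono[OF f(2), of "(\<otimes>) (inv a)"] scale_scale_inv[OF a c(2)] by simp
  ultimately show "m \<le> n" using len_leD assms by blast
qed

text \<open>One witness per strict step suffices to keep the steps strict inside any subspace
  containing the witnesses. This moves a chain in an infinite-dimensional space into a piece with
  bounded poles or with a common denominator.\<close>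

lemma flag_finite_support:
  assumes "flag K Y U m"
  shows "\<exists>S. finite S \<and> S \<subseteq> U \<and> (\<forall>Z. subalgebra K Z R \<and> S \<subseteq> Z \<longrightarrow> flag K (Y \<inter> Z) (U \<inter> Z) m)"
  using assms
proof induction
  case (flag_0 U)
  then show ?case using subspace_inter by (intro exI[of _ "{}"]) (auto intro!: flag.intros)
next
  case (flag_Suc U n U')
  then obtain S where S: "finite S" "S \<subseteq> U"
    "\<And>Z. subalgebra K Z R \<Longrightarrow> S \<subseteq> Z \<Longrightarrow> flag K (Y \<inter> Z) (U \<inter> Z) n" by blast
  obtain w where w: "w \<in> U'" "w \<notin> U" using flag_Suc by auto
  have "flag K (Y \<inter> Z) (U' \<inter> Z) (Suc n)" if Z: "subalgebra K Z R" "insert w S \<subseteq> Z" for Z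
  proof -
    have "U \<inter> Z \<subset> U' \<inter> Z" using w Z flag_Suc(3) by auto
    then show ?thesis using S(3)[of Z] Z subspace_inter[OF flag_Suc(2) Z(1)] flag.flag_Suc by auto
  qed
  then show ?case using S w flag_Suc(3) by (intro exI[of _ "insert w S"]) auto
qed

text \<open>One vector is chosen from each strict step; the conclusion is linear independence modulo
  \<open>Y\<close>.\<close>

lemma flag_independent:
  assumes K: "subfield K R" and "flag K Y U m" "subalgebra K Y R"
  shows "\<exists>ws. length ws = m \<and> set ws \<subseteq> U \<and>
    (\<forall>cs. length cs = m \<and> set cs \<subseteq> K \<and> combine cs ws \<in> Y \<longrightarrow> set cs \<subseteq> {\<zero>})"
  using assms(2)
proof induction
  case (flag_0 U)
  then show ?case by auto
next
  case (flag_Suc U n U')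
  then obtain ws where ws: "length ws = n" "set ws \<subseteq> U"
    "\<And>cs. length cs = n \<Longrightarrow> set cs \<subseteq> K \<Longrightarrow> combine cs ws \<in> Y \<Longrightarrow> set cs \<subseteq> {\<zero>}" by blast
  have U: "subalgebra K U R" "Y \<subseteq> U" using flagD flag_Suc by auto
  note E = subspaceE[OF U(1)]
  obtain w where w: "w \<in> U'" "w \<notin> U" using flag_Suc by auto
  have wc: "w \<in> carrier R" using w subspaceE(1)[OF flag_Suc(2)] by auto
  have comb: "combine cs ws \<in> U" if "set cs \<subseteq> K" for cs
    using that ws(2) by (induction cs ws rule: combine.induct) (auto simp: E)
  have "set (c # cs) \<subseteq> {\<zero>}"
    if cs: "length cs = n" "set (c # cs) \<subseteq> K" "combine (c # cs) (w # ws) \<in> Y" for c cs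
  proof -
    have cc: "c \<in> carrier R" "combine cs ws \<in> carrier R" "combine cs ws \<in> U"
      using comb[of cs] cs subfieldE(3)[OF K] E(1) by auto
    have 0: "c = \<zero>"
    proof (rule ccontr)
      assume c0: "c \<noteq> \<zero>"
      have "c \<otimes> w = combine (c # cs) (w # ws) \<oplus> (\<ominus> combine cs ws)" using cc wc by (simp, algebra)
      moreover have "combine (c # cs) (w # ws) \<in> U" using cs(3) U(2) by blast
      ultimately have "c \<otimes> w \<in> U" using E(3,4) cc(3) by metis
      then have "inv c \<otimes> (c \<otimes> w) \<in> U" using E(5) subfield_m_inv(1)[OF K, of c] cs c0 by auto
      then show False using w cc c0 wc by auto
    qed
    then have "combine cs ws \<in> Y" using cs(3) cc wc by simp
    then show ?thesis using ws(3)[of cs] cs 0 by auto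
  qed
  then have "\<forall>cs. length cs = Suc n \<and> set cs \<subseteq> K \<and> combine cs (w # ws) \<in> Y \<longrightarrow> set cs \<subseteq> {\<zero>}"
    by (metis Suc_length_conv)
  then show ?case using ws w flag_Suc(3) by (intro exI[of _ "w # ws"]) auto
qed

section \<open>Zariski's lemma and Noether normalization\<close>

lemma generate_field_fraction:
  assumes A: "subring A R" and x: "x \<in> generate_field R A"
  shows "\<exists>b\<in>A - {\<zero>}. b \<otimes> x \<in> A"
  using x
proof induction
  note E = subringE[OF A]
  case one
  then show ?case using E(3) by (intro bexI[of _ \<one>]) auto
next
  note E = subringE[OF A]
  case (incl h)
  then show ?case using E(1,3) by (intro bexI[of _ \<one>]) auto
next
  note E = subringE[OF A]
  case (a_inv h)
  then obtain b where b: "b \<in> A" "b \<noteq> \<zero>" "b \<otimes> h \<in> A" by auto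
  have "h \<in> carrier R" "b \<in> carrier R" using generate_field_in_carrier[OF E(1) a_inv(1)] b E(1) by auto
  then have "b \<otimes> (\<ominus> h) = \<ominus> (b \<otimes> h)" by algebra
  moreover have "\<ominus> (b \<otimes> h) \<in> A" using b E(5) by blast
  ultimately show ?case using b by (intro bexI[of _ b]) auto
next
  note E = subringE[OF A]
  case (m_inv h)
  then obtain b where b: "b \<in> A" "b \<noteq> \<zero>" "b \<otimes> h \<in> A" by auto
  have c: "h \<in> carrier R" "b \<in> carrier R" using generate_field_in_carrier[OF E(1) m_inv(1)] b E(1) by auto
  then have "(b \<otimes> h) \<otimes> inv h = b" "b \<otimes> h \<noteq> \<zero>" using m_inv b integral_iff by auto
  then show ?case using b by (intro bexI[of _ "b \<otimes> h"]) auto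
next
  note E = subringE[OF A]
  case (eng_add h1 h2)
  then obtain b1 b2 where b: "b1 \<in> A" "b1 \<noteq> \<zero>" "b1 \<otimes> h1 \<in> A" "b2 \<in> A" "b2 \<noteq> \<zero>" "b2 \<otimes> h2 \<in> A" by auto
  have c: "h1 \<in> carrier R" "h2 \<in> carrier R" "b1 \<in> carrier R" "b2 \<in> carrier R"
    using generate_field_in_carrier[OF E(1)] eng_add b E(1) by auto
  have "(b1 \<otimes> b2) \<otimes> (h1 \<oplus> h2) = b2 \<otimes> (b1 \<otimes> h1) \<oplus> b1 \<otimes> (b2 \<otimes> h2)" using c by algebra
  moreover have "b2 \<otimes> (b1 \<otimes> h1) \<oplus> b1 \<otimes> (b2 \<otimes> h2) \<in> A" using b E(6,7) by blast
  moreover have "b1 \<otimes> b2 \<in> A - {\<zero>}" using b c E(6) integral_iff by auto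
  ultimately show ?case by metis
next
  note E = subringE[OF A]
  case (eng_mult h1 h2)
  then obtain b1 b2 where b: "b1 \<in> A" "b1 \<noteq> \<zero>" "b1 \<otimes> h1 \<in> A" "b2 \<in> A" "b2 \<noteq> \<zero>" "b2 \<otimes> h2 \<in> A" by auto
  have c: "h1 \<in> carrier R" "h2 \<in> carrier R" "b1 \<in> carrier R" "b2 \<in> carrier R"
    using generate_field_in_carrier[OF E(1)] eng_mult b E(1) by auto
  have "(b1 \<otimes> b2) \<otimes> (h1 \<otimes> h2) = (b1 \<otimes> h1) \<otimes> (b2 \<otimes> h2)" using c by algebra
  moreover have "(b1 \<otimes> h1) \<otimes> (b2 \<otimes> h2) \<in> A" using b E(6) by blast
  moreover have "b1 \<otimes> b2 \<in> A - {\<zero>}" using b c E(6) integral_iff by auto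
  ultimately show ?case by metis
qed

text \<open>\<open>M\<close> is a multiplicative set and \<open>B\<close> is stable under
  \<open>A\<close>, so that one statement serves for fraction fields
  (\<open>M = A - {\<zero>}\<close>), for localizations (\<open>M = A - q\<close>), and for
  denominators relative to an overring of \<open>A\<close>.\<close>

lemma common_denominator:
  assumes A: "subring A R" and "finite S" and S: "S \<subseteq> carrier R"
    and M: "M \<subseteq> A" "\<one> \<in> M" "\<And>a b. a \<in> M \<Longrightarrow> b \<in> M \<Longrightarrow> a \<otimes> b \<in> M"
    and ex: "\<And>x. x \<in> S \<Longrightarrow> \<exists>b\<in>M. b \<otimes> x \<in> B"
    and B: "\<And>a b. a \<in> A \<Longrightarrow> b \<in> B \<Longrightarrow> a \<otimes> b \<in> B"
  shows "\<exists>b\<in>M. \<forall>x\<in>S. b \<otimes> x \<in> B"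
  using assms(2) S ex
proof (induction S)
  case empty
  then show ?case using M by auto
next
  note E = subringE[OF A]
  case (insert x S)
  then obtain b where b: "b \<in> M" "\<forall>x\<in>S. b \<otimes> x \<in> B" by auto
  obtain b' where b': "b' \<in> M" "b' \<otimes> x \<in> B" using insert.prems(2)[of x] by blast
  have "(b' \<otimes> b) \<otimes> y \<in> B" if "y \<in> S" for y
  proof -
    have "(b' \<otimes> b) \<otimes> y = b' \<otimes> (b \<otimes> y)" using b b' that insert M(1) E(1) by (intro m_assoc) auto
    then show ?thesis using B b b' that M(1) by (metis subsetD)
  qed
  moreover have "(b' \<otimes> b) \<otimes> x \<in> B"
  proof -
    have "b \<in> carrier R" "b' \<in> carrier R" "x \<in> carrier R" using b b' insert M(1) E(1) by auto
    then have "(b' \<otimes> b) \<otimes> x = b \<otimes> (b' \<otimes> x)" by algebra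
    then show ?thesis using B b b' M(1) by (metis subsetD)
  qed
  ultimately show ?case using M(3) b b' by blast
qed

text \<open>Denominators of the coefficients are cleared at the cost of a leading coefficient
  \<open>a\<close> other than \<open>\<one>\<close>; that \<open>a\<close> decides which valuation
  rings must contain \<open>x\<close>.\<close>

lemma algebraic_generate_field_root:
  assumes A: "subring A R" and x: "x \<in> carrier R" "(algebraic over (generate_field R A)) x"
  obtains a cs where "a \<in> A" "a \<noteq> \<zero>" "set cs \<subseteq> A" "eval (a # cs) x = \<zero>"
proof -
  note E = subringE[OF A]
  have F: "subfield (generate_field R A) R" using generate_field_is_subfield[OF E(1)] .
  obtain p where p: "p \<in> carrier ((generate_field R A)[X])" "p \<noteq> []" "eval p x = \<zero>"
    using algebraicE[OF subfieldE(1)[OF F] x] by auto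
  then have ps: "set p \<subseteq> generate_field R A" "hd p \<noteq> \<zero>" by (auto simp: univ_poly_def polynomial_def)
  then have pc: "set p \<subseteq> carrier R" using generate_field_incl[OF E(1)] by auto
  have "\<exists>b\<in>A - {\<zero>}. \<forall>x\<in>set p. b \<otimes> x \<in> A"
    by (rule common_denominator[OF A]) (use pc ps E generate_field_fraction[OF A] zero_not_one integral_iff in \<open>auto simp: subset_iff\<close>)
  then obtain b where b: "b \<in> A" "b \<noteq> \<zero>" "\<And>c. c \<in> set p \<Longrightarrow> b \<otimes> c \<in> A" by auto
  obtain c cs where ccs: "p = c # cs" using p by (cases p) auto
  have "eval (map ((\<otimes>) b) p) x = \<zero>" using eval_map_mult[OF pc, of b x] b x p E(1) by auto
  moreover have "b \<otimes> c \<noteq> \<zero>" using b ps pc ccs E(1) integral_iff by auto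
  ultimately show thesis using that[of "b \<otimes> c" "map ((\<otimes>) b) cs"] b ccs by auto
qed

lemma generate_field_insert:
  assumes k: "subfield k R" and z: "z \<in> carrier R"
  shows "generate_field R (insert z k) = generate_field R (simple_extension k z)"
proof -
  have kc: "k \<subseteq> carrier R" using subfieldE(3)[OF k] .
  have c: "insert z k \<subseteq> carrier R" "simple_extension k z \<subseteq> carrier R"
    using kc z simple_extension_in_carrier by auto
  have 1: "insert z k \<subseteq> simple_extension k z"
    using simple_extension_incl[OF kc z] simple_extension_mem[OF subfieldE(1)[OF k] z] by auto
  have "subring (generate_field R (insert z k)) R"
    using subfieldE(1)[OF generate_field_is_subfield[OF c(1)]] .
  then have "simple_extension k z \<subseteq> generate_field R (insert z k)"
    using simple_extension_subring_incl[of "generate_field R (insert z k)" k z]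
      generate_field.incl[of _ "insert z k" R] by auto
  then show ?thesis
    using mono_generate_field[OF 1 c(2)] generate_field_min_subfield1[OF c(2) generate_field_is_subfield[OF c(1)]]
    by auto
qed

lemma algebraic_insert_root:
  assumes k: "subfield k R" and z: "z \<in> carrier R"
    and x: "x \<in> carrier R" "(algebraic over (generate_field R (insert z k))) x"
  obtains a cs where "a \<in> simple_extension k z" "a \<noteq> \<zero>" "set cs \<subseteq> simple_extension k z" "eval (a # cs) x = \<zero>"
  using algebraic_generate_field_root[OF simple_extension_is_subring[OF subfieldE(1)[OF k] z] x(1)]
    x(2) generate_field_insert[OF k z] by metis

lemma algebraic_root:
  assumes k: "subfield k R" and x: "x \<in> carrier R" "(algebraic over k) x"
  obtains a cs where "a \<in> k" "a \<noteq> \<zero>" "set cs \<subseteq> k" "eval (a # cs) x = \<zero>"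
proof -
  obtain p where p: "p \<in> carrier (k[X])" "p \<noteq> []" "eval p x = \<zero>"
    using algebraicE[OF subfieldE(1)[OF k] x] by auto
  then have "set p \<subseteq> k" "hd p \<noteq> \<zero>" by (auto simp: univ_poly_def polynomial_def)
  then show thesis using that[of "hd p" "tl p"] p by (cases p) auto
qed

lemma algebraic_over_subset_root:
  assumes k: "subring k R" and "a \<in> k" "a \<noteq> \<zero>" "set cs \<subseteq> k" "eval (a # cs) x = \<zero>"
  shows "(algebraic over k) x"
  by (rule algebraicI[of "a # cs"]) (use assms in \<open>auto simp: univ_poly_def polynomial_def\<close>)

lemma subfield_nonunits:
  assumes W: "subring W R" and k: "subfield k R" "k \<subseteq> W" and c: "c \<in> k" "c \<noteq> \<zero>"
  shows "c \<notin> nonunits W"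
  using subfield_m_inv(1)[OF k(1), of c] k c by (auto simp: nonunits_def)

lemma algebraic_valring:
  assumes W: "valring W" and k: "subfield k R" "k \<subseteq> W" and x: "x \<in> carrier R" "(algebraic over k) x"
  shows "x \<in> W"
proof -
  obtain a cs where a: "a \<in> k" "a \<noteq> \<zero>" "set cs \<subseteq> k" "eval (a # cs) x = \<zero>"
    using algebraic_root[OF k(1) x] by metis
  show ?thesis
    by (rule valring_root[OF W _ subfield_nonunits[OF valringE(1)[OF W] k a(1,2)] _ x(1) a(4)])
      (use a k in auto)
qed

text \<open>Evaluation at a transcendental element is injective, so the extension is a polynomial
  ring, whose units are constants.\<close>

lemma simple_extension_transcendental_unit:
  assumes k: "subfield k R" and z: "z \<in> carrier R" "(transcendental over k) z"
    and u: "u \<in> simple_extension k z" "w \<in> simple_extension k z" "u \<otimes> w = \<one>"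
  shows "u \<in> k"
proof -
  have ks: "subring k R" using subfieldE(1)[OF k] .
  interpret H: ring_hom_ring "k[X]" R "\<lambda>p. eval p z" using eval_ring_hom[OF ks z(1)] .
  interpret UP: domain "k[X]" using univ_poly_is_domain[OF ks] .
  obtain p q where pq: "p \<in> carrier (k[X])" "q \<in> carrier (k[X])" "eval p z = u" "eval q z = w"
    using u simple_extension_as_eval_img[OF subfieldE(3)[OF k] z(1)] by auto
  have "eval (p \<otimes>\<^bsub>k[X]\<^esub> q) z = eval \<one>\<^bsub>k[X]\<^esub> z" using pq u by simp
  then have "p \<otimes>\<^bsub>k[X]\<^esub> q = \<one>\<^bsub>k[X]\<^esub>"
    using z(2) pq unfolding over_def transcendental_def inj_on_def by auto
  then have "p \<in> Units (k[X])" using pq UP.m_comm[OF pq(1,2)] by (auto simp: Units_def)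
  then obtain c where "p = [c]" "c \<in> k" using univ_poly_units[OF k] by auto
  then show ?thesis using pq(3) subfieldE(3)[OF k] by auto
qed

lemma extended_ideal_singleton:
  assumes A: "subring A R" and h: "h \<in> A" and "x \<in> extended_ideal A {h}"
  shows "\<exists>w\<in>A. x = h \<otimes> w"
  using assms(3)
proof induction
  note E = subringE[OF A]
  case zero
  then show ?case using E(1,2) h by (intro bexI[of _ \<zero>]) auto
next
  note E = subringE[OF A]
  case (lin i w x)
  then obtain w' where w': "w' \<in> A" "x = h \<otimes> w'" by auto
  moreover have "w \<in> carrier R" "w' \<in> carrier R" "h \<in> carrier R" using lin h w' E(1) by auto
  ultimately have "i \<otimes> w \<oplus> x = h \<otimes> (w \<oplus> w')" using lin(1) by (simp add: r_distr)
  then show ?case using lin w' E(7) by blast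
qed

lemma algebraic_trans_simple:
  assumes k: "subfield k R" and z: "z \<in> carrier R" "(algebraic over k) z"
    and x: "x \<in> carrier R" "(algebraic over (simple_extension k z)) x"
  shows "(algebraic over k) x"
proof -
  let ?F = "simple_extension k z"
  have F: "subfield ?F R" using simple_extension_is_subfield[OF k z(1)] z(2) by simp
  have 1: "finite_dimension k ?F" using finite_dimension_simple_extension[OF k z(1)] z(2) by simp
  have 2: "finite_dimension ?F (simple_extension ?F x)" using finite_dimension_simple_extension[OF F x(1)] x(2) by simp
  have 3: "finite_dimension k (simple_extension ?F x)" using telescopic_base_dim(1)[OF k F 1 2] .
  show ?thesis
    by (rule finite_dimension_imp_algebraic[OF k _ 3])
      (use simple_extension_is_subring simple_extension_mem subfieldE(1)[OF F] x in auto)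
qed

text \<open>If a generator \<open>z\<close> were transcendental, then all other generators would be
  integral over \<open>k[z, 1/g]\<close> for some \<open>g\<close>, and a valuation ring centered at the non-unit \<open>1 + z g\<close> of
  \<open>k[z]\<close> would contain all of them.\<close>

theorem zariski_lemma:
  assumes "finite S" "S \<subseteq> carrier R" "subfield k R" "subfield (generate_ring R (k \<union> S)) R"
    and "x \<in> generate_ring R (k \<union> S)"
  shows "(algebraic over k) x"
  using assms
proof (induction S arbitrary: k x)
  case empty
  then have "generate_ring R (k \<union> {}) \<subseteq> k"
    using generate_ring_min_subring1[OF subfieldE(3)[OF empty(2)] subfieldE(1)[OF empty(2)]] by auto
  then show ?case using algebraic_self[OF subfieldE(1)[OF empty(2)]] empty by auto
next
  case (insert z S)
  note k = insert.prems(2)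
  have kc: "k \<subseteq> carrier R" using subfieldE(3)[OF k] .
  have z: "z \<in> carrier R" and Sc: "S \<subseteq> carrier R" using insert.prems by auto
  define E where "E = generate_ring R (k \<union> insert z S)"
  have E: "subfield E R" using insert.prems(3) by (simp add: E_def)
  have gc: "k \<union> insert z S \<subseteq> carrier R" using kc z Sc by auto
  have gE: "k \<union> insert z S \<subseteq> E" unfolding E_def using generate_ring.incl[of _ "k \<union> insert z S" R] by blast
  define k' where "k' = generate_field R (insert z k)"
  have zkc: "insert z k \<subseteq> carrier R" using z kc by auto
  have k': "subfield k' R" unfolding k'_def using generate_field_is_subfield[OF zkc] .
  have k'E: "k' \<subseteq> E" unfolding k'_def using generate_field_min_subfield1[OF zkc E] gE by auto
  have kk': "insert z k \<subseteq> k'" unfolding k'_def using generate_field.incl[of _ "insert z k" R] by blast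
  have k'c: "k' \<union> S \<subseteq> carrier R" using subfieldE(3)[OF k'] Sc by auto
  have EE: "generate_ring R (k' \<union> S) = E"
  proof
    show "generate_ring R (k' \<union> S) \<subseteq> E"
      using generate_ring_min_subring1[OF k'c subfieldE(1)[OF E]] k'E gE by auto
    have "k \<union> insert z S \<subseteq> k' \<union> S" using kk' by auto
    then show "E \<subseteq> generate_ring R (k' \<union> S)" unfolding E_def using mono_generate_ring[OF _ k'c] by auto
  qed
  have alg: "(algebraic over k') y" if "y \<in> E" for y
    using insert.IH[OF Sc k', of y] that E EE by simp
  have Ec: "E \<subseteq> carrier R" using subfieldE(3)[OF E] .
  show ?case
  proof (cases "(algebraic over k) z")
    case True
    have F: "subfield (simple_extension k z) R" using simple_extension_is_subfield[OF k z] True by simp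
    have "k' \<subseteq> simple_extension k z"
      unfolding k'_def using generate_field_min_subfield1[OF zkc F] simple_extension_incl[OF kc z]
        simple_extension_mem[OF subfieldE(1)[OF k] z] by auto
    then have "(algebraic over (simple_extension k z)) x"
      using algebraic_mono alg insert.prems(4) by (auto simp: E_def)
    then show ?thesis using algebraic_trans_simple[OF k z True] insert.prems(4) Ec by (auto simp: E_def)
  next
    case False
    then have tr: "(transcendental over k) z" by (simp add: over_def)
    define A where "A = simple_extension k z"
    have A: "subring A R" unfolding A_def using simple_extension_is_subring[OF subfieldE(1)[OF k] z] .
    have Ac: "A \<subseteq> carrier R" using subringE(1)[OF A] .
    have kA: "k \<subseteq> A" "z \<in> A" unfolding A_def
      using simple_extension_incl[OF kc z] simple_extension_mem[OF subfieldE(1)[OF k] z] by auto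
    \<comment> \<open>\<open>g\<close> is the product of leading coefficients of equations for the
      remaining generators. The cofactor \<open>b\<close> records that each of them divides
      \<open>g\<close>, so that each becomes a unit wherever \<open>g\<close> does.\<close>
    have "\<exists>g\<in>A - {\<zero>}. \<forall>s\<in>S. \<exists>a cs b. a \<in> A \<and> b \<in> A \<and> a \<otimes> b = g \<and> set cs \<subseteq> A \<and> eval (a # cs) s = \<zero>"
      using insert.hyps(1) Sc gE
    proof (induction S)
      case empty
      then show ?case using subringE(3)[OF A] by auto
    next
      case (insert s S)
      then obtain g where g: "g \<in> A" "g \<noteq> \<zero>"
        "\<And>s. s \<in> S \<Longrightarrow> \<exists>a cs b. a \<in> A \<and> b \<in> A \<and> a \<otimes> b = g \<and> set cs \<subseteq> A \<and> eval (a # cs) s = \<zero>" by auto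
      obtain a cs where a: "a \<in> A" "a \<noteq> \<zero>" "set cs \<subseteq> A" "eval (a # cs) s = \<zero>"
        using algebraic_insert_root[OF k z, of s] alg[of s] insert Ec unfolding A_def k'_def by auto
      have c: "a \<in> carrier R" "g \<in> carrier R" using a g Ac by auto
      show ?case
      proof (intro bexI[of _ "a \<otimes> g"] ballI)
        show "a \<otimes> g \<in> A - {\<zero>}" using a g c subringE(6)[OF A] integral_iff by auto
        fix t assume "t \<in> insert s S"
        then consider "t = s" | "t \<in> S" by auto
        then show "\<exists>a' cs b. a' \<in> A \<and> b \<in> A \<and> a' \<otimes> b = a \<otimes> g \<and> set cs \<subseteq> A \<and> eval (a' # cs) t = \<zero>"
        proof cases
          case 1
          then show ?thesis using a g by blast
        next
          case 2
          then obtain a' cs' b where *: "a' \<in> A" "b \<in> A" "a' \<otimes> b = g" "set cs' \<subseteq> A" "eval (a' # cs') t = \<zero>"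
            using g(3) by blast
          have "a' \<otimes> (a \<otimes> b) = a \<otimes> g" using * c Ac m_lcomm[of a' a b] by auto
          then show ?thesis using * a subringE(6)[OF A] by blast
        qed
      qed
    qed
    then obtain g where g: "g \<in> A" "g \<noteq> \<zero>"
      "\<And>s. s \<in> S \<Longrightarrow> \<exists>a cs b. a \<in> A \<and> b \<in> A \<and> a \<otimes> b = g \<and> set cs \<subseteq> A \<and> eval (a # cs) s = \<zero>" by auto
    have gc: "g \<in> carrier R" using g Ac by auto
    have no_unit: "\<not> (\<exists>w\<in>A. z \<otimes> w = \<one>)"
      using simple_extension_transcendental_unit[OF k z tr, of z] kA
        algebraic_self[OF subfieldE(1)[OF k], of z] False unfolding A_def by auto
    define h where "h = \<one> \<oplus> z \<otimes> g"
    have hA: "h \<in> A" "h \<in> carrier R"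
      using kA g subringE(3,6,7)[OF A] Ac by (auto simp: h_def)
    have zg: "z \<otimes> g = h \<ominus> \<one>" unfolding h_def using z gc by algebra
    have nu: "\<one> \<notin> extended_ideal A {h}"
    proof
      assume "\<one> \<in> extended_ideal A {h}"
      then obtain w where "w \<in> A" "h \<otimes> w = \<one>" using extended_ideal_singleton[OF A hA(1)] by metis
      then have "h \<in> k" using simple_extension_transcendental_unit[OF k z tr, of h w] hA by (auto simp: A_def)
      then have c: "z \<otimes> g \<in> k" using zg subringE(3,5,7)[OF subfieldE(1)[OF k]] by (auto simp: a_minus_def)
      have nz: "z \<otimes> g \<noteq> \<zero>" using no_unit tr g z gc integral_iff
          algebraic_self[OF subfieldE(1)[OF k], of \<zero>] subringE(2)[OF subfieldE(1)[OF k]] False by auto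
      define i where "i = inv (z \<otimes> g)"
      have i: "i \<in> k" "i \<in> carrier R" "z \<otimes> g \<otimes> i = \<one>"
        using subfield_m_inv[OF k, of "z \<otimes> g"] c nz kc by (auto simp: i_def)
      then have "z \<otimes> (g \<otimes> i) = \<one>" using z gc by (simp add: m_assoc)
      then show False using no_unit i g kA subringE(6)[OF A] by blast
    qed
    obtain W where W: "valring W" "A \<subseteq> W" "{h} \<subseteq> nonunits W"
      using valring_exists[OF A _ nu] hA by auto
    note Ws = valringE(1)[OF W(1)]
    \<comment> \<open>As \<open>h\<close> is a nonunit of \<open>W\<close>, the element
      \<open>z \<otimes> g = h \<ominus> \<one>\<close> is a unit; hence so are \<open>g\<close> and
      all leading coefficients. Then \<open>W\<close> contains the whole field \<open>E\<close>, in
      which the nonunit \<open>h\<close> would be invertible.\<close>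
    have zgn: "z \<otimes> g \<notin> nonunits W"
    proof
      assume "z \<otimes> g \<in> nonunits W"
      then have "h \<oplus> (\<ominus> (z \<otimes> g)) \<in> nonunits W" using nonunits_add[OF W(1)] nonunits_minus[OF Ws] W(3) by auto
      moreover have "h \<oplus> (\<ominus> (z \<otimes> g)) = \<one>" unfolding h_def using z gc by algebra
      ultimately show False using one_notin_nonunits[OF Ws] by simp
    qed
    have gn: "g \<notin> nonunits W" using zgn nonunits_mult[OF Ws, of g z] kA W by auto
    have "S \<subseteq> W"
    proof
      fix s assume s: "s \<in> S"
      then obtain a cs b where *: "a \<in> A" "b \<in> A" "a \<otimes> b = g" "set cs \<subseteq> A" "eval (a # cs) s = \<zero>"
        using g(3) by blast
      then have "a \<notin> nonunits W" using gn nonunits_mult'[OF Ws, of a b] W by auto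
      then show "s \<in> W" using valring_root[OF W(1), of a cs s] * W s Sc by auto
    qed
    then have "k \<union> insert z S \<subseteq> W" using W kA by auto
    then have EW: "E \<subseteq> W" unfolding E_def using generate_ring_min_subring1[OF _ Ws] insert.prems(1) kc by auto
    have "h \<noteq> \<zero>"
    proof
      assume "h = \<zero>"
      then have "z \<otimes> (\<ominus> g) = \<one>" using zg z gc by (simp add: r_minus a_minus_def)
      then show False using no_unit g subringE(5)[OF A] by blast
    qed
    have "A \<subseteq> E" unfolding A_def using simple_extension_subring_incl[OF subfieldE(1)[OF E]] gE by auto
    then have "inv h \<in> E" using subfield_m_inv(1)[OF E, of h] hA \<open>h \<noteq> \<zero>\<close> by auto
    then show ?thesis using W(3) inv_nonunit[of h W] \<open>h \<noteq> \<zero>\<close> EW by auto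
  qed
qed

section \<open>Pole orders and Noether normalization in dimension one\<close>

text \<open>For \<open>z\<close> outside \<open>W\<close> this says that \<open>x\<close> has the
  same value as \<open>z [^] e\<close>, a pole of order \<open>e\<close> measured by
  \<open>z\<close>. The value group of \<open>W\<close> is arbitrary, so only elements whose value
  is a multiple of that of \<open>z\<close> have an order.\<close>

definition unit_multiple :: "'a set \<Rightarrow> 'a \<Rightarrow> nat \<Rightarrow> 'a \<Rightarrow> bool" where
  "unit_multiple W z e x \<longleftrightarrow> (\<exists>u\<in>W - nonunits W. x = z [^] e \<otimes> u)"

lemma unit_mult_closed:
  assumes "subring W R" "u \<in> W - nonunits W" "w \<in> W - nonunits W"
  shows "u \<otimes> w \<in> W - nonunits W"
  using assms nonunits_prime[OF assms(1), of u w] subringE(6)[OF assms(1)] by auto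

lemma unit_add_nonunit:
  assumes W: "valring W" and "u \<in> W - nonunits W" "w \<in> nonunits W"
  shows "u \<oplus> w \<in> W - nonunits W"
proof -
  note Ws = valringE(1)[OF W]
  have c: "u \<in> carrier R" "w \<in> carrier R" "w \<in> W"
    using assms subringE(1)[OF Ws] by (auto simp: nonunits_def)
  have "u \<notin> nonunits W" using assms by auto
  moreover have "u = (u \<oplus> w) \<oplus> (\<ominus> w)" using c by algebra
  ultimately have "u \<oplus> w \<notin> nonunits W"
    using nonunits_add[OF W _ nonunits_minus[OF Ws assms(3)]] by metis
  then show ?thesis using assms c subringE(7)[OF Ws] by auto
qed

lemma unit_multiple_nonzero:
  assumes W: "subring W R" and z: "z \<in> carrier R" "z \<noteq> \<zero>" and x: "unit_multiple W z e x"
  shows "x \<noteq> \<zero>"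
proof -
  obtain u where u: "u \<in> W" "u \<notin> nonunits W" "x = z [^] e \<otimes> u" using x by (auto simp: unit_multiple_def)
  then have "u \<noteq> \<zero>" "u \<in> carrier R" using nonunits_zero[OF W] subringE(1)[OF W] by auto
  then show ?thesis using u(3) mult_nz z by simp
qed

text \<open>Relative to \<open>z [^] e\<close> the term of lower pole order carries a factor
  \<open>inv z\<close>, hence is a nonunit, and cannot disturb the unit of the other term.\<close>

lemma unit_multiple_add:
  assumes W: "valring W" and z: "z \<in> carrier R" "z \<notin> W"
    and x: "unit_multiple W z d x" and y: "unit_multiple W z e y" and less: "d < e"
  shows "unit_multiple W z e (x \<oplus> y)"
proof -
  note Ws = valringE(1)[OF W]
  have z': "z \<noteq> \<zero>" "inv z \<in> nonunits W" using valring_notin[OF W z] by auto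
  obtain u w where u: "u \<in> W - nonunits W" "x = z [^] d \<otimes> u" and w: "w \<in> W - nonunits W" "y = z [^] e \<otimes> w"
    using x y by (auto simp: unit_multiple_def)
  have c: "u \<in> carrier R" "w \<in> carrier R" using u w subringE(1)[OF Ws] by auto
  obtain i where i: "e = d + Suc i" using less less_iff_Suc_add by auto
  have "inv z \<in> W" using z' by (auto simp: nonunits_def)
  then have "inv z [^] i \<in> W" using subringE(3,6)[OF Ws] by (induction i) auto
  then have "inv z [^] i \<otimes> u \<in> W" using u subringE(6)[OF Ws] by auto
  then have n: "inv z [^] i \<otimes> u \<otimes> inv z \<in> nonunits W" using nonunits_mult[OF Ws z'(2)] by auto
  have "z [^] d \<otimes> u = z [^] e \<otimes> (inv z [^] i \<otimes> u \<otimes> inv z)"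
  proof -
    have "z [^] i \<otimes> inv z [^] i = \<one>" using z z' by (simp flip: nat_pow_distrib)
    then have "z [^] e \<otimes> inv z [^] i \<otimes> inv z = z [^] d"
      unfolding i using z z' by (simp add: m_assoc flip: nat_pow_mult)
        (simp add: m_lcomm[of z] z')
    moreover have "z [^] e \<otimes> (inv z [^] i \<otimes> u \<otimes> inv z) = (z [^] e \<otimes> inv z [^] i \<otimes> inv z) \<otimes> u"
      using z z' c by (simp add: m_ac)
    ultimately show ?thesis by simp
  qed
  then have "x \<oplus> y = z [^] e \<otimes> (w \<oplus> inv z [^] i \<otimes> u \<otimes> inv z)"
    using u w z z' c by (simp add: r_distr a_comm)
  then show ?thesis using unit_add_nonunit[OF W w(1) n] unfolding unit_multiple_def by blast
qed

lemma unit_multiple_sum: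
  assumes W: "valring W" and z: "z \<in> carrier R" "z \<notin> W"
    and x: "unit_multiple W z d x" and y: "unit_multiple W z e y" and ne: "d \<noteq> e"
  shows "unit_multiple W z (max d e) (x \<oplus> y)"
proof (cases "d < e")
  case True
  then show ?thesis using unit_multiple_add[OF assms(1-5)] by simp
next
  case False
  have "x \<in> carrier R" "y \<in> carrier R"
    using x y z subringE(1)[OF valringE(1)[OF W]] by (auto simp: unit_multiple_def)
  then have "x \<oplus> y = y \<oplus> x" by (rule a_comm)
  then show ?thesis using unit_multiple_add[OF W z y x] False ne by (simp add: max_def)
qed

text \<open>The terms of \<open>eval cs z\<close> have pairwise distinct pole orders, so that one of them dominates.\<close>

lemma eval_dominant_term:
  assumes W: "valring W" and z: "z \<in> carrier R" "z \<notin> W" and N: "length cs \<le> N"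
    and cs: "\<And>c. c \<in> set cs \<Longrightarrow> c = \<zero> \<or> (\<exists>d. unit_multiple W z (N * d) c)"
  shows "(set cs \<subseteq> {\<zero>} \<and> eval cs z = \<zero>) \<or> (\<exists>e. e mod N < length cs \<and> unit_multiple W z e (eval cs z))"
  using N cs
proof (induction cs)
  case (Cons c cs)
  note Ws = valringE(1)[OF W]
  let ?n = "length cs"
  have cc: "set (c # cs) \<subseteq> carrier R"
    using Cons.prems(2) z subringE(1)[OF Ws] unfolding unit_multiple_def by fastforce
  have ec: "eval cs z \<in> carrier R" using cc z eval_in_carrier by auto
  have IH: "(set cs \<subseteq> {\<zero>} \<and> eval cs z = \<zero>) \<or> (\<exists>e. e mod N < ?n \<and> unit_multiple W z e (eval cs z))"
    using Cons by auto
  show ?case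
  proof (cases "c = \<zero>")
    case True
    then have "eval (c # cs) z = eval cs z" using z ec by simp
    then show ?thesis using IH True by (auto intro: less_SucI)
  next
    case False
    then obtain d u where u: "u \<in> W - nonunits W" "c = z [^] (N * d) \<otimes> u"
      using Cons.prems(2)[of c] by (auto simp: unit_multiple_def)
    have uc: "u \<in> carrier R" using u subringE(1)[OF Ws] by auto
    have "c \<otimes> z [^] ?n = z [^] (N * d + ?n) \<otimes> u" using u z uc by (simp add: m_ac flip: nat_pow_mult)
    then have t: "unit_multiple W z (N * d + ?n) (c \<otimes> z [^] ?n)" using u by (auto simp: unit_multiple_def)
    \<comment> \<open>Coefficients have orders divisible by \<open>N\<close> and there are at most
      \<open>N\<close> of them, so the order of a term modulo \<open>N\<close> reveals its position;
      all earlier dominant orders have smaller residues.\<close>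
    have md: "(N * d + ?n) mod N = ?n" using Cons.prems(1) by simp
    from IH show ?thesis
    proof
      assume "set cs \<subseteq> {\<zero>} \<and> eval cs z = \<zero>"
      then have "eval (c # cs) z = c \<otimes> z [^] ?n" using z cc by simp
      then show ?thesis using t md by (intro disjI2 exI[of _ "N * d + ?n"]) auto
    next
      assume "\<exists>e. e mod N < ?n \<and> unit_multiple W z e (eval cs z)"
      then obtain e where e: "e mod N < ?n" "unit_multiple W z e (eval cs z)" by auto
      then have "N * d + ?n \<noteq> e" using md by auto
      then have "unit_multiple W z (max (N * d + ?n) e) (eval (c # cs) z)"
        using unit_multiple_sum[OF W z t e(2)] by simp
      moreover have "max (N * d + ?n) e mod N < length (c # cs)" using md e by (auto simp: max_def)
      ultimately show ?thesis by blast
    qed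
  qed
qed simp

text \<open>Nonzero constants are units of \<open>W\<close>, so they have order \<open>0\<close>,
  and the dominant-term argument applies with \<open>N\<close> equal to the length of the
  list.\<close>

lemma eval_pole_order:
  assumes W: "valring W" and k: "subfield k R" "k \<subseteq> W" and y: "y \<in> carrier R" "y \<notin> W"
    and p: "set p \<subseteq> k"
  shows "eval p y = \<zero> \<or> (\<exists>e. unit_multiple W y e (eval p y))"
proof -
  note Ws = valringE(1)[OF W]
  have "\<exists>d. unit_multiple W y (length p * d) c" if "c \<in> set p" "c \<noteq> \<zero>" for c
  proof -
    have "c \<in> W - nonunits W" "c \<in> carrier R"
      using subfield_nonunits[OF Ws k, of c] that p k(2) subfieldE(3)[OF k(1)] by (auto simp: subset_iff)
    then show ?thesis by (auto simp: unit_multiple_def intro!: exI[of _ 0] bexI[of _ c])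
  qed
  then show ?thesis using eval_dominant_term[OF W y order_refl, of p] by blast
qed

text \<open>The conclusion says that \<open>S\<close> is integral over \<open>k[y]\<close>, phrased
  with valuation rings so that it can later be reused over a larger constant field. The hypothesis
  \<open>dep\<close> is transcendence degree at most one. The inductive step uses Nagata's
  substitution: \<open>y\<close> is replaced by \<open>y \<oplus> s [^] N\<close>.\<close>

theorem noether_normalization_curve:
  assumes k: "subfield k R" and "finite S" "S \<subseteq> carrier R"
    and dep: "\<And>y z. y \<in> generate_ring R (k \<union> S) \<Longrightarrow> z \<in> generate_ring R (k \<union> S) \<Longrightarrow>
      (algebraic over k) y \<or> (algebraic over (generate_field R (insert y k))) z"
  shows "\<exists>y\<in>generate_ring R (k \<union> S). \<forall>W. valring W \<and> k \<subseteq> W \<and> y \<in> W \<longrightarrow> S \<subseteq> W"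
  using assms(2-)
proof (induction S)
  case empty
  then show ?case using generate_ring.one by blast
next
  case (insert s S)
  have kc: "k \<subseteq> carrier R" using subfieldE(3)[OF k] .
  let ?A = "generate_ring R (k \<union> insert s S)"
  have Sc: "S \<subseteq> carrier R" "s \<in> carrier R" "k \<union> insert s S \<subseteq> carrier R" using insert kc by auto
  have A: "subring ?A R" using generate_ring_is_subring[OF Sc(3)] .
  have sA: "s \<in> ?A" using generate_ring.incl[of s "k \<union> insert s S" R] by auto
  have sub: "generate_ring R (k \<union> S) \<subseteq> ?A" using mono_generate_ring[of "k \<union> S", OF _ Sc(3)] by auto
  then obtain y where y: "y \<in> generate_ring R (k \<union> S)" "\<And>W. valring W \<Longrightarrow> k \<subseteq> W \<Longrightarrow> y \<in> W \<Longrightarrow> S \<subseteq> W"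
    using insert.IH[OF Sc(1)] insert.prems(2) by (meson subsetD)
  have yA: "y \<in> ?A" and yc: "y \<in> carrier R" using y sub subringE(1)[OF A] by auto
  show ?case
  proof (cases "(algebraic over k) y")
    case True
    have "insert s S \<subseteq> W" if "valring W" "k \<subseteq> W" "s \<in> W" for W
      using algebraic_valring[OF that(1) k that(2) yc True] y(2) that by auto
    then show ?thesis using sA by blast
  next
    case False
    then have "(algebraic over (generate_field R (insert y k))) s" using insert.prems(2)[OF yA sA] by simp
    then obtain a cs where a: "a \<in> simple_extension k y" "a \<noteq> \<zero>" "set cs \<subseteq> simple_extension k y" "eval (a # cs) s = \<zero>"
      using algebraic_insert_root[OF k yc Sc(2)] by metis
    \<comment> \<open>\<open>N\<close> exceeds every exponent of \<open>s\<close> in the relation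
      over \<open>k[y]\<close>. If \<open>t \<in> W\<close> while \<open>s\<close> is not, then
      \<open>y\<close> has the pole order of \<open>s [^] N\<close>, so the terms of the relation
      have distinct orders and cannot cancel.\<close>
    define N where "N = length (a # cs)"
    define t where "t = y \<oplus> s [^] N"
    have "s [^] n \<in> ?A" for n :: nat using sA subringE(3,6)[OF A] by (induction n) auto
    then have tA: "t \<in> ?A" using subringE(7)[OF A] yA by (auto simp: t_def)
    have tc: "t \<in> carrier R" using tA subringE(1)[OF A] by auto
    have yt: "y = t \<ominus> s [^] N" unfolding t_def using yc nat_pow_closed[OF Sc(2), of N] by algebra
    have "insert s S \<subseteq> W" if W: "valring W" "k \<subseteq> W" "t \<in> W" for W
    proof -
      note Ws = valringE(1)[OF W(1)]
      have sW: "s \<in> W"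
      proof (rule ccontr)
        assume s: "s \<notin> W"
        have s': "s \<noteq> \<zero>" "inv s \<in> nonunits W" using valring_notin[OF W(1) Sc(2) s] by auto
        have "inv s \<in> W" using s' by (auto simp: nonunits_def)
        then have pw: "inv s [^] n \<in> W" for n :: nat
          using subringE(3,6)[OF Ws] by (induction n) auto
        have n: "inv s [^] N \<in> nonunits W"
          using nonunits_mult[OF Ws s'(2) pw[of "length cs"]] by (simp add: N_def)
        have inv1: "s [^] N \<otimes> inv s [^] N = \<one>" using Sc s' by (simp flip: nat_pow_distrib)
        have "\<ominus> \<one> \<in> W - nonunits W"
          using subringE(3,5)[OF Ws] nonunits_minus[OF Ws, of "\<ominus> \<one>"] one_notin_nonunits[OF Ws] by auto
        then have u: "\<ominus> \<one> \<oplus> t \<otimes> inv s [^] N \<in> W - nonunits W"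
          using unit_add_nonunit[OF W(1)] nonunits_mult[OF Ws n W(3)] by auto
        have yu: "y = s [^] N \<otimes> (\<ominus> \<one> \<oplus> t \<otimes> inv s [^] N)"
        proof -
          define x x' where "x = s [^] N" and "x' = inv s [^] N"
          have "x \<in> carrier R" "x' \<in> carrier R" "x \<otimes> x' = \<one>" using Sc s' inv1 by (auto simp: x_def x'_def)
          moreover from this have "x \<otimes> (\<ominus> \<one> \<oplus> t \<otimes> x') = t \<otimes> (x \<otimes> x') \<ominus> x" using tc by algebra
          ultimately show ?thesis using yt tc by (simp add: x_def x'_def)
        qed
        have yW: "y \<notin> W"
        proof
          assume "y \<in> W"
          then have "s [^] N \<in> W"
            using yt t_def W(3) subringE(5,7)[OF Ws] Sc yc
            by (metis a_assoc a_comm a_inv_closed nat_pow_closed r_neg r_zero)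
          then have "s [^] N \<otimes> inv s [^] N \<in> nonunits W" using nonunits_mult[OF Ws n] by auto
          then show False using inv1 one_notin_nonunits[OF Ws] by simp
        qed
        have "c = \<zero> \<or> (\<exists>d. unit_multiple W s (N * d) c)" if c: "c \<in> set (a # cs)" for c
        proof -
          have "c \<in> simple_extension k y" using c a by auto
          then obtain p where p: "set p \<subseteq> k" "eval p y = c" using simple_extension_eval[OF kc yc] by metis
          \<comment> \<open>Since \<open>y\<close> is \<open>s [^] N\<close> times a unit, an order
            \<open>e\<close> measured by \<open>y\<close> is an order \<open>N * e\<close> measured
            by \<open>s\<close>.\<close>
          have "unit_multiple W s (N * e) c" if e: "unit_multiple W y e c" for e
          proof -
            obtain w where w: "w \<in> W - nonunits W" "c = y [^] e \<otimes> w" using e by (auto simp: unit_multiple_def)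
            define u where "u = \<ominus> \<one> \<oplus> t \<otimes> inv s [^] N"
            have uW: "u \<in> W - nonunits W" "y = s [^] N \<otimes> u" using u yu by (auto simp: u_def)
            have uc: "u \<in> carrier R" "w \<in> carrier R" using uW w subringE(1)[OF Ws] by auto
            have "u [^] n \<in> W - nonunits W" for n :: nat
            proof (induction n)
              case 0
              then show ?case using subringE(3)[OF Ws] one_notin_nonunits[OF Ws] by simp
            next
              case (Suc n)
              then show ?case using unit_mult_closed[OF Ws _ uW(1)] by simp
            qed
            then have "u [^] e \<otimes> w \<in> W - nonunits W" using unit_mult_closed[OF Ws _ w(1)] by auto
            moreover have "c = s [^] (N * e) \<otimes> (u [^] e \<otimes> w)"
              using w(2) uW(2) uc Sc by (simp add: nat_pow_distrib nat_pow_pow m_assoc)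
            ultimately show ?thesis by (auto simp: unit_multiple_def)
          qed
          then show ?thesis using eval_pole_order[OF W(1) k W(2) yc yW p(1)] p(2) by auto
        qed
        then have "(set (a # cs) \<subseteq> {\<zero>} \<and> eval (a # cs) s = \<zero>) \<or>
            (\<exists>e. e mod N < length (a # cs) \<and> unit_multiple W s e (eval (a # cs) s))"
          by (intro eval_dominant_term[OF W(1) Sc(2) s]) (auto simp: N_def)
        then show False using a unit_multiple_nonzero[OF Ws Sc(2) s'(1)] by auto
      qed
      have "s [^] n \<in> W" for n :: nat using sW subringE(3,6)[OF Ws] by (induction n) auto
      then have "y \<in> W" using yt W(3) subringE(5,7)[OF Ws] by (metis a_minus_def)
      then show ?thesis using y(2)[OF W(1,2)] sW by auto
    qed
    then show ?thesis using tA by blast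
  qed
qed

section \<open>Local subrings and localizations\<close>

lemma cring_subring: "subring A R \<Longrightarrow> cring (R\<lparr>carrier := A\<rparr>)"
  using subcringI'[of A] subcring_iff[of A] subringE(1)[of A R] by auto

lemma a_inv_subring:
  assumes A: "subring A R" and x: "x \<in> A"
  shows "\<ominus>\<^bsub>R\<lparr>carrier := A\<rparr>\<^esub> x = \<ominus> x"
proof -
  interpret A: cring "R\<lparr>carrier := A\<rparr>" using cring_subring[OF A] .
  have "x \<in> carrier R" using x subringE(1)[OF A] by auto
  then show ?thesis using A.minus_equality[of "\<ominus> x" x] x subringE(5)[OF A] by (simp add: l_neg)
qed

lemma ideal_subringI:
  assumes A: "subring A R" and I: "I \<subseteq> A" "\<zero> \<in> I"
    and add: "\<And>x y. x \<in> I \<Longrightarrow> y \<in> I \<Longrightarrow> x \<oplus> y \<in> I" and mult: "\<And>a x. a \<in> A \<Longrightarrow> x \<in> I \<Longrightarrow> a \<otimes> x \<in> I"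
  shows "ideal I (R\<lparr>carrier := A\<rparr>)"
proof (rule idealI)
  interpret A: cring "R\<lparr>carrier := A\<rparr>" using cring_subring[OF A] .
  have Ac: "A \<subseteq> carrier R" using subringE(1)[OF A] .
  show "ring (R\<lparr>carrier := A\<rparr>)" by (rule A.ring_axioms)
  have neg: "\<ominus> x \<in> I" if "x \<in> I" for x
    using mult[OF subringE(5)[OF A subringE(3)[OF A]] that] that I Ac by (auto simp: l_minus)
  show "subgroup I (add_monoid (R\<lparr>carrier := A\<rparr>))"
  proof (rule A.add.subgroupI)
    show "I \<subseteq> carrier (R\<lparr>carrier := A\<rparr>)" "I \<noteq> {}" using I by auto
    show "\<ominus>\<^bsub>R\<lparr>carrier := A\<rparr>\<^esub> x \<in> I" if "x \<in> I" for x
      using that neg a_inv_subring[OF A] I by auto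
    show "x \<oplus>\<^bsub>R\<lparr>carrier := A\<rparr>\<^esub> y \<in> I" if "x \<in> I" "y \<in> I" for x y using add that by simp
  qed
  show "x \<otimes>\<^bsub>R\<lparr>carrier := A\<rparr>\<^esub> a \<in> I" if "a \<in> I" "x \<in> carrier (R\<lparr>carrier := A\<rparr>)" for a x
    using mult that by simp
  show "a \<otimes>\<^bsub>R\<lparr>carrier := A\<rparr>\<^esub> x \<in> I" if "a \<in> I" "x \<in> carrier (R\<lparr>carrier := A\<rparr>)" for a x
  proof -
    have "a \<in> carrier R" "x \<in> carrier R" using that Ac I by auto
    then have "a \<otimes> x = x \<otimes> a" by (rule m_comm)
    then show ?thesis using mult[of x a] that by simp
  qed
qed

lemma ideal_subringE:
  assumes "ideal I (R\<lparr>carrier := A\<rparr>)"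
  shows "I \<subseteq> A" "\<zero> \<in> I" "\<And>x y. x \<in> I \<Longrightarrow> y \<in> I \<Longrightarrow> x \<oplus> y \<in> I" "\<And>a x. a \<in> A \<Longrightarrow> x \<in> I \<Longrightarrow> a \<otimes> x \<in> I"
  using ideal.Icarr[OF assms] additive_subgroup.zero_closed[OF ideal.axioms(1)[OF assms]]
    additive_subgroup.a_closed[OF ideal.axioms(1)[OF assms]] ideal.I_l_closed[OF assms] by auto

section \<open>Centers of valuation rings\<close>

lemma prime_nonunits:
  assumes W: "valring W" and A: "subring A R" "A \<subseteq> W"
  shows "primeideal (nonunits W \<inter> A) (R\<lparr>carrier := A\<rparr>)"
proof (rule primeidealI)
  note Ws = valringE(1)[OF W]
  show "ideal (nonunits W \<inter> A) (R\<lparr>carrier := A\<rparr>)"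
    by (rule ideal_subringI[OF A(1)])
      (use nonunits_zero[OF Ws] nonunits_add[OF W] nonunits_mult[OF Ws] subringE[OF A(1)] A(2) in auto)
  show "cring (R\<lparr>carrier := A\<rparr>)" using cring_subring[OF A(1)] .
  show "carrier (R\<lparr>carrier := A\<rparr>) \<noteq> nonunits W \<inter> A"
    using one_notin_nonunits[OF Ws] subringE(3)[OF A(1)] by auto
  show "a \<in> nonunits W \<inter> A \<or> b \<in> nonunits W \<inter> A"
    if "a \<in> carrier (R\<lparr>carrier := A\<rparr>)" "b \<in> carrier (R\<lparr>carrier := A\<rparr>)"
      "a \<otimes>\<^bsub>R\<lparr>carrier := A\<rparr>\<^esub> b \<in> nonunits W \<inter> A" for a b
    using that nonunits_prime[OF Ws, of a b] A by auto
qed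

lemma prime_zero:
  assumes "subring A R"
  shows "primeideal {\<zero>} (R\<lparr>carrier := A\<rparr>)"
proof (rule primeidealI)
  have Ac: "A \<subseteq> carrier R" using subringE(1)[OF assms] .
  show "ideal {\<zero>} (R\<lparr>carrier := A\<rparr>)"
    by (rule ideal_subringI[OF assms]) (use subringE(2)[OF assms] Ac in auto)
  show "cring (R\<lparr>carrier := A\<rparr>)" using cring_subring[OF assms] .
  show "carrier (R\<lparr>carrier := A\<rparr>) \<noteq> {\<zero>}" using subringE(3)[OF assms] by auto
  show "a \<in> {\<zero>} \<or> b \<in> {\<zero>}"
    if "a \<in> carrier (R\<lparr>carrier := A\<rparr>)" "b \<in> carrier (R\<lparr>carrier := A\<rparr>)"
      "a \<otimes>\<^bsub>R\<lparr>carrier := A\<rparr>\<^esub> b \<in> {\<zero>}" for a b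
    using that integral_iff[of a b] Ac by auto
qed

text \<open>If \<open>A / q\<close> were a field, then Zariski's lemma would make the residue class of \<open>y\<close> algebraic.\<close>

lemma center_not_maximal:
  assumes k: "subfield k R" and S: "finite S" "S \<subseteq> carrier R" and A: "A = generate_ring R (k \<union> S)"
    and W: "valring W" "A \<subseteq> W" and y: "y \<in> A" "generate_field R (insert y k) \<subseteq> W"
    and tr: "\<not> (algebraic over k) y"
  shows "\<exists>W2. valring W2 \<and> A \<subseteq> W2 \<and> nonunits W \<inter> A \<subset> nonunits W2 \<inter> A"
proof -
  note Ws = valringE(1)[OF W(1)]
  have kc: "k \<subseteq> carrier R" using subfieldE(3)[OF k] .
  then have gc: "k \<union> S \<subseteq> carrier R" using S by auto
  have As: "subring A R" unfolding A using generate_ring_is_subring[OF gc] .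
  have Ac: "A \<subseteq> carrier R" using subringE(1)[OF As] .
  have gA: "k \<union> S \<subseteq> A" unfolding A using generate_ring.incl[of _ "k \<union> S" R] by blast
  define q where "q = nonunits W \<inter> A"
  let ?A = "R\<lparr>carrier := A\<rparr>"
  have q: "primeideal q ?A" unfolding q_def using prime_nonunits[OF W(1) As W(2)] .
  have qi: "ideal q ?A" using primeideal.axioms(1)[OF q] .
  note qE = ideal_subringE[OF qi]
  have q1: "\<one> \<notin> q" using one_notin_nonunits[OF Ws] by (auto simp: q_def)
  have not_max: "\<not> maximalideal q ?A"
  proof
    assume max: "maximalideal q ?A"
    interpret A: cring ?A using cring_subring[OF As] .
    interpret q: maximalideal q ?A using max .
    let ?Q = "?A Quot q"
    interpret Q: field ?Q using q.quotient_is_field[OF A.cring_axioms] .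
    let ?h = "\<lambda>x. q +>\<^bsub>?A\<^esub> x"
    interpret h: ring_hom_ring ?A ?Q ?h using q.rcos_ring_hom_ring .
    have h0: "x \<in> q" if "x \<in> A" "?h x = \<zero>\<^bsub>?Q\<^esub>" for x
    proof -
      have "abelian_subgroup q ?A"
        using A.is_abelian_group q.additive_subgroup_axioms by (intro abelian_subgroupI3) auto
      then have "x \<in> ?h x" using abelian_subgroup.a_rcos_self[of q ?A x] that by simp
      then show ?thesis using that by (simp add: FactRing_def)
    qed
    have ksub: "subfield k ?A"
      using A.subfield_iff(1)[of k] subfield_iff(2)[OF k] gA by simp
    have hk: "subfield (?h ` k) ?Q"
      using h.img_is_subfield(2)[OF ksub] Q.one_not_zero by simp
    have gen: "?h a \<in> generate_ring ?Q (?h ` k \<union> ?h ` S)" if "a \<in> generate_ring R (k \<union> S)" for a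
      using that
    proof induction
      case one
      have "?h \<one> = \<one>\<^bsub>?Q\<^esub>" using h.hom_one by simp
      then show ?case using generate_ring.one by metis
    next
      case (incl a)
      then show ?case using generate_ring.incl[of "?h a" "?h ` k \<union> ?h ` S" ?Q] by auto
    next
      case (a_inv a)
      then have aA: "a \<in> A" by (simp add: A)
      then have "?h (\<ominus> a) = \<ominus>\<^bsub>?Q\<^esub> ?h a" using h.hom_a_inv[of a] a_inv_subring[OF As aA] by simp
      then show ?case using generate_ring.a_inv[OF a_inv(2)] by simp
    next
      case (eng_add a b)
      then have "?h (a \<oplus> b) = ?h a \<oplus>\<^bsub>?Q\<^esub> ?h b" using h.hom_add[of a b] by (simp flip: A)
      then show ?case using generate_ring.eng_add[OF eng_add(3,4)] by simp
    next
      case (eng_mult a b)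
      then have "?h (a \<otimes> b) = ?h a \<otimes>\<^bsub>?Q\<^esub> ?h b" using h.hom_mult[of a b] by (simp flip: A)
      then show ?case using generate_ring.eng_mult[OF eng_mult(3,4)] by simp
    qed
    have hSc: "?h ` k \<union> ?h ` S \<subseteq> carrier ?Q" using h.hom_closed gA by auto
    have surj: "carrier ?Q = ?h ` A"
      by (auto simp: FactRing_def A_RCOSETS_def' )
    then have Qgen: "generate_ring ?Q (?h ` k \<union> ?h ` S) = carrier ?Q"
      using gen[folded A] Q.generate_ring_incl[OF hSc] by auto
    have yQ: "?h y \<in> carrier ?Q" using h.hom_closed[of y] y by simp
    have "(Q.algebraic over (?h ` k)) (?h y)"
      using Q.zariski_lemma[of "?h ` S" "?h ` k" "?h y"] S hSc hk Qgen Q.carrier_is_subfield yQ by simp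
    then obtain c cs where c: "c \<in> ?h ` k" "c \<noteq> \<zero>\<^bsub>?Q\<^esub>" "set cs \<subseteq> ?h ` k" "Q.eval (c # cs) (?h y) = \<zero>\<^bsub>?Q\<^esub>"
      using Q.algebraic_root[OF hk yQ] by metis
    have "\<exists>ds. set ds \<subseteq> k \<and> map ?h ds = cs" using c(3)
      by (induction cs) (force, auto, metis insert_subset list.simps(9,15))
    then obtain d ds where d: "d \<in> k" "?h d = c" "set ds \<subseteq> k" "map ?h ds = cs" using c(1) by auto
    have dA: "set (d # ds) \<subseteq> carrier ?A" using d gA by auto
    have "?h (A.eval (d # ds) y) = Q.eval (map ?h (d # ds)) (?h y)"
      using h.eval_hom'[OF _ dA, of y] y by simp
    also have "\<dots> = \<zero>\<^bsub>?Q\<^esub>" using c(4) d by simp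
    finally have "?h (A.eval (d # ds) y) = \<zero>\<^bsub>?Q\<^esub>" .
    moreover have "A.eval (d # ds) y \<in> A" using A.eval_in_carrier[OF dA, of y] y by simp
    ultimately have ev: "eval (d # ds) y \<in> q" using h0 eval_consistent[OF As] by metis
    have "c \<noteq> q" using c(2) by (simp add: FactRing_def)
    then have "d \<noteq> \<zero>" using d(2) A.a_rcos_zero[OF qi qE(2)] by auto
    then have nz: "eval (d # ds) y \<noteq> \<zero>"
      using algebraic_over_subset_root[OF subfieldE(1)[OF k], of d ds y] d tr by auto
    have yc: "y \<in> carrier R" using y Ac by auto
    have ykc: "insert y k \<subseteq> carrier R" using yc kc by auto
    let ?k' = "generate_field R (insert y k)"
    have k': "subfield ?k' R" using generate_field_is_subfield[OF ykc] .
    have "insert y k \<subseteq> ?k'" using generate_field.incl[of _ "insert y k" R] by blast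
    then have "eval (d # ds) y \<in> ?k'"
      using ring.eval_in_carrier[OF subring_is_ring[OF subfieldE(1)[OF k']], of "d # ds" y]
        eval_consistent[OF subfieldE(1)[OF k']] d by auto
    \<comment> \<open>The value of this polynomial is a nonzero element of the field generated by
      \<open>k\<close> and \<open>y\<close>, which lies in \<open>W\<close>; so it is a unit there,
      although the algebraic relation modulo \<open>q\<close> places it in the center.\<close>
    then have "eval (d # ds) y \<notin> nonunits W" using subfield_nonunits[OF Ws k' y(2)] nz by auto
    then show False using ev by (auto simp: q_def)
  qed
  \<comment> \<open>Since the center is not maximal, there is a larger proper ideal, and Chevalley's
    theorem realizes it inside the center of another valuation ring.\<close>
  have "\<exists>J. ideal J ?A \<and> q \<subset> J \<and> J \<noteq> A"
  proof (rule ccontr)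
    assume "\<not> ?thesis"
    then have "maximalideal q ?A"
      using q1 subringE(3)[OF As] by (intro maximalidealI[OF qi]) auto
    then show False using not_max by simp
  qed
  then obtain J where J: "ideal J ?A" "q \<subset> J" "J \<noteq> A" by auto
  note JE = ideal_subringE[OF J(1)]
  have Jc: "J \<subseteq> carrier R" using JE(1) Ac by auto
  have "x \<in> J" if "x \<in> extended_ideal A J" for x
    using that
  proof induction
    case (lin i w h)
    then have "i \<otimes> w = w \<otimes> i" using Jc Ac m_comm by auto
    then show ?case using lin JE by auto
  qed (rule JE(2))
  moreover have "\<one> \<notin> J"
  proof
    assume "\<one> \<in> J"
    then have "A \<subseteq> J" using JE(4)[of _ \<one>] Ac by force
    then show False using J(3) JE(1) by auto
  qed
  ultimately obtain W2 where W2: "valring W2" "A \<subseteq> W2" "J \<subseteq> nonunits W2"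
    using valring_exists[OF As JE(1)] by metis
  then have "q \<subset> nonunits W2 \<inter> A" using J(2) JE(1) by auto
  then show ?thesis using W2 by (auto simp: q_def)
qed

text \<open>By Zariski's lemma the algebra generated by \<open>S\<close> over \<open>k(y)\<close> is
  not a field, because \<open>z\<close> is transcendental over \<open>k(y)\<close>. A valuation ring
  in which some nonzero element of it is a nonunit has a nonzero center on \<open>A\<close>; it
  contains \<open>k(y)\<close>, so by \<open>center_not_maximal\<close> its center lies properly
  below another one.\<close>

lemma chain_of_centers:
  assumes k: "subfield k R" and S: "finite S" "S \<subseteq> carrier R" and A: "A = generate_ring R (k \<union> S)"
    and y: "y \<in> A" "\<not> (algebraic over k) y" and z: "z \<in> A" "\<not> (algebraic over (generate_field R (insert y k))) z"
  shows "\<exists>W W2. valring W \<and> A \<subseteq> W \<and> valring W2 \<and> A \<subseteq> W2 \<and>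
    {\<zero>} \<subset> nonunits W \<inter> A \<and> nonunits W \<inter> A \<subset> nonunits W2 \<inter> A"
proof -
  have kc: "k \<subseteq> carrier R" using subfieldE(3)[OF k] .
  then have gc: "k \<union> S \<subseteq> carrier R" using S by auto
  have As: "subring A R" unfolding A using generate_ring_is_subring[OF gc] .
  have Ac: "A \<subseteq> carrier R" using subringE(1)[OF As] .
  have gA: "k \<union> S \<subseteq> A" unfolding A using generate_ring.incl[of _ "k \<union> S" R] by blast
  have yc: "y \<in> carrier R" using y Ac by auto
  let ?k = "generate_field R (insert y k)"
  have ykc: "insert y k \<subseteq> carrier R" using yc kc by auto
  have k': "subfield ?k R" using generate_field_is_subfield[OF ykc] .
  have kk': "insert y k \<subseteq> ?k" using generate_field.incl[of _ "insert y k" R] by blast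
  have g'c: "?k \<union> S \<subseteq> carrier R" using subfieldE(3)[OF k'] S by auto
  define E where "E = generate_ring R (?k \<union> S)"
  have E: "subring E R" unfolding E_def using generate_ring_is_subring[OF g'c] .
  have gE: "?k \<union> S \<subseteq> E" unfolding E_def using generate_ring.incl[of _ "?k \<union> S" R] by blast
  have AE: "A \<subseteq> E" unfolding A using generate_ring_min_subring1[OF gc E] gE kk' by auto
  have "\<not> subfield E R"
    using zariski_lemma[OF S k', of z] z AE unfolding E_def by auto
  then obtain f where f: "f \<in> E" "f \<noteq> \<zero>" "inv f \<notin> E" using subfieldI'[OF E] by auto
  have fc: "f \<in> carrier R" using f subringE(1)[OF E] by auto
  have "\<one> \<notin> extended_ideal E {f}"
  proof
    assume "\<one> \<in> extended_ideal E {f}"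
    then obtain w where w: "w \<in> E" "f \<otimes> w = \<one>" using extended_ideal_singleton[OF E f(1)] by metis
    then have "w = inv f" using fc f subringE(1)[OF E] by (metis mult_inv_cancel(2) r_one subsetD inv_nz(1))
    then show False using w f by simp
  qed
  then obtain W where W: "valring W" "E \<subseteq> W" "f \<in> nonunits W"
    using valring_exists[OF E, of "{f}"] f by auto
  note Ws = valringE(1)[OF W(1)]
  define B where "B = simple_extension k y"
  have B: "subring B R" unfolding B_def using simple_extension_is_subring[OF subfieldE(1)[OF k] yc] .
  have BA: "B \<subseteq> A" unfolding B_def using simple_extension_subring_incl[OF As] gA y by auto
  have kB: "?k = generate_field R B" unfolding B_def using generate_field_insert[OF k yc] .
  \<comment> \<open>Elements of \<open>k(y)[S]\<close> are carried into \<open>A\<close> by nonzero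
    polynomials in \<open>y\<close>. Applied to the nonunit \<open>f\<close>, this produces a
    nonzero element in the center on \<open>A\<close>.\<close>
  have "\<exists>s\<in>B - {\<zero>}. s \<otimes> e \<in> A" if "e \<in> E" for e
    using that unfolding E_def
  proof induction
    case one
    then show ?case using subringE(3)[OF B] subringE(3)[OF As] by (intro bexI[of _ \<one>]) auto
  next
    case (incl h)
    then consider "h \<in> S" | "h \<in> ?k" by auto
    then show ?case
    proof cases
      case 1
      then have "h \<in> A" "h \<in> carrier R" using gA S(2) by auto
      then have "\<one> \<otimes> h \<in> A" by simp
      then show ?thesis using subringE(3)[OF B] by (intro bexI[of _ \<one>]) auto
    next
      case 2
      then show ?thesis using generate_field_fraction[OF B] BA kB by blast
    qed
  next
    case (a_inv e)
    then obtain s where s: "s \<in> B" "s \<noteq> \<zero>" "s \<otimes> e \<in> A" by auto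
    have c: "s \<in> carrier R" "e \<in> carrier R" using s BA Ac a_inv(1) subringE(1)[OF E] by (auto simp: E_def)
    then have "s \<otimes> (\<ominus> e) = \<ominus> (s \<otimes> e)" by algebra
    then have "s \<otimes> (\<ominus> e) \<in> A" using subringE(5)[OF As s(3)] by simp
    then show ?case using s by blast
  next
    case (eng_add e e')
    then obtain s t where s: "s \<in> B" "s \<noteq> \<zero>" "s \<otimes> e \<in> A" "t \<in> B" "t \<noteq> \<zero>" "t \<otimes> e' \<in> A" by auto
    have c: "s \<in> carrier R" "e \<in> carrier R" "t \<in> carrier R" "e' \<in> carrier R"
      using s BA Ac eng_add(1,2) subringE(1)[OF E] by (auto simp: E_def)
    then have "(s \<otimes> t) \<otimes> (e \<oplus> e') = t \<otimes> (s \<otimes> e) \<oplus> s \<otimes> (t \<otimes> e')" by algebra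
    moreover have "t \<otimes> (s \<otimes> e) \<oplus> s \<otimes> (t \<otimes> e') \<in> A" using s BA subringE(6,7)[OF As] by (simp add: subset_iff)
    moreover have "s \<otimes> t \<in> B - {\<zero>}" using s c subringE(6)[OF B] integral_iff by auto
    ultimately show ?case by metis
  next
    case (eng_mult e e')
    then obtain s t where s: "s \<in> B" "s \<noteq> \<zero>" "s \<otimes> e \<in> A" "t \<in> B" "t \<noteq> \<zero>" "t \<otimes> e' \<in> A" by auto
    have c: "s \<in> carrier R" "e \<in> carrier R" "t \<in> carrier R" "e' \<in> carrier R"
      using s BA Ac eng_mult(1,2) subringE(1)[OF E] by (auto simp: E_def)
    then have "(s \<otimes> t) \<otimes> (e \<otimes> e') = (s \<otimes> e) \<otimes> (t \<otimes> e')" by algebra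
    moreover have "(s \<otimes> e) \<otimes> (t \<otimes> e') \<in> A" using s subringE(6)[OF As] by simp
    moreover have "s \<otimes> t \<in> B - {\<zero>}" using s c subringE(6)[OF B] integral_iff by auto
    ultimately show ?case by metis
  qed
  then obtain s where s: "s \<in> B" "s \<noteq> \<zero>" "s \<otimes> f \<in> A" using f by blast
  have "s \<otimes> f \<in> nonunits W" using nonunits_mult[OF Ws W(3)] s BA AE W(2) by auto
  moreover have "s \<otimes> f \<noteq> \<zero>" using s f fc BA Ac mult_nz by auto
  moreover have "\<zero> \<in> nonunits W \<inter> A" using nonunits_zero[OF Ws] subringE(2)[OF As] by auto
  ultimately have "{\<zero>} \<subset> nonunits W \<inter> A" using s(3) by auto
  moreover have "\<exists>W2. valring W2 \<and> A \<subseteq> W2 \<and> nonunits W \<inter> A \<subset> nonunits W2 \<inter> A"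
    by (rule center_not_maximal[OF k S A W(1) _ y(1) _ y(2)]) (use AE W gE in auto)
  ultimately show ?thesis using W AE by (meson order_trans)
qed

section \<open>Local subrings and the dimension of a curve\<close>

text \<open>Locality stated elementwise. Domination then becomes an inclusion between sets of
  nonunits, and valuation rings are local without mention of ideals.\<close>

definition is_local :: "'a set \<Rightarrow> bool" where
  "is_local P \<longleftrightarrow> subring P R \<and> (\<forall>x\<in>nonunits P. \<forall>y\<in>nonunits P. x \<oplus> y \<in> nonunits P)"

lemma ideal_subset_nonunits:
  assumes P: "subring P R" and I: "ideal I (R\<lparr>carrier := P\<rparr>)" "I \<noteq> P"
  shows "I \<subseteq> nonunits P"
proof
  note IE = ideal_subringE[OF I(1)]
  have Pc: "P \<subseteq> carrier R" using subringE(1)[OF P] .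
  fix x assume x: "x \<in> I"
  show "x \<in> nonunits P"
  proof (rule ccontr)
    assume "x \<notin> nonunits P"
    then have u: "x \<noteq> \<zero>" "inv x \<in> P" using x IE(1) by (auto simp: nonunits_def)
    then have "\<one> \<in> I" using IE(4)[OF u(2) x] x IE(1) Pc by auto
    then have "P \<subseteq> I" using IE(4)[of _ \<one>] Pc by force
    then show False using I(2) IE(1) by auto
  qed
qed

lemma is_local_maximal:
  assumes "is_local P"
  shows "local_ring (R\<lparr>carrier := P\<rparr>)" "max_ideal (R\<lparr>carrier := P\<rparr>) = nonunits P"
proof -
  have P: "subring P R" and add: "\<And>x y. x \<in> nonunits P \<Longrightarrow> y \<in> nonunits P \<Longrightarrow> x \<oplus> y \<in> nonunits P"
    using assms by (auto simp: is_local_def)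
  have id: "ideal (nonunits P) (R\<lparr>carrier := P\<rparr>)"
    by (rule ideal_subringI[OF P]) (use nonunits_zero[OF P] add nonunits_mult[OF P] in \<open>auto simp: nonunits_def\<close>)
  have ne: "nonunits P \<noteq> P" using one_notin_nonunits[OF P] subringE(3)[OF P] by auto
  have max: "maximalideal (nonunits P) (R\<lparr>carrier := P\<rparr>)"
    by (rule maximalidealI[OF id]) (use ne ideal_subset_nonunits[OF P] in auto)
  have uniq: "I = nonunits P" if "maximalideal I (R\<lparr>carrier := P\<rparr>)" for I
  proof -
    interpret I: maximalideal I "R\<lparr>carrier := P\<rparr>" using that .
    have "I \<noteq> P" using I.I_notcarr by simp
    then have "I \<subseteq> nonunits P" using ideal_subset_nonunits[OF P I.is_ideal] by simp
    then show ?thesis using I.I_maximal[OF id] ne by (auto simp: nonunits_def)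
  qed
  show "local_ring (R\<lparr>carrier := P\<rparr>)"
    unfolding local_ring_def using cring_subring[OF P] max uniq by blast
  show "max_ideal (R\<lparr>carrier := P\<rparr>) = nonunits P"
    unfolding max_ideal_def using max uniq by (rule the_equality)
qed

lemma valring_is_local: "valring W \<Longrightarrow> is_local W"
  using nonunits_add valringE(1) by (auto simp: is_local_def)

lemma lies_over_iff:
  "is_local P \<Longrightarrow> is_local Q \<Longrightarrow> lies_over R Q P \<longleftrightarrow> P \<subseteq> Q \<and> nonunits Q \<inter> P = nonunits P"
  by (simp add: lies_over_def is_local_maximal)

lemma nonunits_inter:
  assumes "P \<subseteq> Q" "nonunits P \<subseteq> nonunits Q"
  shows "nonunits Q \<inter> P = nonunits P"
  using assms by (auto simp: nonunits_def)

text \<open>Membership is rephrased as the existence of some \<open>s\<close> outside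
  \<open>q\<close> that multiplies \<open>x\<close> into \<open>A\<close>, or into \<open>q\<close>
  for the nonunits. In this form no numerator has to be chosen and common denominators are
  products.\<close>

lemma localization_props:
  assumes A: "subring A R" and q: "primeideal q (R\<lparr>carrier := A\<rparr>)"
  defines "P \<equiv> localization_at R A q"
  shows "subring P R" "A \<subseteq> P" "is_local P" "nonunits P \<inter> A = q"
    "\<And>x. x \<in> P \<longleftrightarrow> x \<in> carrier R \<and> (\<exists>s\<in>A - q. s \<otimes> x \<in> A)"
    "\<And>x. x \<in> nonunits P \<longleftrightarrow> x \<in> carrier R \<and> (\<exists>s\<in>A - q. s \<otimes> x \<in> q)"
    "\<And>s t. s \<in> A - q \<Longrightarrow> t \<in> A - q \<Longrightarrow> s \<otimes> t \<in> A - q" "\<one> \<in> A - q" "\<zero> \<in> q" "q \<subseteq> A"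
proof -
  interpret q: primeideal q "R\<lparr>carrier := A\<rparr>" using q .
  note qE = ideal_subringE[OF q.is_ideal]
  note AE = subringE[OF A]
  have Ac: "\<And>x. x \<in> A \<Longrightarrow> x \<in> carrier R" using AE(1) by auto
  show "\<zero> \<in> q" "q \<subseteq> A" using qE by auto
  have q1: "\<one> \<notin> q" using q.one_imp_carrier q.I_notcarr by auto
  show one: "\<one> \<in> A - q" using q1 AE(3) by auto
  show mult: "s \<otimes> t \<in> A - q" if "s \<in> A - q" "t \<in> A - q" for s t
    using that q.I_prime[of s t] AE(6) by auto
  have nz: "s \<noteq> \<zero>" if "s \<in> A - q" for s using that qE(2) by auto
  show mem: "x \<in> P \<longleftrightarrow> x \<in> carrier R \<and> (\<exists>s\<in>A - q. s \<otimes> x \<in> A)" for x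
  proof
    assume "x \<in> P"
    then obtain a s where "a \<in> A" "s \<in> A - q" "x = a \<otimes> inv s"
      unfolding P_def localization_at_def by blast
    moreover from this have "s \<otimes> x = a" "x \<in> carrier R" using nz[of s] Ac m_lcomm[of s a "inv s"] by auto
    ultimately show "x \<in> carrier R \<and> (\<exists>s\<in>A - q. s \<otimes> x \<in> A)" by (metis (full_types))
  next
    assume "x \<in> carrier R \<and> (\<exists>s\<in>A - q. s \<otimes> x \<in> A)"
    then obtain s where s: "x \<in> carrier R" "s \<in> A - q" "s \<otimes> x \<in> A" by auto
    then have "x = (s \<otimes> x) \<otimes> inv s" using nz[of s] Ac m_comm[of s x] by auto
    then show "x \<in> P" unfolding P_def localization_at_def using s by blast
  qed
  have pair: "\<exists>s\<in>A - q. s \<otimes> x \<in> B \<and> s \<otimes> y \<in> B"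
    if xy: "x \<in> carrier R" "y \<in> carrier R" "\<exists>s\<in>A - q. s \<otimes> x \<in> B" "\<exists>s\<in>A - q. s \<otimes> y \<in> B"
      "\<And>a b. a \<in> A \<Longrightarrow> b \<in> B \<Longrightarrow> a \<otimes> b \<in> B" for x y B
  proof -
    obtain s t where st: "s \<in> A - q" "s \<otimes> x \<in> B" "t \<in> A - q" "t \<otimes> y \<in> B" using xy(3,4) by blast
    have "(s \<otimes> t) \<otimes> x = t \<otimes> (s \<otimes> x)" "(s \<otimes> t) \<otimes> y = s \<otimes> (t \<otimes> y)"
      using st xy(1,2) Ac by (simp_all add: m_ac)
    then show ?thesis using st xy(5) mult[of s t] by (intro bexI[of _ "s \<otimes> t"]) auto
  qed
  have unit: "\<exists>s\<in>A - q. s \<otimes> x \<in> B" if "x \<in> A" "x \<in> B" for x B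
    using one that Ac by (intro bexI[of _ \<one>]) auto
  show sub: "A \<subseteq> P"
  proof
    fix x assume "x \<in> A"
    then show "x \<in> P" using unit[of x A] Ac by (subst mem) auto
  qed
  show P: "subring P R"
  proof (rule subringI)
    show "P \<subseteq> carrier R" using mem by auto
    show "\<one> \<in> P" using sub AE(3) by auto
    fix x assume x: "x \<in> P"
    then obtain s where s: "s \<in> A - q" "s \<otimes> x \<in> A" "x \<in> carrier R" using mem by auto
    then have "s \<otimes> (\<ominus> x) \<in> A" using AE(5) Ac by (auto simp: r_minus)
    then show "\<ominus> x \<in> P" using s mem by blast
    fix y assume y: "y \<in> P"
    obtain t where t: "t \<in> A - q" "t \<otimes> y \<in> A" "y \<in> carrier R" using mem y by auto
    have "(s \<otimes> t) \<otimes> (x \<otimes> y) = (s \<otimes> x) \<otimes> (t \<otimes> y)" using s t Ac by (simp add: m_ac)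
    then have "(s \<otimes> t) \<otimes> (x \<otimes> y) \<in> A" using AE(6)[OF s(2) t(2)] by simp
    then show "x \<otimes> y \<in> P" using s t mem mult[of s t] by blast
    obtain r where r: "r \<in> A - q" "r \<otimes> x \<in> A" "r \<otimes> y \<in> A"
      using pair[of x y A] s t AE(6) by blast
    then have "r \<otimes> (x \<oplus> y) \<in> A" using s t Ac AE(7) by (auto simp: r_distr)
    then show "x \<oplus> y \<in> P" using s t r mem by blast
  qed
  show nu: "x \<in> nonunits P \<longleftrightarrow> x \<in> carrier R \<and> (\<exists>s\<in>A - q. s \<otimes> x \<in> q)" for x
  proof
    assume "x \<in> nonunits P"
    then have x: "x \<in> P" "x = \<zero> \<or> inv x \<notin> P" by (auto simp: nonunits_def)
    then obtain s where s: "s \<in> A - q" "s \<otimes> x \<in> A" "x \<in> carrier R" using mem by auto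
    have "s \<otimes> x \<in> q"
    proof (rule ccontr)
      assume n: "s \<otimes> x \<notin> q"
      then have x0: "x \<noteq> \<zero>" using qE(2) s Ac by auto
      have "(s \<otimes> x) \<otimes> inv x = s" using s x0 Ac by auto
      then have "(s \<otimes> x) \<otimes> inv x \<in> A" "s \<otimes> x \<in> A - q" using s n by auto
      then have "\<exists>t\<in>A - q. t \<otimes> inv x \<in> A" by blast
      then have "inv x \<in> P" using mem[of "inv x"] s x0 by auto
      then show False using x x0 by auto
    qed
    then show "x \<in> carrier R \<and> (\<exists>s\<in>A - q. s \<otimes> x \<in> q)" using s by blast
  next
    assume "x \<in> carrier R \<and> (\<exists>s\<in>A - q. s \<otimes> x \<in> q)"
    then obtain s where s: "x \<in> carrier R" "s \<in> A - q" "s \<otimes> x \<in> q" by auto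
    have "x \<in> P" using mem s qE(1) by blast
    moreover have "inv x \<notin> P" if x0: "x \<noteq> \<zero>"
    proof
      assume "inv x \<in> P"
      then obtain t where t: "t \<in> A - q" "t \<otimes> inv x \<in> A" using mem by auto
      have "(t \<otimes> inv x) \<otimes> (s \<otimes> x) = s \<otimes> t" using s t x0 Ac by (simp add: m_ac)
      then have "s \<otimes> t \<in> q" using qE(4)[OF t(2) s(3)] by simp
      then show False using mult[OF s(2) t(1)] by simp
    qed
    ultimately show "x \<in> nonunits P" by (auto simp: nonunits_def)
  qed
  show "is_local P"
    unfolding is_local_def
  proof (intro conjI P ballI)
    fix x y assume "x \<in> nonunits P" "y \<in> nonunits P"
    then have xy: "x \<in> carrier R" "y \<in> carrier R" "\<exists>s\<in>A - q. s \<otimes> x \<in> q" "\<exists>s\<in>A - q. s \<otimes> y \<in> q" using nu by auto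
    then obtain r where r: "r \<in> A - q" "r \<otimes> x \<in> q" "r \<otimes> y \<in> q" using pair[OF xy qE(4)] by blast
    then have "r \<otimes> (x \<oplus> y) \<in> q" using xy Ac qE(3) by (auto simp: r_distr)
    then show "x \<oplus> y \<in> nonunits P" using nu xy r by blast
  qed
  show "nonunits P \<inter> A = q"
  proof
    show "q \<subseteq> nonunits P \<inter> A"
    proof
      fix x assume "x \<in> q"
      then have "x \<in> A" using qE(1) by auto
      then show "x \<in> nonunits P \<inter> A" using unit[of x q] \<open>x \<in> q\<close> Ac nu[of x] by auto
    qed
    show "nonunits P \<inter> A \<subseteq> q"
    proof
      fix x assume "x \<in> nonunits P \<inter> A"
      then obtain s where "s \<in> A - q" "s \<otimes> x \<in> q" "x \<in> A" using nu by auto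
      then show "x \<in> q" using q.I_prime[of s x] by auto
    qed
  qed
qed

lemma krull_dim_ge_2:
  assumes P: "subring P R" and W: "valring W" "P \<subseteq> W" "valring W2" "P \<subseteq> W2"
    and chain: "{\<zero>} \<subset> nonunits W \<inter> P" "nonunits W \<inter> P \<subset> nonunits W2 \<inter> P"
  shows "enat 2 \<le> krull_dim (R\<lparr>carrier := P\<rparr>)"
proof -
  define q where "q i = (if i = 0 then {\<zero>} else if i = 1 then nonunits W \<inter> P else nonunits W2 \<inter> P)" for i :: nat
  have "primeideal (q i) (R\<lparr>carrier := P\<rparr>)" for i
    using prime_zero[OF P] prime_nonunits[OF W(1) P W(2)] prime_nonunits[OF W(3) P W(4)] by (simp add: q_def)
  moreover have "q i \<subset> q (Suc i)" if "i < 2" for i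
    using that chain by (auto simp: q_def less_Suc_eq numeral_2_eq_2)
  ultimately show ?thesis unfolding krull_dim_def by (intro Sup_upper) blast
qed

text \<open>Two algebraically independent functions on a chart would give a chain of three primes
  below the center of \<open>W2\<close>; localizing there produces a point whose local ring has
  dimension at least two.\<close>

lemma curve_transcendence_degree:
  assumes C: "curve R k F C" and k: "subfield k R" and S: "finite S" "S \<subseteq> carrier R"
    and A: "A = generate_ring R (k \<union> S)" "affine_model R A \<subseteq> C" and y: "y \<in> A" and z: "z \<in> A"
  shows "(algebraic over k) y \<or> (algebraic over (generate_field R (insert y k))) z"
proof (rule ccontr)
  assume "\<not> ?thesis"
  then obtain W W2 where W: "valring W" "A \<subseteq> W" "valring W2" "A \<subseteq> W2"
    "{\<zero>} \<subset> nonunits W \<inter> A" "nonunits W \<inter> A \<subset> nonunits W2 \<inter> A"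
    using chain_of_centers[OF k S A(1) y _ z] by blast
  have As: "subring A R"
    unfolding A(1) using generate_ring_is_subring subfieldE(3)[OF k] S by simp
  define q where "q = nonunits W2 \<inter> A"
  have q: "primeideal q (R\<lparr>carrier := A\<rparr>)" unfolding q_def using prime_nonunits[OF W(3) As W(4)] .
  define P where "P = localization_at R A q"
  note loc = localization_props[OF As q, folded P_def]
  have PC: "P \<in> C" using A(2) q by (auto simp: affine_model_def P_def)
  \<comment> \<open>A valuation ring whose center on \<open>A\<close> is contained in
    \<open>q\<close> inverts everything outside \<open>q\<close>. Hence both rings of the chain
    contain the localization, and their centers can be compared on it.\<close>
  have PW: "P \<subseteq> U" if U: "valring U" "A \<subseteq> U" "nonunits U \<inter> A \<subseteq> q" for U
  proof
    fix x assume "x \<in> P"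
    then obtain a s where *: "a \<in> A" "s \<in> A - q" "x = a \<otimes> inv s"
      unfolding P_def localization_at_def by blast
    then have "s \<notin> nonunits U" using U(3) by auto
    then have "inv s \<in> U" using unitsD[of s U] * U(2) by auto
    then show "x \<in> U" using * U subringE(6)[OF valringE(1)[OF U(1)]] by auto
  qed
  have "{\<zero>} \<subset> nonunits W \<inter> P" "nonunits W \<inter> P \<subset> nonunits W2 \<inter> P"
  proof -
    show "{\<zero>} \<subset> nonunits W \<inter> P" using W(5) loc(2) by auto
    have "nonunits W \<inter> P \<subseteq> nonunits W2"
    proof
      fix x assume x: "x \<in> nonunits W \<inter> P"
      then obtain s where s: "s \<in> A - q" "s \<otimes> x \<in> A" "x \<in> carrier R" using loc(5) by auto
      have "s \<otimes> x \<in> nonunits W" using nonunits_mult[OF valringE(1)[OF W(1)], of x s] x s W(2) by auto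
      then have "s \<otimes> x \<in> nonunits W2" using s W(6) by auto
      moreover have "x \<in> W2" using PW[OF W(3,4)] x by (auto simp: q_def)
      ultimately show "x \<in> nonunits W2"
        using nonunits_prime[OF valringE(1)[OF W(3)], of s x] s W(4) by (auto simp: q_def)
    qed
    then show "nonunits W \<inter> P \<subset> nonunits W2 \<inter> P" using W(6) loc(2) by auto
  qed
  then have "enat 2 \<le> krull_dim (R\<lparr>carrier := P\<rparr>)"
    using krull_dim_ge_2[OF loc(1) W(1) _ W(3)] PW[OF W(1,2)] PW[OF W(3,4)] W(6) by (auto simp: q_def)
  also have "\<dots> \<le> (SUP P \<in> C. krull_dim (R\<lparr>carrier := P\<rparr>))" using PC by (intro SUP_upper)
  also have "\<dots> = 1" using C by (simp add: curve_def)
  finally show False by (simp add: one_enat_def)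
qed

end

section \<open>Function fields in one variable\<close>

text \<open>A chain between \<open>M \<inter> N\<close> and \<open>N\<close> has constant
  intersection with \<open>M\<close>, so all its steps survive when \<open>M\<close> is
  added.\<close>

lemma (in field) len_le_inter:
  assumes K: "subring K R" and sp: "subalgebra K M R" "subalgebra K Z R" and MZ: "M \<subseteq> Z"
    and le: "len_le K M Z n" and N: "N \<subseteq> Z"
  shows "len_le K (M \<inter> N) N n"
  unfolding len_le_def
proof (intro allI impI)
  fix U m assume f: "flag K (M \<inter> N) U m" and U: "U \<subseteq> N"
  obtain a b where ab: "m \<le> a + b" "flag K (M \<inter> N) (U \<inter> M) a" "flag K M (U <+>\<^bsub>R\<^esub> M) b"
    using flag_inter_sum[OF K sp(1) _ f] by auto
  have "a \<le> 0" using len_leD[OF len_le_refl ab(2)] U by auto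
  moreover have "U <+>\<^bsub>R\<^esub> M \<subseteq> Z"
    using subspaceE(3)[OF sp(2)] U N MZ unfolding set_add_iff subset_iff by metis
  then have "b \<le> n" using len_leD[OF le ab(3)] by simp
  ultimately show "m \<le> n" using ab(1) by simp
qed

lemma (in field) subring_pow: "subring A R \<Longrightarrow> x \<in> A \<Longrightarrow> x [^] (n::nat) \<in> A"
  using subringE(3,6)[of A R] by (induction n) auto

lemma (in field) eval_pad:
  assumes "set p \<subseteq> carrier R" "c \<in> carrier R" "x \<in> carrier R" "length p \<le> m"
  shows "eval (c # (replicate (m - length p) \<zero> @ p)) x = c \<otimes> x [^] m \<oplus> eval p x"
  using eval_replicate[OF assms(1,3)] assms(4) by simp

lemma (in field) subring_subspace:
  assumes "subring K R" "subring A R" "K \<subseteq> A"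
  shows "subalgebra K A R"
  by (rule subspaceI[OF assms(1)]) (use subringE[OF assms(2)] assms(3) in auto)

text \<open>As \<open>k\<close> is algebraically closed in the field and does not contain
  \<open>y\<close>, the element \<open>y\<close> is transcendental: the field is a function field in
  one variable, viewed as a finite cover of the projective line by \<open>y\<close>.\<close>

locale function_field = field R for R (structure) +
  fixes k :: "'a set" and y :: 'a
  assumes k: "subfield k R"
    and k_closed: "\<And>x. x \<in> carrier R \<Longrightarrow> (algebraic over k) x \<Longrightarrow> x \<in> k"
    and yc: "y \<in> carrier R" and yk: "y \<notin> k"
    and finite_degree: "finite_dimension (generate_field R (insert y k)) (carrier R)"
begin

definition k1 :: "'a set" where "k1 = generate_field R (insert y k)"

text \<open>The integral closure of \<open>k[y]\<close>: the functions without poles over the affine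
  line.\<close>

definition O_fin :: "'a set" where
  "O_fin = {x \<in> carrier R. \<forall>W. valring W \<longrightarrow> k \<subseteq> W \<longrightarrow> y \<in> W \<longrightarrow> x \<in> W}"

text \<open>The functions regular at all places over infinity, that is, at the poles of
  \<open>y\<close>. It is the integral closure of the local ring of the projective line at
  infinity.\<close>

definition O_inf :: "'a set" where
  "O_inf = {x \<in> carrier R. \<forall>W. valring W \<longrightarrow> k \<subseteq> W \<longrightarrow> y \<notin> W \<longrightarrow> x \<in> W}"

abbreviation i :: 'a where "i \<equiv> inv y"

definition small :: "'a set" where "small = (\<otimes>) i ` O_inf"

text \<open>The functions whose poles at infinity are bounded by those of \<open>y [^] n\<close>;
  accordingly \<open>small\<close> consists of the functions divisible by \<open>inv y\<close>
  there.\<close>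

definition pole :: "nat \<Rightarrow> 'a set" where "pole n = (\<otimes>) (y [^] n) ` O_inf"

lemma k_subring: "subring k R" and kc: "\<And>x. x \<in> k \<Longrightarrow> x \<in> carrier R"
  using subfieldE(1,3)[OF k] by auto

lemma y_nonzero: "y \<noteq> \<zero>" using yk subringE(2)[OF k_subring] by auto

lemma i [simp]: "i \<in> carrier R" "i \<noteq> \<zero>" "y \<otimes> i = \<one>" "i \<otimes> y = \<one>"
  using yc y_nonzero by auto

lemma y_carrier [simp]: "y \<in> carrier R" by (rule yc)

lemma pow_y_i [simp]: "y [^] (n::nat) \<otimes> i [^] n = \<one>" "i [^] (n::nat) \<otimes> y [^] n = \<one>"
  by (simp_all flip: nat_pow_distrib)

lemma O_fin_subring: "subring O_fin R" and O_inf_subring: "subring O_inf R"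
  by (rule subringI; force simp: O_fin_def O_inf_def subringE(3,5-7)[OF valringE(1)])+

lemma k_O: "k \<subseteq> O_fin" "k \<subseteq> O_inf" "y \<in> O_fin"
  using kc by (auto simp: O_fin_def O_inf_def)

lemma O_inf_c [simp]: "x \<in> O_inf \<Longrightarrow> x \<in> carrier R" by (simp add: O_inf_def)

lemmas O_inf_closed = subringE(2-)[OF O_inf_subring]

lemma i_nonunit: "valring W \<Longrightarrow> y \<notin> W \<Longrightarrow> i \<in> nonunits W"
  using valring_notin[of W y] by simp

lemma i_O_inf: "i \<in> O_inf"
proof -
  have "i \<in> W" if "valring W" "y \<notin> W" for W
    using i_nonunit[OF that] unfolding nonunits_def by simp
  then show ?thesis unfolding O_inf_def by simp
qed

lemma i_pow_O_inf: "i [^] (n::nat) \<in> O_inf"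
  by (rule subring_pow[OF O_inf_subring i_O_inf])

text \<open>A function without poles is constant: every valuation ring over \<open>k\<close> falls
  under one of the two definitions, so the element is integral over \<open>k\<close>, hence in
  \<open>k\<close>.\<close>

lemma O_fin_inter_O_inf: "O_fin \<inter> O_inf \<subseteq> k"
proof
  fix x assume x: "x \<in> O_fin \<inter> O_inf"
  have xc: "x \<in> carrier R" using x by simp
  have "x \<in> W" if "valring W" "k \<subseteq> W" for W
    using x that unfolding O_fin_def O_inf_def by (cases "y \<in> W") simp_all
  then have "integral_over k x" unfolding integral_over_iff_valring[OF k_subring] using xc by blast
  then obtain cs where "set cs \<subseteq> k" "eval (\<one> # cs) x = \<zero>" by (auto simp: integral_over_def)
  then have "(algebraic over k) x"
    using algebraic_over_subset_root[OF k_subring subringE(3)[OF k_subring]] by simp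
  then show "x \<in> k" by (rule k_closed[OF xc])
qed

lemma y_notin_O_inf: "y \<notin> O_inf"
  using O_fin_inter_O_inf k_O(3) yk by blast

lemma ex_infinite_place: "\<exists>W. valring W \<and> k \<subseteq> W \<and> y \<notin> W"
  using y_notin_O_inf unfolding O_inf_def by simp

lemma eval_y_nonzero:
  assumes "c \<in> k" "c \<noteq> \<zero>" "set cs \<subseteq> k"
  shows "eval (c # cs) y \<noteq> \<zero>"
  using algebraic_over_subset_root[OF k_subring assms, of y] k_closed[OF yc] yk by auto

lemma small_iff: "x \<in> small \<longleftrightarrow> (\<exists>r\<in>O_inf. x = i \<otimes> r)" by (auto simp: small_def)

lemma small_mult: "r \<in> O_inf \<Longrightarrow> x \<in> small \<Longrightarrow> r \<otimes> x \<in> small"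
  unfolding small_iff by (metis O_inf_c O_inf_closed(5) i(1) m_lcomm)

lemma small_sub: "small \<subseteq> O_inf"
  using O_inf_closed(5) i_O_inf by (auto simp: small_def)

lemma O_inf_subspaces: "subalgebra k O_inf R" "subalgebra k small R" "subalgebra k (pole n) R"
proof -
  show s: "subalgebra k O_inf R" using subring_subspace[OF k_subring O_inf_subring k_O(2)] .
  show "subalgebra k small R" unfolding small_def by (rule subspace_scale[OF k_subring s]) simp
  show "subalgebra k (pole n) R" unfolding pole_def by (rule subspace_scale[OF k_subring s]) simp
qed

lemma small_add: "x \<in> small \<Longrightarrow> x' \<in> small \<Longrightarrow> x \<oplus> x' \<in> small"
  and small_minus: "x \<in> small \<Longrightarrow> \<ominus> x \<in> small" and small_zero: "\<zero> \<in> small"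
  using subspaceE[OF O_inf_subspaces(2)] by auto

lemma pole_iff: "x \<in> pole n \<longleftrightarrow> x \<in> carrier R \<and> i [^] n \<otimes> x \<in> O_inf"
proof
  assume "x \<in> pole n"
  then obtain r where r: "r \<in> O_inf" "x = y [^] n \<otimes> r" by (auto simp: pole_def)
  then have "i [^] n \<otimes> x = (i [^] n \<otimes> y [^] n) \<otimes> r" by (simp only: m_assoc nat_pow_closed i yc O_inf_c)
  then show "x \<in> carrier R \<and> i [^] n \<otimes> x \<in> O_inf" using r by simp
next
  assume x: "x \<in> carrier R \<and> i [^] n \<otimes> x \<in> O_inf"
  then have "x = y [^] n \<otimes> (i [^] n \<otimes> x)" by (simp flip: m_assoc)
  then show "x \<in> pole n" using x unfolding pole_def by blast
qed

lemma pole_mono: "n \<le> m \<Longrightarrow> pole n \<subseteq> pole m"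
proof
  fix x assume "n \<le> m" and x: "x \<in> pole n"
  then obtain l where l: "m = l + n" by (metis le_iff_add add.commute)
  have "i [^] m \<otimes> x = i [^] l \<otimes> (i [^] n \<otimes> x)"
    unfolding l using x by (simp add: pole_iff m_assoc flip: nat_pow_mult)
  then show "x \<in> pole m" using x O_inf_closed(5)[OF i_pow_O_inf] by (simp add: pole_iff)
qed

lemma small_scale: "(\<otimes>) (y [^] Suc n) ` small = pole n"
proof -
  have "y [^] Suc n \<otimes> (i \<otimes> r) = y [^] n \<otimes> r" if "r \<in> O_inf" for r
    using that y_nonzero by (simp add: m_assoc)
  then show ?thesis unfolding small_def pole_def image_image by (rule image_cong[OF refl])
qed

text \<open>A list of length \<open>n\<close> has degree at most \<open>n - 1\<close>. Writing the
  bound as \<open>y [^] n\<close> times \<open>i\<close> keeps it meaningful for the empty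
  list.\<close>

lemma eval_pole:
  assumes "set cs \<subseteq> k"
  shows "\<exists>r\<in>O_inf. eval cs y = y [^] length cs \<otimes> (i \<otimes> r)"
  using assms
proof (induction cs)
  case Nil
  then show ?case using O_inf_closed(1) by (intro bexI[of _ \<zero>]) auto
next
  case (Cons c cs)
  then obtain r where r: "r \<in> O_inf" "eval cs y = y [^] length cs \<otimes> (i \<otimes> r)" by auto
  have c: "c \<in> carrier R" "c \<in> O_inf" using Cons kc k_O by auto
  define s where "s = c \<oplus> i \<otimes> r"
  have s: "s \<in> O_inf" using c r i_O_inf O_inf_closed(5,6) by (simp add: s_def)
  have "eval (c # cs) y = y [^] length cs \<otimes> s"
    using r c unfolding s_def by (simp add: r_distr m_comm)
  also have "\<dots> = y [^] length (c # cs) \<otimes> (i \<otimes> s)" using s y_nonzero by (simp add: m_assoc)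
  finally show ?case using s by blast
qed

lemma eval_in_pole:
  assumes "set p \<subseteq> k" "length p \<le> Suc n"
  shows "eval p y \<in> pole n"
proof -
  obtain r where r: "r \<in> O_inf" "eval p y = y [^] length p \<otimes> (i \<otimes> r)" using eval_pole[OF assms(1)] by auto
  show ?thesis
  proof (cases "length p")
    case 0
    then show ?thesis using subspaceE(2)[OF O_inf_subspaces(3)] by simp
  next
    case (Suc m)
    have "y [^] Suc m \<otimes> (i \<otimes> r) \<in> pole m" using r(1) small_scale[of m] by (auto simp: small_def)
    then show ?thesis using r Suc assms(2) pole_mono[of m n] by auto
  qed
qed

text \<open>The leading coefficient is split off; by \<open>unit_at_infinity\<close> the factor in
  parentheses is a unit of \<open>O_inf\<close>, so \<open>d\<close> is the exact order at
  infinity.\<close>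

lemma eval_leading_form:
  assumes "a \<in> simple_extension k y" "a \<noteq> \<zero>"
  shows "\<exists>d. \<exists>c\<in>k - {\<zero>}. \<exists>r\<in>O_inf. a = y [^] (d::nat) \<otimes> (c \<oplus> i \<otimes> r)"
proof -
  obtain p where p: "p \<in> carrier (k[X])" "eval p y = a"
    using simple_extension_as_eval_img[OF subfieldE(3)[OF k] yc] assms by auto
  then have "p \<noteq> []" using assms(2) by auto
  then obtain c cs where ccs: "p = c # cs" by (cases p) auto
  have c: "c \<in> k - {\<zero>}" "set cs \<subseteq> k" using p(1) unfolding ccs univ_poly_def polynomial_def by auto
  obtain r where r: "r \<in> O_inf" "eval cs y = y [^] length cs \<otimes> (i \<otimes> r)" using eval_pole[OF c(2)] by auto
  have "a = y [^] length cs \<otimes> (c \<oplus> i \<otimes> r)"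
    using p(2) r c kc unfolding ccs by (simp add: r_distr m_comm)
  then show ?thesis using c r by blast
qed

lemma unit_at_infinity:
  assumes c: "c \<in> k - {\<zero>}" and r: "r \<in> O_inf"
  shows "c \<oplus> i \<otimes> r \<noteq> \<zero>" "inv (c \<oplus> i \<otimes> r) \<in> O_inf"
proof -
  have *: "c \<oplus> i \<otimes> r \<in> W - nonunits W" if W: "valring W" "k \<subseteq> W" "y \<notin> W" for W
  proof (rule unit_add_nonunit[OF W(1)])
    show "c \<in> W - nonunits W" using subfield_nonunits[OF valringE(1)[OF W(1)] k W(2)] c W by auto
    have "r \<in> W" using r W unfolding O_inf_def by simp
    then show "i \<otimes> r \<in> nonunits W" by (rule nonunits_mult'[OF valringE(1)[OF W(1)] i_nonunit[OF W(1,3)]])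
  qed
  have cc: "c \<oplus> i \<otimes> r \<in> carrier R" using c r kc by auto
  obtain W where "valring W" "k \<subseteq> W" "y \<notin> W" using ex_infinite_place by auto
  then show nz: "c \<oplus> i \<otimes> r \<noteq> \<zero>" using *[of W] unitsD(1) by blast
  have "inv (c \<oplus> i \<otimes> r) \<in> W" if "valring W" "k \<subseteq> W" "y \<notin> W" for W
    using *[OF that] unitsD(2)[of "c \<oplus> i \<otimes> r" W] by simp
  then show "inv (c \<oplus> i \<otimes> r) \<in> O_inf"
    unfolding O_inf_def using inv_nz(1)[OF cc nz] by simp
qed

section \<open>The residue algebra at infinity has dimension at most the degree of the cover\<close>

text \<open>This is \<open>k\<close> plus \<open>small\<close>, the functions that are constant
  modulo \<open>inv y\<close>. Nonzero elements of \<open>k(y)\<close> become members of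
  \<open>Q - small\<close> after multiplication by a suitable power of \<open>y\<close> or of
  \<open>inv y\<close>.\<close>

definition Q :: "'a set" where "Q = {c \<oplus> i \<otimes> r | c r. c \<in> k \<and> r \<in> O_inf}"

lemma small_Q: "small \<subseteq> Q"
proof
  fix x assume "x \<in> small"
  then obtain r where "r \<in> O_inf" "x = \<zero> \<oplus> i \<otimes> r" unfolding small_iff by fastforce
  then show "x \<in> Q" unfolding Q_def using subringE(2)[OF k_subring] by blast
qed

lemma Q_O_inf: "Q \<subseteq> O_inf"
  using k_O i_O_inf O_inf_closed(5,6) by (auto simp: Q_def)

text \<open>With \<open>u' = c' \<oplus> i \<otimes> r'\<close>, the quotient equals
  \<open>c / c'\<close> plus \<open>i\<close> times \<open>(r c' - c r') / (c' u')\<close>, and this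
  last fraction lies in \<open>O_inf\<close>.\<close>

lemma quotient_of_units:
  assumes "c \<in> k - {\<zero>}" "r \<in> O_inf" "c' \<in> k - {\<zero>}" "r' \<in> O_inf"
  shows "(c \<oplus> i \<otimes> r) \<otimes> inv (c' \<oplus> i \<otimes> r') \<in> Q - small"
proof -
  define u' where "u' = c' \<oplus> i \<otimes> r'"
  define iu where "iu = inv u'"
  define ic where "ic = inv c'"
  have c: "c \<in> carrier R" "r \<in> carrier R" "c' \<in> carrier R" "r' \<in> carrier R" "c' \<noteq> \<zero>" using assms kc by auto
  have u': "u' \<in> carrier R" "u' \<noteq> \<zero>" "iu \<in> O_inf" "u' \<in> O_inf"
    using unit_at_infinity[OF assms(3,4)] c assms k_O i_O_inf O_inf_closed(5,6) by (auto simp: u'_def iu_def)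
  have iu: "iu \<in> carrier R" "u' \<otimes> iu = \<one>" using u' by (auto simp: iu_def)
  have ic: "ic \<in> k" "ic \<in> carrier R" "ic \<otimes> c' = \<one>" using subfield_m_inv[OF k assms(3)] c kc by (auto simp: ic_def)
  have "c \<otimes> ic \<otimes> u' \<oplus> i \<otimes> (r \<otimes> c' \<ominus> c \<otimes> r') \<otimes> ic = (c \<oplus> i \<otimes> r) \<otimes> (ic \<otimes> c')"
    unfolding u'_def using c ic(2) i(1) by algebra
  then have "(c \<oplus> i \<otimes> r) \<otimes> iu = (c \<otimes> ic \<otimes> u' \<oplus> i \<otimes> (r \<otimes> c' \<ominus> c \<otimes> r') \<otimes> ic) \<otimes> iu"
    using c ic by simp
  also have "\<dots> = c \<otimes> ic \<otimes> (u' \<otimes> iu) \<oplus> i \<otimes> ((r \<otimes> c' \<ominus> c \<otimes> r') \<otimes> ic \<otimes> iu)"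
    using c ic(2) iu(1) i(1) u'(1) by algebra
  finally have e: "(c \<oplus> i \<otimes> r) \<otimes> iu = c \<otimes> ic \<oplus> i \<otimes> ((r \<otimes> c' \<ominus> c \<otimes> r') \<otimes> ic \<otimes> iu)"
    using c ic iu by simp
  have "c \<otimes> ic \<in> k" using assms(1) ic subringE(6)[OF k_subring] by auto
  moreover have "(r \<otimes> c' \<ominus> c \<otimes> r') \<otimes> ic \<otimes> iu \<in> O_inf"
  proof -
    have "c \<in> O_inf" "c' \<in> O_inf" "ic \<in> O_inf" using assms k_O ic by auto
    then show ?thesis using assms u' O_inf_closed(4,5,6) by (simp add: a_minus_def)
  qed
  ultimately have "(c \<oplus> i \<otimes> r) \<otimes> iu \<in> Q" unfolding e Q_def by blast
  \<comment> \<open>If the quotient were divisible by \<open>inv y\<close>, then so would be its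
    numerator and hence the constant \<open>c\<close>; this would make \<open>y\<close> regular at
    infinity.\<close>
  moreover have "(c \<oplus> i \<otimes> r) \<otimes> iu \<notin> small"
  proof
    assume "(c \<oplus> i \<otimes> r) \<otimes> iu \<in> small"
    then have "u' \<otimes> ((c \<oplus> i \<otimes> r) \<otimes> iu) \<in> small" using small_mult u'(4) by auto
    moreover have "u' \<otimes> ((c \<oplus> i \<otimes> r) \<otimes> iu) = (c \<oplus> i \<otimes> r) \<otimes> (u' \<otimes> iu)"
      using c u' iu by (intro m_lcomm) auto
    ultimately have "c \<oplus> i \<otimes> r \<in> small" using iu c by simp
    moreover have "i \<otimes> r \<in> small" using assms by (auto simp: small_def)
    ultimately have "(c \<oplus> i \<otimes> r) \<oplus> (\<ominus> (i \<otimes> r)) \<in> small" using small_add small_minus by auto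
    moreover have "(c \<oplus> i \<otimes> r) \<oplus> (\<ominus> (i \<otimes> r)) = c" using c i(1) by algebra
    ultimately have "c \<in> small" by simp
    then obtain s where s: "s \<in> O_inf" "c = i \<otimes> s" unfolding small_iff by auto
    have "y = inv c \<otimes> s" using s c assms(1)
      by (metis DiffD2 O_inf_c i(1) i(3) insertI1 inv_nz(1) inv_nz(4) m_assoc m_comm r_one yc)
    moreover have "inv c \<in> O_inf" using subfield_m_inv(1)[OF k assms(1)] k_O by auto
    ultimately have "y \<in> O_inf" using O_inf_closed(5)[OF _ s(1), of "inv c"] by metis
    then show False using y_notin_O_inf by simp
  qed
  ultimately show ?thesis by (simp add: iu_def u'_def)
qed

lemma k1_subfield: "subfield k1 R" and y_k1: "y \<in> k1" and k_k1: "k \<subseteq> k1"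
proof -
  have "insert y k \<subseteq> carrier R" using kc by auto
  then show "subfield k1 R" unfolding k1_def by (rule generate_field_is_subfield)
  show "y \<in> k1" "k \<subseteq> k1" unfolding k1_def using generate_field.incl[of _ "insert y k" R] by blast+
qed

lemma k1_subring: "subring k1 R" and k1c: "\<And>x. x \<in> k1 \<Longrightarrow> x \<in> carrier R"
  using subfieldE(1,3)[OF k1_subfield] by auto

lemma i_k1: "i \<in> k1"
  using subfield_m_inv(1)[OF k1_subfield, of y] y_k1 y_nonzero by auto

text \<open>The factor \<open>s\<close> is a power of \<open>y\<close> or of \<open>i\<close>. The
  last alternative is what the next lemma depends on: unless \<open>x\<close> is already in
  \<open>Q\<close>, the factor is a positive power of \<open>i\<close>, hence small.\<close>

lemma k1_normal_form:
  assumes x: "x \<in> k1" "x \<noteq> \<zero>"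
  shows "\<exists>s\<in>k1 - {\<zero>}. s \<otimes> x \<in> Q - small \<and> (x \<in> Q \<or> s \<in> small)"
proof -
  have B: "subring (simple_extension k y) R" using simple_extension_is_subring[OF k_subring yc] .
  obtain b where b: "b \<in> simple_extension k y" "b \<noteq> \<zero>" "b \<otimes> x \<in> simple_extension k y"
    using generate_field_fraction[OF B, of x] x generate_field_insert[OF k yc] by (auto simp: k1_def)
  have c: "b \<in> carrier R" "x \<in> carrier R" using b x k1c subringE(1)[OF B] by auto
  then have "b \<otimes> x \<noteq> \<zero>" using mult_nz b x by simp
  then obtain d c r where d: "c \<in> k - {\<zero>}" "r \<in> O_inf" "b \<otimes> x = y [^] (d::nat) \<otimes> (c \<oplus> i \<otimes> r)"
    using eval_leading_form[OF b(3)] by auto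
  obtain e c' r' where e: "c' \<in> k - {\<zero>}" "r' \<in> O_inf" "b = y [^] (e::nat) \<otimes> (c' \<oplus> i \<otimes> r')"
    using eval_leading_form[OF b(1,2)] by auto
  define u where "u = c \<oplus> i \<otimes> r"
  define u' where "u' = c' \<oplus> i \<otimes> r'"
  define w where "w = u \<otimes> inv u'"
  have u: "u \<in> carrier R" "u' \<in> carrier R" "u' \<noteq> \<zero>"
    using d e kc unit_at_infinity(1)[OF e(1,2)] by (auto simp: u_def u'_def)
  have w: "w \<in> Q - small" using quotient_of_units[OF d(1,2) e(1,2)] by (simp add: w_def u_def u'_def)
  have wc: "w \<in> carrier R" using u by (simp add: w_def)
  have eq: "y [^] e \<otimes> x = y [^] d \<otimes> w"
  proof -
    have "u' \<otimes> (y [^] e \<otimes> x) = y [^] d \<otimes> u"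
      using d(3) e(3) u c by (simp add: u_def u'_def m_ac)
    then have "inv u' \<otimes> (u' \<otimes> (y [^] e \<otimes> x)) = inv u' \<otimes> (y [^] d \<otimes> u)" by simp
    then have "y [^] e \<otimes> x = inv u' \<otimes> (y [^] d \<otimes> u)" using u c by simp
    then show ?thesis using u by (simp add: w_def m_ac)
  qed
  have yk: "y [^] n \<in> k1 - {\<zero>}" "i [^] n \<in> k1 - {\<zero>}" for n :: nat
    using subring_pow[OF k1_subring] y_k1 i_k1 y_nonzero by auto
  show ?thesis
  proof (cases "d \<le> e")
    case True
    then obtain l where l: "e = d + l" by (metis le_iff_add)
    have "y [^] d \<otimes> (y [^] l \<otimes> x) = y [^] d \<otimes> w" using eq c by (simp add: l m_assoc flip: nat_pow_mult)
    then have s: "y [^] l \<otimes> x = w" using c wc y_nonzero m_lcancel[of "y [^] d" "y [^] l \<otimes> x" w] by simp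
    then have x: "x = i [^] l \<otimes> w" using c by (metis pow_y_i(2) i(1) l_one m_assoc nat_pow_closed yc)
    have "x \<in> Q"
    proof (cases l)
      case 0
      then show ?thesis using x w wc by simp
    next
      case (Suc l')
      have "i [^] l' \<otimes> w \<in> O_inf" using O_inf_closed(5)[OF i_pow_O_inf] w Q_O_inf by auto
      moreover have "x = i \<otimes> (i [^] l' \<otimes> w)" using x wc unfolding Suc by (simp add: m_ac)
      ultimately show ?thesis using small_Q by (auto simp: small_def)
    qed
    then show ?thesis using s w yk by metis
  next
    case False
    then obtain l where l: "d = e + Suc l" using less_iff_Suc_add[of e d] by auto
    have "y [^] e \<otimes> x = y [^] e \<otimes> (y [^] Suc l \<otimes> w)" using eq wc unfolding l by (simp add: m_assoc flip: nat_pow_mult)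
    then have "x = y [^] Suc l \<otimes> w" using c wc y_nonzero m_lcancel[of "y [^] e" x "y [^] Suc l \<otimes> w"] by simp
    then have "i [^] Suc l \<otimes> x = w" using wc by (metis pow_y_i(2) i(1) l_one m_assoc nat_pow_closed yc)
    moreover have "i \<in> small" unfolding small_iff using O_inf_closed(2) by (intro bexI[of _ \<one>]) simp_all
    then have "i [^] Suc l \<in> small" using small_mult[OF i_pow_O_inf[of l], of i] by simp
    ultimately show ?thesis using w yk by metis
  qed
qed

text \<open>The scaling factor belongs to the coefficient with the largest pole at infinity. When a
  new coefficient enlarges the pole, the additional factor is small, so the coefficients already
  scaled remain in \<open>Q\<close>.\<close>

lemma scale_coefficients:
  assumes "set Ks \<subseteq> k1" "\<not> set Ks \<subseteq> {\<zero>}"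
  shows "\<exists>t\<in>k1 - {\<zero>}. (\<forall>x\<in>set Ks. t \<otimes> x \<in> Q) \<and> (\<exists>x\<in>set Ks. t \<otimes> x \<notin> small)"
  using assms
proof (induction Ks)
  case (Cons x Ks)
  have xc: "x \<in> k1" "x \<in> carrier R" using Cons k1c by auto
  have 0: "\<zero> \<in> Q" using small_Q small_zero by auto
  have sQ: "s \<otimes> q \<in> Q" if "s \<in> small" "q \<in> Q" for s q
  proof -
    have "q \<otimes> s \<in> small" using small_mult that Q_O_inf by auto
    moreover have "q \<otimes> s = s \<otimes> q" using that small_sub Q_O_inf by (intro m_comm) auto
    ultimately show ?thesis using small_Q by auto
  qed
  show ?case
  proof (cases "set Ks \<subseteq> {\<zero>}")
    case True
    then have "x \<noteq> \<zero>" using Cons by auto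
    then obtain s where s: "s \<in> k1 - {\<zero>}" "s \<otimes> x \<in> Q - small" using k1_normal_form xc by blast
    have "s \<otimes> \<zero> \<in> Q" using 0 s k1c by auto
    then show ?thesis using s True by (intro bexI[of _ s]) auto
  next
    case False
    then obtain t where t: "t \<in> k1 - {\<zero>}" "\<And>x. x \<in> set Ks \<Longrightarrow> t \<otimes> x \<in> Q" "\<exists>x\<in>set Ks. t \<otimes> x \<notin> small"
      using Cons by auto
    have tc: "t \<in> carrier R" using t k1c by auto
    show ?thesis
    proof (cases "t \<otimes> x \<in> Q")
      case True
      then show ?thesis using t by (intro bexI[of _ t]) auto
    next
      case False
      have "t \<otimes> x \<noteq> \<zero>" using False 0 by auto
      moreover have "t \<otimes> x \<in> k1" using t xc subringE(6)[OF k1_subring] by auto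
      ultimately obtain s where s: "s \<in> k1 - {\<zero>}" "s \<otimes> (t \<otimes> x) \<in> Q - small" "s \<in> small"
        using k1_normal_form[of "t \<otimes> x"] False by blast
      have sc: "s \<in> carrier R" using s k1c by auto
      have "s \<otimes> t \<in> k1 - {\<zero>}" using s t sc tc subringE(6)[OF k1_subring] mult_nz by auto
      moreover have "(s \<otimes> t) \<otimes> z \<in> Q" if "z \<in> set Ks" for z
        using sQ[OF s(3) t(2)[OF that]] sc tc Cons.prems(1) that k1c m_assoc[of s t z] by auto
      moreover have "(s \<otimes> t) \<otimes> x \<in> Q - small" using s(2) sc tc xc m_assoc[of s t x] by auto
      ultimately show ?thesis by (intro bexI[of _ "s \<otimes> t"]) auto
    qed
  qed
qed simp

text \<open>More than \<open>n\<close> elements of \<open>O_inf\<close> are dependent over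
  \<open>k(y)\<close>. After scaling, the coefficients lie in \<open>Q\<close> and not all are
  small; replacing them by their constant parts gives a nontrivial relation over \<open>k\<close>
  modulo \<open>small\<close>.\<close>

lemma len_small:
  assumes n: "dimension n k1 (carrier R)"
  shows "len_le k small O_inf n"
  unfolding len_le_def
proof (intro allI impI)
  fix U m assume f: "flag k small U m" and U: "U \<subseteq> O_inf"
  obtain ws where ws: "length ws = m" "set ws \<subseteq> U"
    "\<And>cs. length cs = m \<Longrightarrow> set cs \<subseteq> k \<Longrightarrow> combine cs ws \<in> small \<Longrightarrow> set cs \<subseteq> {\<zero>}"
    using flag_independent[OF k f O_inf_subspaces(2)] by blast
  have wO: "set ws \<subseteq> O_inf" using ws U by auto
  then have wc: "set ws \<subseteq> carrier R" by auto
  show "m \<le> n"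
  proof (rule ccontr)
    assume "\<not> m \<le> n"
    then have "dependent k1 ws"
      using independent_length_le_dimension[OF k1_subfield n _ wc] ws(1) by auto
    then obtain Ks where Ks: "length Ks = length ws" "combine Ks ws = \<zero>" "set Ks \<subseteq> k1" "set Ks \<noteq> {\<zero>}"
      using dependent_imp_non_trivial_combine[OF k1_subfield wc] by blast
    have "m \<noteq> 0" using \<open>\<not> m \<le> n\<close> by simp
    then have "\<not> set Ks \<subseteq> {\<zero>}" using Ks(1,4) ws(1) by (metis length_0_conv set_empty subset_singletonD)
    then obtain t where t: "t \<in> k1 - {\<zero>}" "\<And>x. x \<in> set Ks \<Longrightarrow> t \<otimes> x \<in> Q" "\<exists>x\<in>set Ks. t \<otimes> x \<notin> small"
      using scale_coefficients[OF Ks(3)] by auto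
    have tc: "t \<in> carrier R" and Kc: "set Ks \<subseteq> carrier R" using t Ks k1c by auto
    have "\<forall>x\<in>set Ks. \<exists>c. c \<in> k \<and> (\<exists>r\<in>O_inf. t \<otimes> x = c \<oplus> i \<otimes> r)" using t(2) by (force simp: Q_def)
    then obtain f where f: "\<And>x. x \<in> set Ks \<Longrightarrow> f x \<in> k \<and> (\<exists>r\<in>O_inf. t \<otimes> x = f x \<oplus> i \<otimes> r)" by metis
    have "\<exists>r\<in>O_inf. combine (map ((\<otimes>) t) Ks) ws = combine (map f Ks) ws \<oplus> i \<otimes> r"
      using Ks(1) f wO
    proof (induction Ks ws rule: list_induct2)
      case Nil
      then show ?case using O_inf_closed(1) by (intro bexI[of _ \<zero>]) auto
    next
      case (Cons x Ks w ws)
      then obtain r where r: "r \<in> O_inf" "combine (map ((\<otimes>) t) Ks) ws = combine (map f Ks) ws \<oplus> i \<otimes> r" by auto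
      obtain r' where r': "r' \<in> O_inf" "t \<otimes> x = f x \<oplus> i \<otimes> r'" using Cons by auto
      have "set (map f Ks) \<subseteq> carrier R" "set ws \<subseteq> carrier R" using Cons kc by auto
      then have c: "f x \<in> carrier R" "w \<in> carrier R" "r \<in> carrier R" "r' \<in> carrier R" "combine (map f Ks) ws \<in> carrier R"
        using Cons r r' kc by auto
      have "combine (map ((\<otimes>) t) (x # Ks)) (w # ws) = (f x \<oplus> i \<otimes> r') \<otimes> w \<oplus> (combine (map f Ks) ws \<oplus> i \<otimes> r)"
        using r r' by simp
      also have "\<dots> = (f x \<otimes> w \<oplus> combine (map f Ks) ws) \<oplus> i \<otimes> (r' \<otimes> w \<oplus> r)" using c i(1) by algebra
      finally show ?case using r r' Cons.prems(2) O_inf_closed(5,6) by (intro bexI[of _ "r' \<otimes> w \<oplus> r"]) auto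
    qed
    then obtain r where r: "r \<in> O_inf" "combine (map ((\<otimes>) t) Ks) ws = combine (map f Ks) ws \<oplus> i \<otimes> r" by auto
    have "combine (map ((\<otimes>) t) Ks) ws = \<zero>" using combine_r_distr[OF Kc wc tc] Ks(2) tc by simp
    then have "combine (map f Ks) ws \<oplus> i \<otimes> r = \<zero>" using r by simp
    moreover have "set (map f Ks) \<subseteq> carrier R" using f kc by auto
    then have cc: "combine (map f Ks) ws \<in> carrier R" using wc by simp
    ultimately have "combine (map f Ks) ws = \<ominus> (i \<otimes> r)" using r(1) by (metis O_inf_c i(1) m_closed minus_equality)
    then have "combine (map f Ks) ws \<in> small" using small_minus r(1) by (auto simp: small_def)
    then have "set (map f Ks) \<subseteq> {\<zero>}" using ws(3)[of "map f Ks"] f Ks(1) ws(1) by auto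
    then have "t \<otimes> x \<in> small" if "x \<in> set Ks" for x
      using f[OF that] that by (auto simp: small_def)
    then show False using t(3) by auto
  qed
qed

end

section \<open>Counting functions with bounded poles\<close>

context field
begin

text \<open>The vectors \<open>u\<close>, \<open>w \<otimes> u\<close>, ..., up to exponent
  \<open>m - 1\<close> are adjoined one by one. It is applied with \<open>w = y\<close> and a basis
  vector \<open>u\<close> to build lattices, and with \<open>u = \<one>\<close> to bound the residue
  field of a valuation ring.\<close>

lemma flag_powers:
  assumes k: "subfield k R" and Z: "subalgebra k Z R" and w: "w \<in> carrier R" and u: "u \<in> carrier R"
    and nz: "\<And>c cs. c \<in> k \<Longrightarrow> c \<noteq> \<zero> \<Longrightarrow> set cs \<subseteq> k \<Longrightarrow> length cs < m \<Longrightarrow> eval (c # cs) w \<otimes> u \<notin> Z"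
  shows "\<exists>Z'. flag k Z Z' m \<and> (\<forall>x\<in>Z'. \<exists>z\<in>Z. \<exists>p. set p \<subseteq> k \<and> length p \<le> m \<and> x = z \<oplus> eval p w \<otimes> u)"
  using nz
proof (induction m)
  case 0
  have "x = x \<oplus> eval [] w \<otimes> u" if "x \<in> Z" for x using that subspaceE(6)[OF Z] u by simp
  then have "\<forall>x\<in>Z. \<exists>z\<in>Z. \<exists>p. set p \<subseteq> k \<and> length p \<le> 0 \<and> x = z \<oplus> eval p w \<otimes> u"
    by (metis empty_iff empty_set le_refl list.size(3) subsetI)
  then show ?case using flag_0[OF Z order_refl] by blast
next
  case (Suc m)
  have k_subring: "subring k R" and kc: "\<And>x. x \<in> k \<Longrightarrow> x \<in> carrier R" using subfieldE(1,3)[OF k] by auto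
  obtain Z' where Z': "flag k Z Z' m"
    "\<And>x. x \<in> Z' \<Longrightarrow> \<exists>z\<in>Z. \<exists>p. set p \<subseteq> k \<and> length p \<le> m \<and> x = z \<oplus> eval p w \<otimes> u"
    using Suc by fastforce
  have sp: "subalgebra k Z' R" using flagD[OF Z'(1)] by simp
  define g where "g = w [^] m \<otimes> u"
  have g: "g \<in> carrier R" using u w by (simp add: g_def)
  note L = subspace_line_extension[OF k sp g]
  have "g \<notin> Z'"
  proof
    assume "g \<in> Z'"
    then obtain z p where p: "z \<in> Z" "set p \<subseteq> k" "length p \<le> m" "g = z \<oplus> eval p w \<otimes> u" using Z'(2) by blast
    \<comment> \<open>If \<open>w [^] m \<otimes> u\<close> were already reached, subtracting the
      polynomial that reaches it would leave a monic polynomial of degree \<open>m\<close> whose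
      multiple of \<open>u\<close> lies in \<open>Z\<close>. The zeros pad the list to exact
      degree.\<close>
    define q where "q = replicate (m - length p) \<zero> @ map ((\<otimes>) (\<ominus> \<one>)) p"
    have pc: "set p \<subseteq> carrier R" using p kc by auto
    have e: "eval p w \<in> carrier R" using eval_in_carrier[OF pc w] .
    have q: "set q \<subseteq> k" "length q = m" using p subringE(2,3,5,6)[OF k_subring] by (auto simp: q_def)
    have "set (map ((\<otimes>) (\<ominus> \<one>)) p) \<subseteq> carrier R" using pc by auto
    from eval_pad[OF this one_closed w, of m] have "eval (\<one> # q) w = w [^] m \<oplus> (\<ominus> \<one>) \<otimes> eval p w"
      using p(3) eval_map_mult[OF pc _ w, of "\<ominus> \<one>"] w by (simp add: q_def)
    then have ev: "eval (\<one> # q) w = w [^] m \<ominus> eval p w" using e by (simp add: l_minus a_minus_def)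
    have zc: "z \<in> carrier R" using p subspaceE(6)[OF Z] by auto
    have "eval (\<one> # q) w \<otimes> u = z"
    proof -
      have "(w [^] m \<ominus> eval p w) \<otimes> u = g \<ominus> eval p w \<otimes> u"
        unfolding g_def using e u nat_pow_closed[OF w, of m] by algebra
      also have "\<dots> = z" unfolding p(4) using e u zc by algebra
      finally show ?thesis using ev by simp
    qed
    then show False using Suc.prems[of \<one> q] q p(1) subringE(3)[OF k_subring] by auto
  qed
  then have "flag k Z (line_extension k g Z') (Suc m)" using flag_Suc[OF Z'(1) L(1)] L by auto
  moreover have "\<exists>z\<in>Z. \<exists>p. set p \<subseteq> k \<and> length p \<le> Suc m \<and> x = z \<oplus> eval p w \<otimes> u"
    if xL: "x \<in> line_extension k g Z'" for x
  proof -
    obtain c x' where c: "c \<in> k" "x' \<in> Z'" "x = c \<otimes> g \<oplus> x'"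
      using xL unfolding line_extension_mem_iff by auto
    obtain z p where p: "z \<in> Z" "set p \<subseteq> k" "length p \<le> m" "x' = z \<oplus> eval p w \<otimes> u" using Z'(2)[OF c(2)] by blast
    have pc: "set p \<subseteq> carrier R" using p kc by auto
    have e: "eval p w \<in> carrier R" using eval_in_carrier[OF pc w] .
    let ?q = "c # (replicate (m - length p) \<zero> @ p)"
    have "eval ?q w = c \<otimes> w [^] m \<oplus> eval p w" using eval_pad[OF pc _ w p(3)] c kc by blast
    moreover have "x = z \<oplus> (c \<otimes> w [^] m \<oplus> eval p w) \<otimes> u"
    proof -
      have "c \<in> carrier R" "z \<in> carrier R" using c p kc subspaceE(6)[OF Z] by auto
      then show ?thesis unfolding c(3) p(4) g_def using e u nat_pow_closed[OF w, of m] by algebra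
    qed
    moreover have "set ?q \<subseteq> k" "length ?q \<le> Suc m" using c p subringE(2)[OF k_subring] by auto
    ultimately show ?thesis using p(1) by (intro bexI[of _ z] exI[of _ ?q]) simp_all
  qed
  ultimately show ?case by blast
qed

end

context function_field
begin

lemma algebraic_over_k1:
  assumes "x \<in> carrier R"
  obtains a cs where "a \<in> simple_extension k y" "a \<noteq> \<zero>" "set cs \<subseteq> simple_extension k y" "eval (a # cs) x = \<zero>"
proof -
  have "(algebraic over k1) x"
    using finite_dimension_imp_algebraic[OF k1_subfield carrier_is_subring finite_degree[folded k1_def] assms] .
  then show thesis using algebraic_insert_root[OF k yc assms] that unfolding k1_def by metis
qed

text \<open>In an equation for \<open>x\<close> over \<open>k[y]\<close> the leading coefficient is
  \<open>y [^] d\<close> times a unit at infinity, so its inverse is regular there. A bound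
  \<open>n\<close> for the poles of the other coefficients therefore bounds the pole of
  \<open>x\<close> too.\<close>

lemma pole_exhaustive:
  assumes "x \<in> carrier R"
  shows "\<exists>n. x \<in> pole n"
proof -
  obtain a cs where a: "a \<in> simple_extension k y" "a \<noteq> \<zero>" "set cs \<subseteq> simple_extension k y" "eval (a # cs) x = \<zero>"
    using algebraic_over_k1[OF assms] by metis
  have B: "simple_extension k y \<subseteq> carrier R"
    using subringE(1)[OF simple_extension_is_subring[OF k_subring yc]] .
  have "\<exists>n. c \<in> pole n" if c: "c \<in> simple_extension k y" for c
  proof -
    obtain p where "set p \<subseteq> k" "eval p y = c" using simple_extension_eval[OF subfieldE(3)[OF k] yc c] by metis
    then show ?thesis using eval_in_pole[of p "length p"] by auto
  qed
  then have "\<exists>n. set cs \<subseteq> pole n"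
    using a(3)
  proof (induction cs)
    case (Cons c cs)
    obtain n where "c \<in> pole n" using Cons.prems(1)[of c] Cons.prems(2) by auto
    moreover obtain m where "set cs \<subseteq> pole m" using Cons by auto
    ultimately show ?case using pole_mono[of m "max m n"] pole_mono[of n "max m n"] by (intro exI[of _ "max m n"]) auto
  qed simp
  then obtain n where n: "set cs \<subseteq> pole n" by auto
  obtain d c r where d: "c \<in> k - {\<zero>}" "r \<in> O_inf" "a = y [^] (d::nat) \<otimes> (c \<oplus> i \<otimes> r)"
    using eval_leading_form[OF a(1,2)] by auto
  define u where "u = c \<oplus> i \<otimes> r"
  have u: "u \<noteq> \<zero>" "inv u \<in> O_inf" "u \<in> carrier R" "a = y [^] d \<otimes> u"
    using unit_at_infinity[OF d(1,2)] d kc by (auto simp: u_def)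
  have "i [^] n \<otimes> x \<in> W" if W: "valring W" "k \<subseteq> W" "y \<notin> W" for W
  proof (cases "x \<in> W")
    note Ws = valringE(1)[OF W(1)]
    have OW: "O_inf \<subseteq> W" using W unfolding O_inf_def by auto
    case True
    then show ?thesis using subringE(6)[OF Ws] i_pow_O_inf[of n] OW by auto
  next
    note Ws = valringE(1)[OF W(1)]
    have OW: "O_inf \<subseteq> W" using W unfolding O_inf_def by auto
    have Wc: "W \<subseteq> carrier R" using subringE(1)[OF Ws] .
    case False
    then have x: "x \<noteq> \<zero>" "inv x \<in> W" using valringE(2)[OF W(1) assms] by auto
    define ds where "ds = map ((\<otimes>) (i [^] n)) cs"
    have csc: "set cs \<subseteq> carrier R" using a(3) B by auto
    have "i [^] n \<otimes> z \<in> W" if "z \<in> set cs" for z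
      using pole_iff[of z n] that n OW by blast
    then have ds: "set ds \<subseteq> W" by (auto simp: ds_def)
    obtain w where w: "w \<in> W" "eval ds x \<otimes> x = w \<otimes> x [^] length ds"
      using eval_inverse_in[OF Ws assms x ds] by auto
    define z where "z = x [^] length cs"
    have z: "z \<in> carrier R" "z \<noteq> \<zero>" using assms x by (auto simp: z_def)
    have ec: "eval cs x \<in> carrier R" using eval_in_carrier csc assms by auto
    have c: "a \<in> carrier R" "w \<in> carrier R" using a(1) B w Wc by auto
    have "i [^] n \<otimes> eval cs x \<otimes> x = w \<otimes> z"
      using w(2) eval_map_mult[OF csc _ assms, of "i [^] n"] by (simp add: ds_def z_def)
    moreover have "a \<otimes> z \<oplus> eval cs x = \<zero>" using a(4) by (simp add: z_def)
    then have "eval cs x = \<ominus> (a \<otimes> z)" using c ec z by (metis minus_equality a_comm m_closed minus_minus)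
    ultimately have e: "i [^] n \<otimes> (\<ominus> (a \<otimes> z)) \<otimes> x = w \<otimes> z" by simp
    define j where "j = i [^] n"
    have j: "j \<in> carrier R" by (simp add: j_def)
    have "j \<otimes> (\<ominus> (a \<otimes> z)) \<otimes> x = (\<ominus> (j \<otimes> a \<otimes> x)) \<otimes> z" using j c z(1) assms by algebra
    then have "(\<ominus> (j \<otimes> a \<otimes> x)) \<otimes> z = w \<otimes> z" using e by (simp add: j_def)
    then have "\<ominus> (j \<otimes> a \<otimes> x) = w" using m_rcancel[of z "\<ominus> (j \<otimes> a \<otimes> x)" w] j c z assms by simp
    then have "a \<otimes> (j \<otimes> x) = \<ominus> w" using j c assms by (metis m_assoc m_closed m_comm minus_minus)
    then have e2: "y [^] d \<otimes> (u \<otimes> (j \<otimes> x)) = \<ominus> w" using u j assms by (simp add: m_assoc)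
    have "j \<otimes> x = inv u \<otimes> (i [^] d \<otimes> (y [^] d \<otimes> (u \<otimes> (j \<otimes> x))))"
    proof -
      have "i [^] d \<otimes> (y [^] d \<otimes> (u \<otimes> (j \<otimes> x))) = (i [^] d \<otimes> y [^] d) \<otimes> (u \<otimes> (j \<otimes> x))"
        using u j assms by (intro m_assoc[symmetric]) auto
      then show ?thesis using u j assms by simp
    qed
    then have "j \<otimes> x = inv u \<otimes> (i [^] d \<otimes> (\<ominus> w))" using e2 by simp
    moreover have "inv u \<otimes> (i [^] d \<otimes> (\<ominus> w)) \<in> W"
      using subringE(5,6)[OF Ws] w(1) u(2) i_pow_O_inf[of d] OW by (meson subsetD)
    ultimately show ?thesis by (simp add: j_def)
  qed
  then have "i [^] n \<otimes> x \<in> O_inf" unfolding O_inf_def using assms by simp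
  then show ?thesis using assms pole_iff by auto
qed

text \<open>The Riemann-Roch space of \<open>n\<close> times the pole divisor of
  \<open>y\<close>.\<close>

definition O_k :: "nat \<Rightarrow> 'a set" where "O_k n = O_fin \<inter> pole n"

lemma O_fin_subspace: "subalgebra k O_fin R"
  by (rule subring_subspace[OF k_subring O_fin_subring k_O(1)])

lemma O_k_subspace: "subalgebra k (O_k n) R"
  unfolding O_k_def by (rule subspace_inter[OF O_fin_subspace O_inf_subspaces(3)])

lemma O_k_mono: "n \<le> m \<Longrightarrow> O_k n \<subseteq> O_k m"
  using pole_mono[of n m] by (auto simp: O_k_def)

lemma O_k_exhaustive:
  assumes "finite S" "S \<subseteq> O_fin"
  shows "\<exists>n. S \<subseteq> O_k n"
  using assms
proof (induction S)
  case (insert x S)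
  then obtain m where m: "S \<subseteq> O_k m" by auto
  have "x \<in> carrier R" using insert subringE(1)[OF O_fin_subring] by auto
  then obtain n where "x \<in> pole n" using pole_exhaustive by auto
  then have "x \<in> O_k n" using insert by (auto simp: O_k_def)
  then show ?case using m O_k_mono[of m "max m n"] O_k_mono[of n "max m n"] by (intro exI[of _ "max m n"]) auto
qed simp

lemma zero_subspace: "subalgebra k {\<zero>} R"
  using subspaceI[OF k_subring, of "{\<zero>}"] kc by auto

text \<open>For \<open>m = 0\<close> only constants remain, which accounts for the summand
  \<open>1\<close>. Raising the bound by one embeds the quotient into \<open>pole (Suc m)\<close>
  modulo \<open>pole m\<close>, a rescaled copy of \<open>O_inf\<close> modulo
  \<open>small\<close>.\<close>

lemma len_O_k:
  assumes n: "dimension n k1 (carrier R)"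
  shows "len_le k {\<zero>} (O_k m) (n * m + 1)"
proof (induction m)
  case 0
  have "O_k 0 \<subseteq> k" using O_fin_inter_O_inf by (auto simp: O_k_def pole_def)
  also have "k \<subseteq> line_extension k \<one> {\<zero>}"
  proof
    fix c assume "c \<in> k"
    moreover from this have "c = c \<otimes> \<one> \<oplus> \<zero>" using kc by simp
    ultimately show "c \<in> line_extension k \<one> {\<zero>}" using line_extension_mem_iff by blast
  qed
  finally show ?case
    using len_le_mono[OF len_le_line_extension[OF k zero_subspace one_closed] order_refl, of "O_k 0" 1] by simp
next
  case (Suc m)
  have "len_le k small O_inf n" using len_small[OF n] .
  then have "len_le k ((\<otimes>) (y [^] Suc m) ` small) ((\<otimes>) (y [^] Suc m) ` O_inf) n"
    using small_sub pow_nz[OF yc y_nonzero, of "Suc m"] by (intro len_le_scale[OF k_subring]) auto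
  then have "len_le k (pole m) (pole (Suc m)) n" by (simp only: small_scale pole_def[symmetric])
  then have "len_le k (pole m \<inter> O_k (Suc m)) (O_k (Suc m)) n"
    by (intro len_le_inter[OF k_subring O_inf_subspaces(3) O_inf_subspaces(3)] pole_mono) (auto simp: O_k_def)
  moreover have "pole m \<inter> O_k (Suc m) = O_k m" using pole_mono[of m "Suc m"] by (auto simp: O_k_def)
  ultimately have "len_le k (O_k m) (O_k (Suc m)) n" by simp
  then have "len_le k {\<zero>} (O_k (Suc m)) ((n * m + 1) + n)"
    using len_le_trans[OF k_subring O_k_subspace O_k_subspace _ O_k_mono Suc] subspaceE(2)[OF O_k_subspace] by auto
  then show ?case by (simp add: algebra_simps)
qed

text \<open>What a set must satisfy in order to contain all sums of \<open>p(y) \<otimes> u\<close>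
  with \<open>u\<close> from the list and \<open>p\<close> of degree below \<open>m\<close>. Here
  \<open>m\<close> counts coefficients.\<close>

definition additive_span :: "nat \<Rightarrow> 'a list \<Rightarrow> 'a set \<Rightarrow> bool" where
  "additive_span m us D \<longleftrightarrow> \<zero> \<in> D \<and> (\<forall>a\<in>D. \<forall>b\<in>D. a \<oplus> b \<in> D) \<and>
    (\<forall>u\<in>set us. \<forall>p. set p \<subseteq> k \<and> length p \<le> m \<longrightarrow> eval p y \<otimes> u \<in> D)"

text \<open>Independence over \<open>k(y)\<close> makes the multiples of the different
  \<open>u\<close> by powers of \<open>y\<close> independent over \<open>k\<close>; each
  \<open>u\<close> contributes \<open>m\<close> dimensions.\<close>

lemma flag_lattice:
  assumes "independent k1 us"
  shows "\<exists>Z. flag k {\<zero>} Z (length us * m) \<and> Z \<subseteq> Span k1 us \<and> (\<forall>D. additive_span m us D \<longrightarrow> Z \<subseteq> D)"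
  using assms
proof (induction us rule: list.induct)
  case Nil
  have "flag k {\<zero>} {\<zero>} 0" using flag_0[OF zero_subspace] by simp
  then show ?case by (intro exI[of _ "{\<zero>}"]) (auto simp: additive_span_def)
next
  case (Cons u us)
  note ind = independent_backwards[OF Cons.prems]
  obtain Z where Z: "flag k {\<zero>} Z (length us * m)" "Z \<subseteq> Span k1 us"
    "\<And>D. additive_span m us D \<Longrightarrow> Z \<subseteq> D"
    using Cons.IH[OF ind(2)] by blast
  have uc: "set us \<subseteq> carrier R" using independent_in_carrier[OF ind(2)] .
  have Zs: "subalgebra k Z R" using flagD[OF Z(1)] by simp
  have nz: "eval (c # cs) y \<otimes> u \<notin> Z" if c: "c \<in> k" "c \<noteq> \<zero>" "set cs \<subseteq> k" for c cs
  proof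
    assume "eval (c # cs) y \<otimes> u \<in> Z"
    then have s: "eval (c # cs) y \<otimes> u \<in> Span k1 us" using Z(2) by auto
    have "eval (c # cs) y \<in> k1"
      using ring.eval_in_carrier[OF subring_is_ring[OF k1_subring], of "c # cs" y]
        eval_consistent[OF k1_subring] c k_k1 y_k1 by auto
    then have "u \<in> Span k1 us"
      using Span_m_inv_simprule[OF k1_subfield uc _ ind(3) s] eval_y_nonzero[OF c] by simp
    then show False using ind(1) by simp
  qed
  obtain Z' where Z': "flag k Z Z' m"
    "\<And>x. x \<in> Z' \<Longrightarrow> \<exists>z\<in>Z. \<exists>p. set p \<subseteq> k \<and> length p \<le> m \<and> x = z \<oplus> eval p y \<otimes> u"
    using flag_powers[OF k Zs yc ind(3) nz, of m] by blast
  have "flag k {\<zero>} Z' (length (u # us) * m)" using flag_trans[OF Z(1) Z'(1)] by (simp add: add.commute)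
  moreover have "Z' \<subseteq> Span k1 (u # us)"
  proof
    fix x assume "x \<in> Z'"
    then obtain z p where p: "z \<in> Z" "set p \<subseteq> k" "x = z \<oplus> eval p y \<otimes> u" using Z'(2) by blast
    have "eval p y \<in> k1"
      using ring.eval_in_carrier[OF subring_is_ring[OF k1_subring], of p y]
        eval_consistent[OF k1_subring] p k_k1 y_k1 by auto
    moreover have "x = eval p y \<otimes> u \<oplus> z"
      using p calculation k1c ind(3) subspaceE(6)[OF Zs] a_comm by auto
    ultimately show "x \<in> Span k1 (u # us)" using p(1) Z(2) line_extension_mem_iff by auto
  qed
  moreover have "Z' \<subseteq> D" if D: "additive_span m (u # us) D" for D
  proof
    fix x assume "x \<in> Z'"
    then obtain z p where p: "z \<in> Z" "set p \<subseteq> k" "length p \<le> m" "x = z \<oplus> eval p y \<otimes> u" using Z'(2) by blast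
    have "additive_span m us D" using D by (simp add: additive_span_def)
    then have "z \<in> D" using Z(3) p(1) by auto
    moreover have "eval p y \<otimes> u \<in> D" using D p by (simp add: additive_span_def)
    ultimately show "x \<in> D" using D p(4) by (simp add: additive_span_def)
  qed
  ultimately show ?case by blast
qed

lemma ex_basis_in_subring:
  assumes A: "subring A R" "generate_field R A = carrier R" and n: "dimension n k1 (carrier R)"
  shows "\<exists>us. independent k1 us \<and> length us = n \<and> set us \<subseteq> A"
proof -
  note Ac = subringE(1)[OF A(1)]
  obtain vs where vs: "set vs \<subseteq> carrier R" "independent k1 vs" "length vs = n"
    using exists_base[OF k1_subfield n] by blast
  have "\<exists>b\<in>A - {\<zero>}. \<forall>x\<in>set vs. b \<otimes> x \<in> A"
    by (rule common_denominator[OF A(1)])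
      (use vs subringE[OF A(1)] generate_field_fraction[OF A(1)] A(2) zero_not_one integral_iff in \<open>auto simp: subset_iff\<close>)
  then obtain b where b: "b \<in> A" "b \<noteq> \<zero>" "\<And>x. x \<in> set vs \<Longrightarrow> b \<otimes> x \<in> A" by auto
  have bc: "b \<in> carrier R" using b Ac by auto
  define us where "us = map ((\<otimes>) b) vs"
  have uA: "set us \<subseteq> A" using b by (auto simp: us_def)
  have comb: "combine Ks us = b \<otimes> combine Ks vs" if "set Ks \<subseteq> carrier R" for Ks
    using that vs(1) unfolding us_def
  proof (induction Ks vs rule: combine.induct)
    case (1 c Ks v vs)
    then have c: "c \<in> carrier R" "v \<in> carrier R" "combine Ks vs \<in> carrier R" by auto
    have "c \<otimes> (b \<otimes> v) \<oplus> b \<otimes> combine Ks vs = b \<otimes> (c \<otimes> v \<oplus> combine Ks vs)" using c bc by algebra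
    then show ?case using 1 by simp
  qed (use bc in auto)
  have "independent k1 us"
  proof (rule trivial_combine_imp_independent[OF k1_subfield])
    show "set us \<subseteq> carrier R" using uA Ac by auto
    fix Ks assume Ks: "set Ks \<subseteq> k1" "combine Ks us = \<zero>"
    then have Kc: "set Ks \<subseteq> carrier R" using k1c by auto
    then have "combine Ks vs = \<zero>" using comb[OF Kc] Ks(2) b bc vs(1) integral_iff[of b "combine Ks vs"] by auto
    then show "set (take (length us) Ks) \<subseteq> {\<zero>}"
      using independent_imp_trivial_combine[OF k1_subfield vs(2) Ks(1)] by (simp add: us_def)
  qed
  then show ?thesis using vs(3) uA by (intro exI[of _ us]) (simp add: us_def)
qed

text \<open>Comparing the growth of \<open>O_k m\<close> with that of the lattice spanned by a basis contained in \<open>A\<close>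
  bounds the colength of \<open>A\<close>.\<close>

theorem finite_colength:
  assumes A: "subring A R" "k \<subseteq> A" "y \<in> A" "generate_field R A = carrier R" "A \<subseteq> O_fin"
  shows "\<exists>e. len_le k A O_fin e"
proof -
  obtain n where n: "dimension n k1 (carrier R)" using finite_degree[folded k1_def] by auto
  obtain us where us: "independent k1 us" "length us = n" "set us \<subseteq> A"
    using ex_basis_in_subring[OF A(1,4) n] by auto
  \<comment> \<open>\<open>c\<close> bounds the poles of the chosen basis at infinity; polynomials
    of degree at most \<open>m\<close> times basis vectors then have poles bounded by
    \<open>m + c\<close>.\<close>
  obtain c where c: "set us \<subseteq> O_k c" using O_k_exhaustive[of "set us"] us(3) A(5) by auto
  have Asp: "subalgebra k A R" using subring_subspace[OF k_subring A(1,2)] .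
  \<comment> \<open>Inside the space of dimension at most \<open>n * (m + c) + 1\<close> the subring
    already fills at least \<open>n * Suc m\<close> dimensions. The difference is at most
    \<open>n * c + 1\<close>, independently of \<open>m\<close>.\<close>
  have bound: "len_le k (A \<inter> O_k (m + c)) (O_k (m + c)) (n * c + 1)" for m
  proof -
    define D where "D = A \<inter> O_k (m + c)"
    have D: "subalgebra k D R" unfolding D_def using subspace_inter[OF Asp O_k_subspace] .
    obtain Z where Z: "flag k {\<zero>} Z (length us * Suc m)"
      "\<And>D. additive_span (Suc m) us D \<Longrightarrow> Z \<subseteq> D"
      using flag_lattice[OF us(1), of "Suc m"] by blast
    have "eval p y \<otimes> u \<in> D" if "u \<in> set us" "set p \<subseteq> k" "length p \<le> Suc m" for u p
    proof -
      have pA: "eval p y \<in> A"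
        using ring.eval_in_carrier[OF subring_is_ring[OF A(1)], of p y] eval_consistent[OF A(1)] that A by auto
      have uA: "u \<in> A" "u \<in> pole c" using that us c by (auto simp: O_k_def)
      have pc: "eval p y \<in> carrier R" "u \<in> carrier R" using pA uA subringE(1)[OF A(1)] by auto
      have "eval p y \<otimes> u \<in> A" using subringE(6)[OF A(1) pA uA(1)] .
      moreover have "eval p y \<otimes> u \<in> pole (m + c)"
      proof -
        have 1: "i [^] m \<otimes> eval p y \<in> O_inf" using eval_in_pole[OF that(2,3)] by (simp add: pole_iff)
        have 2: "i [^] c \<otimes> u \<in> O_inf" using uA by (simp add: pole_iff)
        have "i [^] (m + c) \<otimes> (eval p y \<otimes> u) = (i [^] m \<otimes> eval p y) \<otimes> (i [^] c \<otimes> u)"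
          using pc by (simp add: m_ac flip: nat_pow_mult)
        then show ?thesis using O_inf_closed(5)[OF 1 2] pc by (simp add: pole_iff)
      qed
      ultimately show ?thesis using A(5) by (auto simp: D_def O_k_def)
    qed
    then have "additive_span (Suc m) us D" using subspaceE(2,3)[OF D] by (simp add: additive_span_def)
    then have "Z \<subseteq> D" by (rule Z(2))
    then have "flag k {\<zero>} D (n * Suc m)" using flag_mono_top[OF Z(1) _ D] us(2) by simp
    then have "len_le k D (O_k (m + c)) (n * (m + c) + 1 - n * Suc m)"
      using len_le_diff[OF len_O_k[OF n]] by blast
    then show ?thesis
      unfolding D_def by (rule len_le_mono) (auto simp: algebra_simps)
  qed
  \<comment> \<open>Any chain above \<open>A\<close> is witnessed by finitely many functions, which
    all lie in one of the bounded spaces, where the uniform bound applies.\<close>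
  have "len_le k A O_fin (n * c + 1)"
    unfolding len_le_def
  proof (intro allI impI)
    fix U l assume f: "flag k A U l" and U: "U \<subseteq> O_fin"
    obtain S where S: "finite S" "S \<subseteq> U" "\<And>Z. subalgebra k Z R \<Longrightarrow> S \<subseteq> Z \<Longrightarrow> flag k (A \<inter> Z) (U \<inter> Z) l"
      using flag_finite_support[OF f] by blast
    obtain m where "S \<subseteq> O_k m" using O_k_exhaustive[OF S(1)] S(2) U by auto
    then have "S \<subseteq> O_k (m + c)" using O_k_mono[of m "m + c"] by auto
    then have "flag k (A \<inter> O_k (m + c)) (U \<inter> O_k (m + c)) l" using S(3)[OF O_k_subspace] by simp
    then show "l \<le> n * c + 1" using len_leD[OF bound] by blast
  qed
  then show ?thesis by blast
qed

end

section \<open>Extension of scalars and linear disjointness\<close>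

context field
begin

text \<open>A maximal \<open>K\<close>-subspace of \<open>Kb\<close> avoiding \<open>\<one>\<close>
  is a complement of \<open>K\<close>; the retraction is the projection along it.\<close>

lemma subfield_retraction:
  assumes K: "subfield K R" and Kb: "subfield Kb R" and sub: "K \<subseteq> Kb"
  shows "\<exists>f. (\<forall>b\<in>Kb. f b \<in> K) \<and> (\<forall>b\<in>Kb. \<forall>b'\<in>Kb. f (b \<oplus> b') = f b \<oplus> f b') \<and>
    (\<forall>c\<in>K. \<forall>b\<in>Kb. f (c \<otimes> b) = c \<otimes> f b) \<and> f \<one> = \<one>"
proof -
  have Ks: "subring K R" and Kbs: "subring Kb R" using K Kb subfieldE(1) by auto
  note KE = subringE[OF Ks] and KbE = subringE[OF Kbs]
  have Kc: "\<And>x. x \<in> K \<Longrightarrow> x \<in> carrier R" and Kbc: "\<And>x. x \<in> Kb \<Longrightarrow> x \<in> carrier R" using KE(1) KbE(1) by auto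
  define \<U> where "\<U> = {U. subalgebra K U R \<and> U \<subseteq> Kb \<and> \<one> \<notin> U}"
  have "\<exists>M\<in>\<U>. \<forall>U\<in>\<U>. M \<subseteq> U \<longrightarrow> U = M"
  proof (rule subset_Zorn_nonempty)
    have "subalgebra K {\<zero>} R" using subspaceI[OF Ks, of "{\<zero>}"] Kc by auto
    then have "{\<zero>} \<in> \<U>" using KbE(2) by (simp add: \<U>_def)
    then show "\<U> \<noteq> {}" by blast
    fix \<C> assume ne: "\<C> \<noteq> {}" and ch: "subset.chain \<U> \<C>"
    have C: "subalgebra K U R" "U \<subseteq> Kb" "\<one> \<notin> U" if "U \<in> \<C>" for U
      using ch that by (auto simp: subset.chain_def \<U>_def)
    have "subalgebra K (\<Union>\<C>) R"
    proof (rule subspaceI[OF Ks])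
      show "\<Union>\<C> \<subseteq> carrier R" using C(2) Kbc by blast
      show "\<zero> \<in> \<Union>\<C>" using ne subspaceE(2)[OF C(1)] by auto
      show "c \<otimes> x \<in> \<Union>\<C>" if "c \<in> K" "x \<in> \<Union>\<C>" for c x
        using that subspaceE(5)[OF C(1)] by auto
      fix a b assume "a \<in> \<Union>\<C>" "b \<in> \<Union>\<C>"
      then obtain U U' where U: "U \<in> \<C>" "a \<in> U" "U' \<in> \<C>" "b \<in> U'" by auto
      then have "U \<subseteq> U' \<or> U' \<subseteq> U" using ch by (simp add: subset_chain_def)
      then show "a \<oplus> b \<in> \<Union>\<C>"
        using U subspaceE(3)[OF C(1)[OF U(1)], of a b] subspaceE(3)[OF C(1)[OF U(3)], of a b] by auto
    qed
    then show "\<Union>\<C> \<in> \<U>" using C by (auto simp: \<U>_def)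
  qed
  then obtain U where U: "subalgebra K U R" "U \<subseteq> Kb" "\<one> \<notin> U"
    and max: "\<And>U'. U' \<in> \<U> \<Longrightarrow> U \<subseteq> U' \<Longrightarrow> U' = U" by (auto simp: \<U>_def)
  note UE = subspaceE[OF U(1)]
  \<comment> \<open>Adjoining \<open>b\<close> to the maximal subspace reaches
    \<open>\<one>\<close>, and solving that relation for \<open>b\<close> gives its component in
    \<open>K\<close>.\<close>
  have ex: "\<exists>a\<in>K. b \<ominus> a \<in> U" if b: "b \<in> Kb" for b
  proof (cases "b \<in> U")
    case True
    then have "b \<ominus> \<zero> \<in> U" using UE(6) by (simp add: a_minus_def)
    then show ?thesis using KE(2) by blast
  next
    case False
    let ?U = "line_extension K b U"
    note L = subspace_line_extension[OF K U(1) Kbc[OF b]]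
    have "subalgebra K Kb R" by (rule subring_subspace[OF Ks Kbs sub])
    then have "?U \<subseteq> Kb" using line_extension_least b U(2) by auto
    moreover have "?U \<noteq> U" using L(3) False by auto
    ultimately have "\<one> \<in> ?U" using max[of ?U] L by (auto simp: \<U>_def)
    then obtain c u where cu: "c \<in> K" "u \<in> U" "\<one> = c \<otimes> b \<oplus> u" using line_extension_mem_iff by blast
    have cc: "c \<in> carrier R" "u \<in> carrier R" "b \<in> carrier R" using cu Kc UE(6) b Kbc by auto
    have c0: "c \<noteq> \<zero>" using cu U(3) cc by auto
    then have ic: "inv c \<in> K" "inv c \<in> carrier R" "inv c \<otimes> c = \<one>" using subfield_m_inv[OF K, of c] cu cc by auto
    have "inv c \<otimes> (c \<otimes> b \<oplus> u) = (inv c \<otimes> c) \<otimes> b \<oplus> inv c \<otimes> u" using ic(2) cc by algebra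
    then have "inv c = b \<oplus> inv c \<otimes> u" unfolding cu(3)[symmetric] using ic cc by simp
    moreover have "b \<ominus> (b \<oplus> inv c \<otimes> u) = \<ominus> (inv c \<otimes> u)" using ic(2) cc by algebra
    ultimately have "b \<ominus> inv c = \<ominus> (inv c \<otimes> u)" by simp
    moreover have "\<ominus> (inv c \<otimes> u) \<in> U" using UE(4,5) ic cu by auto
    ultimately show ?thesis using ic by metis
  qed
  have uniq: "a = a'" if a: "a \<in> K" "a' \<in> K" "b \<ominus> a \<in> U" "b \<ominus> a' \<in> U" "b \<in> Kb" for a a' b
  proof (rule ccontr)
    assume ne: "a \<noteq> a'"
    have c: "a \<in> carrier R" "a' \<in> carrier R" "b \<in> carrier R" using a Kc Kbc by auto
    define e where "e = a \<ominus> a'"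
    have "e = (b \<ominus> a') \<oplus> (\<ominus> (b \<ominus> a))" unfolding e_def using c by algebra
    then have eU: "e \<in> U" using UE(3,4) a by metis
    have e: "e \<in> K" "e \<in> carrier R" "e \<noteq> \<zero>"
      using a KE(5,7) c ne r_right_minus_eq[OF c(1,2)] by (simp_all add: e_def a_minus_def)
    then have "inv e \<in> K" using subfield_m_inv(1)[OF K, of e] by auto
    then have "inv e \<otimes> e \<in> U" by (rule UE(5)[OF _ eU])
    then show False using U(3) e by simp
  qed
  define f where "f b = (SOME a. a \<in> K \<and> b \<ominus> a \<in> U)" for b
  have f: "f b \<in> K" "b \<ominus> f b \<in> U" if "b \<in> Kb" for b
    using someI_ex[of "\<lambda>a. a \<in> K \<and> b \<ominus> a \<in> U"] ex[OF that] unfolding f_def by blast+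
  have fI: "f b = a" if "b \<in> Kb" "a \<in> K" "b \<ominus> a \<in> U" for a b using uniq[of "f b" a b] f that by auto
  have "f (b \<oplus> b') = f b \<oplus> f b'" if b: "b \<in> Kb" "b' \<in> Kb" for b b'
  proof (rule fI)
    show "b \<oplus> b' \<in> Kb" "f b \<oplus> f b' \<in> K" using b KbE(7) KE(7) f by auto
    have c: "b \<in> carrier R" "b' \<in> carrier R" "f b \<in> carrier R" "f b' \<in> carrier R" using b Kbc Kc f by auto
    then have "b \<oplus> b' \<ominus> (f b \<oplus> f b') = (b \<ominus> f b) \<oplus> (b' \<ominus> f b')" by algebra
    then show "b \<oplus> b' \<ominus> (f b \<oplus> f b') \<in> U" using UE(3) f b by simp
  qed
  moreover have "f (c \<otimes> b) = c \<otimes> f b" if b: "c \<in> K" "b \<in> Kb" for b c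
  proof (rule fI)
    show "c \<otimes> b \<in> Kb" "c \<otimes> f b \<in> K" using b KbE(6) KE(6) f sub by auto
    have c: "b \<in> carrier R" "f b \<in> carrier R" "c \<in> carrier R" using b Kbc Kc f by auto
    then have "c \<otimes> b \<ominus> c \<otimes> f b = c \<otimes> (b \<ominus> f b)" by algebra
    then show "c \<otimes> b \<ominus> c \<otimes> f b \<in> U" using UE(5) f b by simp
  qed
  moreover have "f \<one> = \<one>"
    by (rule fI) (use KE(3) KbE(3) UE(2) in \<open>auto simp: a_minus_def r_neg\<close>)
  ultimately show ?thesis using f(1) by blast
qed

section \<open>Formal tensors\<close>

text \<open>The additive extension of \<open>g\<close> to formal integer combinations.
  Multiplication gives \<open>tensor_eval\<close>; multiplication after a functional on the second
  factor gives the map used for linear disjointness.\<close>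

definition frag_eval :: "('i \<Rightarrow> 'a) \<Rightarrow> ('i \<Rightarrow>\<^sub>0 int) \<Rightarrow> 'a" where
  "frag_eval g z = (\<Oplus>p \<in> Poly_Mapping.keys z. [Poly_Mapping.lookup z p] \<cdot> g p)"

lemma add_pow_int_zero [simp]: "[(0::int)] \<cdot> x = \<zero>"
  by (simp add: add_pow_def)

lemma frag_eval_superset:
  assumes "Poly_Mapping.keys z \<subseteq> T" "finite T" "\<And>p. p \<in> T \<Longrightarrow> g p \<in> carrier R"
  shows "frag_eval g z = (\<Oplus>p \<in> T. [Poly_Mapping.lookup z p] \<cdot> g p)"
  unfolding frag_eval_def
  by (rule add.finprod_mono_neutral_cong_left)
    (use assms in \<open>auto simp: in_keys_iff\<close>)

lemma frag_eval_add:
  assumes "\<And>p. p \<in> S \<Longrightarrow> g p \<in> carrier R" "Poly_Mapping.keys z \<subseteq> S" "Poly_Mapping.keys w \<subseteq> S"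
  shows "frag_eval g (z + w) = frag_eval g z \<oplus> frag_eval g w"
proof -
  let ?T = "Poly_Mapping.keys z \<union> Poly_Mapping.keys w"
  have g: "\<And>p. p \<in> ?T \<Longrightarrow> g p \<in> carrier R" using assms by auto
  have "frag_eval g (z + w) = (\<Oplus>p \<in> ?T. [Poly_Mapping.lookup (z + w) p] \<cdot> g p)"
    by (rule frag_eval_superset) (use g keys_add[of z w] in auto)
  also have "\<dots> = (\<Oplus>p \<in> ?T. [Poly_Mapping.lookup z p] \<cdot> g p \<oplus> [Poly_Mapping.lookup w p] \<cdot> g p)"
    using g by (intro add.finprod_cong') (auto simp: lookup_add add.int_pow_mult)
  also have "\<dots> = (\<Oplus>p \<in> ?T. [Poly_Mapping.lookup z p] \<cdot> g p) \<oplus> (\<Oplus>p \<in> ?T. [Poly_Mapping.lookup w p] \<cdot> g p)"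
    using g by (intro finsum_addf) auto
  also have "\<dots> = frag_eval g z \<oplus> frag_eval g w"
    using g frag_eval_superset[of z ?T g] frag_eval_superset[of w ?T g] by simp
  finally show ?thesis .
qed

lemma frag_eval_closed:
  assumes "\<And>p. p \<in> S \<Longrightarrow> g p \<in> carrier R" "Poly_Mapping.keys z \<subseteq> S"
  shows "frag_eval g z \<in> carrier R"
  unfolding frag_eval_def using assms by (intro finsum_closed) auto

lemma frag_eval_minus:
  assumes "\<And>p. p \<in> S \<Longrightarrow> g p \<in> carrier R" "Poly_Mapping.keys z \<subseteq> S"
  shows "frag_eval g (- z) = \<ominus> frag_eval g z"
proof -
  have "frag_eval g (- z) \<oplus> frag_eval g z = frag_eval g (- z + z)"
    using assms by (intro frag_eval_add[symmetric, of S]) auto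
  also have "\<dots> = \<zero>" by (simp add: frag_eval_def)
  finally show ?thesis using assms by (intro minus_equality[symmetric] frag_eval_closed[of S]) auto
qed

lemma frag_eval_diff:
  assumes "\<And>p. p \<in> S \<Longrightarrow> g p \<in> carrier R" "Poly_Mapping.keys z \<subseteq> S" "Poly_Mapping.keys w \<subseteq> S"
  shows "frag_eval g (z - w) = frag_eval g z \<ominus> frag_eval g w"
  using frag_eval_add[of S g z "- w"] frag_eval_minus[of S g w] assms by (simp add: a_minus_def)

lemma frag_eval_of: "g p \<in> carrier R \<Longrightarrow> frag_eval g (frag_of p) = g p"
  by (simp add: frag_eval_def)

lemma tensor_eval_eq: "tensor_eval R = frag_eval (\<lambda>(a, b). a \<otimes> b)"
  unfolding tensor_eval_def frag_eval_def by (rule ext) (simp add: case_prod_unfold)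

text \<open>The tensor product of the identity with \<open>f\<close> respects the defining relations
  of the tensor product. Since these generate the whole kernel of the evaluation, it is well defined
  on the image in the field.\<close>

lemma tensor_embeds_functional:
  assumes A: "subring A R" and Kb: "subring Kb R" and K: "K \<subseteq> A" "K \<subseteq> Kb"
    and f: "\<And>b. b \<in> Kb \<Longrightarrow> f b \<in> K" "\<And>b b'. b \<in> Kb \<Longrightarrow> b' \<in> Kb \<Longrightarrow> f (b \<oplus> b') = f b \<oplus> f b'"
      "\<And>c b. c \<in> K \<Longrightarrow> b \<in> Kb \<Longrightarrow> f (c \<otimes> b) = c \<otimes> f b"
    and emb: "tensor_embeds R K A Kb" and z: "Poly_Mapping.keys z \<subseteq> A \<times> Kb" "tensor_eval R z = \<zero>"
  shows "frag_eval (\<lambda>(a, b). a \<otimes> f b) z = \<zero>"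
proof -
  let ?G = "free_Abelian_group (A \<times> Kb)"
  let ?g = "\<lambda>(a, b). a \<otimes> f b"
  note AE = subringE[OF A] and KbE = subringE[OF Kb]
  have Ac: "\<And>x. x \<in> A \<Longrightarrow> x \<in> carrier R" using AE(1) by auto
  have fc: "\<And>b. b \<in> Kb \<Longrightarrow> f b \<in> carrier R" using f(1) K Ac by blast
  have g: "\<And>p. p \<in> A \<times> Kb \<Longrightarrow> ?g p \<in> carrier R" using Ac fc by auto
  have rel: "Poly_Mapping.keys h \<subseteq> A \<times> Kb \<and> frag_eval ?g h = \<zero>" if h: "h \<in> tensor_relations R K A Kb" for h
  proof -
    have 3: "frag_eval ?g (frag_of p - frag_of q - frag_of r) = ?g p \<ominus> ?g q \<ominus> ?g r"
      "Poly_Mapping.keys (frag_of p - frag_of q - frag_of r) \<subseteq> A \<times> Kb"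
      if "p \<in> A \<times> Kb" "q \<in> A \<times> Kb" "r \<in> A \<times> Kb" for p q r
    proof -
      have k1: "Poly_Mapping.keys (frag_of p - frag_of q) \<subseteq> A \<times> Kb"
        using keys_diff[of "frag_of p" "frag_of q"] that by auto
      then show "Poly_Mapping.keys (frag_of p - frag_of q - frag_of r) \<subseteq> A \<times> Kb"
        using keys_diff[of "frag_of p - frag_of q" "frag_of r"] that by auto
      show "frag_eval ?g (frag_of p - frag_of q - frag_of r) = ?g p \<ominus> ?g q \<ominus> ?g r"
        using that k1 g by (simp add: frag_eval_diff[of "A \<times> Kb"] frag_eval_of)
    qed
    have 2: "frag_eval ?g (frag_of p - frag_of q) = ?g p \<ominus> ?g q"
      "Poly_Mapping.keys (frag_of p - frag_of q) \<subseteq> A \<times> Kb"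
      if "p \<in> A \<times> Kb" "q \<in> A \<times> Kb" for p q
      using that g keys_diff[of "frag_of p" "frag_of q"]
      by (auto simp: frag_eval_diff[of "A \<times> Kb"] frag_eval_of)
    from h consider
      (1) a a' b where "h = frag_of (a \<oplus> a', b) - frag_of (a, b) - frag_of (a', b)" "a \<in> A" "a' \<in> A" "b \<in> Kb"
      | (2) a b b' where "h = frag_of (a, b \<oplus> b') - frag_of (a, b) - frag_of (a, b')" "a \<in> A" "b \<in> Kb" "b' \<in> Kb"
      | (3) a b c where "h = frag_of (a \<otimes> c, b) - frag_of (a, c \<otimes> b)" "a \<in> A" "b \<in> Kb" "c \<in> K"
      unfolding tensor_relations_def by blast
    then show ?thesis
    proof cases
      case 1
      have "a \<in> carrier R" "a' \<in> carrier R" "f b \<in> carrier R" using 1 Ac fc by auto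
      then have "(a \<oplus> a') \<otimes> f b \<ominus> a \<otimes> f b \<ominus> a' \<otimes> f b = \<zero>" by algebra
      then show ?thesis using 3[of "(a \<oplus> a', b)" "(a, b)" "(a', b)"] 1 AE(7) by simp
    next
      case 2
      have "a \<in> carrier R" "f b \<in> carrier R" "f b' \<in> carrier R" using 2 Ac fc by auto
      then have "a \<otimes> (f b \<oplus> f b') \<ominus> a \<otimes> f b \<ominus> a \<otimes> f b' = \<zero>" by algebra
      then show ?thesis using 3[of "(a, b \<oplus> b')" "(a, b)" "(a, b')"] 2 KbE(7) f(2) by simp
    next
      case 3
      have "a \<in> carrier R" "f b \<in> carrier R" "c \<in> carrier R" using 3 Ac fc K by auto
      then have "a \<otimes> c \<otimes> f b \<ominus> a \<otimes> (c \<otimes> f b) = \<zero>" by algebra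
      moreover have "c \<in> A" "c \<in> Kb" using 3 K by auto
      ultimately show ?thesis using 2[of "(a \<otimes> c, b)" "(a, c \<otimes> b)"] 3 KbE(6) AE(6) f(3) by simp
    qed
  qed
  have "Poly_Mapping.keys h \<subseteq> A \<times> Kb \<and> frag_eval ?g h = \<zero>"
    if "h \<in> generate ?G (tensor_relations R K A Kb)" for h
    using that
  proof induction
    case one
    then show ?case by (simp add: frag_eval_def)
  next
    case (incl h)
    then show ?case by (rule rel)
  next
    case (inv h)
    then have h: "Poly_Mapping.keys h \<subseteq> A \<times> Kb" "frag_eval ?g h = \<zero>" using rel by auto
    then show ?case using frag_eval_minus[of "A \<times> Kb" ?g h, OF g h(1)] by simp
  next
    case (eng h h')
    then show ?case using frag_eval_add[of "A \<times> Kb" ?g h h', OF g] keys_add[of h h'] by auto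
  qed
  moreover have "z \<in> generate ?G (tensor_relations R K A Kb)"
    using emb z unfolding tensor_embeds_def by auto
  ultimately show ?thesis by blast
qed

section \<open>Spans over the larger field and linear disjointness\<close>

inductive_set kspan :: "'a set \<Rightarrow> 'a set \<Rightarrow> 'a set" for K Q where
  zero: "\<zero> \<in> kspan K Q"
| lin: "w \<in> kspan K Q \<Longrightarrow> b \<in> K \<Longrightarrow> p \<in> Q \<Longrightarrow> w \<oplus> b \<otimes> p \<in> kspan K Q"

text \<open>The graph of the extension of \<open>f\<close> to a \<open>Q\<close>-linear map on the span of \<open>Q\<close>; that it is a function
  is the content of linear disjointness.\<close>

inductive_set fgraph :: "'a set \<Rightarrow> ('a \<Rightarrow> 'a) \<Rightarrow> 'a set \<Rightarrow> ('a \<times> 'a) set" for K f Q where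
  zero: "(\<zero>, \<zero>) \<in> fgraph K f Q"
| lin: "(w, w') \<in> fgraph K f Q \<Longrightarrow> b \<in> K \<Longrightarrow> p \<in> Q \<Longrightarrow> (w \<oplus> b \<otimes> p, w' \<oplus> f b \<otimes> p) \<in> fgraph K f Q"

lemma fgraph_mono:
  assumes "Q \<subseteq> Q'" "(w, w') \<in> fgraph K f Q"
  shows "(w, w') \<in> fgraph K f Q'"
  using assms(2) by (induction w w' rule: fgraph.induct) (use assms(1) in \<open>auto intro: fgraph.intros\<close>)

lemma kspan_fgraph: "w \<in> kspan K Q \<Longrightarrow> \<exists>w'. (w, w') \<in> fgraph K f Q"
  by (induction rule: kspan.induct) (auto intro: fgraph.intros)

text \<open>A \<open>K\<close>-linear retraction \<open>Kb \<rightarrow> K\<close>, applied to the coefficients, maps the \<open>Kb\<close>-span of \<open>Q\<close> back to \<open>Q\<close>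
  and fixes \<open>p\<close>.\<close>

theorem kspan_contraction:
  assumes A: "subring A R" and K: "subfield K R" and Kb: "subfield Kb R" and sub: "K \<subseteq> A" "K \<subseteq> Kb"
    and emb: "tensor_embeds R K A Kb"
    and Q: "subalgebra K Q R" "Q \<subseteq> generate_field R A"
    and p: "p \<in> kspan Kb Q" "p \<in> generate_field R A"
  shows "p \<in> Q"
proof -
  have Kbs: "subring Kb R" using subfieldE(1)[OF Kb] .
  note AE = subringE[OF A] and KbE = subringE[OF Kbs] and QE = subspaceE[OF Q(1)]
  have Ac: "\<And>x. x \<in> A \<Longrightarrow> x \<in> carrier R" and Kbc: "\<And>x. x \<in> Kb \<Longrightarrow> x \<in> carrier R"
    and Kc: "\<And>x. x \<in> K \<Longrightarrow> x \<in> carrier R" using AE(1) KbE(1) subfieldE(3)[OF K] by auto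
  define F where "F = generate_field R A"
  have Fc: "\<And>x. x \<in> F \<Longrightarrow> x \<in> carrier R" using generate_field_incl[OF AE(1)] by (auto simp: F_def)
  obtain f where f': "(\<forall>b\<in>Kb. f b \<in> K) \<and> (\<forall>b\<in>Kb. \<forall>b'\<in>Kb. f (b \<oplus> b') = f b \<oplus> f b') \<and>
    (\<forall>c\<in>K. \<forall>b\<in>Kb. f (c \<otimes> b) = c \<otimes> f b) \<and> f \<one> = \<one>"
    using subfield_retraction[OF K Kb sub(2)] by (rule exE)
  then have f: "\<And>b. b \<in> Kb \<Longrightarrow> f b \<in> K" "\<And>b b'. b \<in> Kb \<Longrightarrow> b' \<in> Kb \<Longrightarrow> f (b \<oplus> b') = f b \<oplus> f b'"
    "\<And>c b. c \<in> K \<Longrightarrow> b \<in> Kb \<Longrightarrow> f (c \<otimes> b) = c \<otimes> f b" "f \<one> = \<one>" by simp_all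
  have fc: "\<And>b. b \<in> Kb \<Longrightarrow> f b \<in> carrier R" using f(1) Kc by auto
  let ?g = "\<lambda>(a, b). a \<otimes> f b" and ?e = "\<lambda>(a, b). a \<otimes> b"
  have g: "\<And>p. p \<in> A \<times> Kb \<Longrightarrow> ?g p \<in> carrier R" "\<And>p. p \<in> A \<times> Kb \<Longrightarrow> ?e p \<in> carrier R" using Ac fc Kbc by auto
  have gc: "w \<in> carrier R \<and> w' \<in> carrier R" if "(w, w') \<in> fgraph Kb f F" for w w'
    using that by (induction w w' rule: fgraph.induct) (use Kbc fc Fc in auto)
  have AF: "A \<subseteq> F" using generate_field.incl[of _ A R] by (auto simp: F_def)
  \<comment> \<open>Both components of a graph element come from one formal tensor, once evaluated
    directly and once after \<open>f\<close>. This carries the embedding of the tensor product over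
    to the graph.\<close>
  have lift: "\<exists>z. Poly_Mapping.keys z \<subseteq> A \<times> Kb \<and> tensor_eval R z = w \<and> frag_eval ?g z = w'"
    if "(w, w') \<in> fgraph Kb f A" for w w'
    using that
  proof (induction w w' rule: fgraph.induct)
    case zero
    show ?case by (rule exI[of _ 0]) (simp add: tensor_eval_eq frag_eval_def)
  next
    case (lin w w' b p)
    then obtain z where z: "Poly_Mapping.keys z \<subseteq> A \<times> Kb" "tensor_eval R z = w" "frag_eval ?g z = w'" by auto
    have k: "Poly_Mapping.keys (frag_of (p, b)) \<subseteq> A \<times> Kb" using lin by simp
    have c: "b \<in> carrier R" "p \<in> carrier R" "f b \<in> carrier R" using lin Kbc Ac fc by auto
    have "frag_eval ?e (z + frag_of (p, b)) = frag_eval ?e z \<oplus> frag_eval ?e (frag_of (p, b))"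
      by (rule frag_eval_add[OF g(2) z(1) k])
    then have "tensor_eval R (z + frag_of (p, b)) = w \<oplus> b \<otimes> p"
      using z(2) c frag_eval_of[of ?e "(p, b)"] m_comm[of p b] unfolding tensor_eval_eq by simp
    moreover have "frag_eval ?g (z + frag_of (p, b)) = frag_eval ?g z \<oplus> frag_eval ?g (frag_of (p, b))"
      by (rule frag_eval_add[OF g(1) z(1) k])
    then have "frag_eval ?g (z + frag_of (p, b)) = w' \<oplus> f b \<otimes> p"
      using z(3) c frag_eval_of[of ?g "(p, b)"] m_comm[of p "f b"] by simp
    moreover have "Poly_Mapping.keys (z + frag_of (p, b)) \<subseteq> A \<times> Kb" using keys_add[of z "frag_of (p, b)"] z(1) k by auto
    ultimately show ?case by blast
  qed
  have zeroA: "w' = \<zero>" if w: "(\<zero>, w') \<in> fgraph Kb f A" for w'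
  proof -
    obtain z where "Poly_Mapping.keys z \<subseteq> A \<times> Kb" "tensor_eval R z = \<zero>" "frag_eval ?g z = w'"
      using lift[OF w] by auto
    then show ?thesis using tensor_embeds_functional[OF A Kbs sub f(1-3) emb] by metis
  qed
  have scale: "(a \<otimes> w, a \<otimes> w') \<in> fgraph Kb f A" if "(w, w') \<in> fgraph Kb f A" and a: "a \<in> A" for a w w'
    using that(1)
  proof (induction w w' rule: fgraph.induct)
    case zero
    then show ?case using a Ac fgraph.zero by simp
  next
    case (lin w w' b p)
    have c: "w \<in> carrier R" "w' \<in> carrier R" using gc[OF fgraph_mono[OF AF lin(1)]] by auto
    have c': "b \<in> carrier R" "p \<in> carrier R" "f b \<in> carrier R" "a \<in> carrier R" using lin Kbc Ac fc a by auto
    have "a \<otimes> (w \<oplus> b \<otimes> p) = a \<otimes> w \<oplus> b \<otimes> (a \<otimes> p)" "a \<otimes> (w' \<oplus> f b \<otimes> p) = a \<otimes> w' \<oplus> f b \<otimes> (a \<otimes> p)"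
      using c c' by algebra+
    moreover have "a \<otimes> p \<in> A" using AE(6) a lin by auto
    ultimately show ?case using fgraph.lin[OF lin(4,2), of "a \<otimes> p"] by simp
  qed
  \<comment> \<open>The tensor hypothesis concerns \<open>A\<close> only; multiplying a graph
    element by a common denominator brings the fraction field within its reach.\<close>
  have denom: "\<exists>s\<in>A - {\<zero>}. (s \<otimes> w, s \<otimes> w') \<in> fgraph Kb f A" if "(w, w') \<in> fgraph Kb f F" for w w'
    using that
  proof (induction w w' rule: fgraph.induct)
    case zero
    then show ?case using AE(3) fgraph.zero by (intro bexI[of _ \<one>]) auto
  next
    case (lin w w' b p)
    then obtain s where s: "s \<in> A" "s \<noteq> \<zero>" "(s \<otimes> w, s \<otimes> w') \<in> fgraph Kb f A" by auto
    obtain t where t: "t \<in> A" "t \<noteq> \<zero>" "t \<otimes> p \<in> A"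
      using generate_field_fraction[OF A, of p] lin(3) by (auto simp: F_def)
    have c: "w \<in> carrier R" "w' \<in> carrier R" using gc lin(1) by auto
    have c': "b \<in> carrier R" "p \<in> carrier R" "f b \<in> carrier R" "s \<in> carrier R" "t \<in> carrier R"
      using lin Kbc Fc fc s t Ac by auto
    have "(t \<otimes> s) \<otimes> (w \<oplus> b \<otimes> p) = t \<otimes> (s \<otimes> w) \<oplus> b \<otimes> (s \<otimes> (t \<otimes> p))"
      "(t \<otimes> s) \<otimes> (w' \<oplus> f b \<otimes> p) = t \<otimes> (s \<otimes> w') \<oplus> f b \<otimes> (s \<otimes> (t \<otimes> p))"
      using c c' by algebra+
    moreover have "s \<otimes> (t \<otimes> p) \<in> A" using AE(6) s t by auto
    ultimately have "((t \<otimes> s) \<otimes> (w \<oplus> b \<otimes> p), (t \<otimes> s) \<otimes> (w' \<oplus> f b \<otimes> p)) \<in> fgraph Kb f A"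
      using fgraph.lin[OF scale[OF s(3) t(1)] lin(2), of "s \<otimes> (t \<otimes> p)"] by simp
    moreover have "t \<otimes> s \<in> A - {\<zero>}" using s t c' AE(6) mult_nz by auto
    ultimately show ?case by blast
  qed
  have zeroF: "w' = \<zero>" if w: "(\<zero>, w') \<in> fgraph Kb f F" for w'
  proof -
    obtain s where s: "s \<in> A" "s \<noteq> \<zero>" "(s \<otimes> \<zero>, s \<otimes> w') \<in> fgraph Kb f A" using denom[OF w] by auto
    then have "s \<otimes> w' = \<zero>" using zeroA Ac by auto
    then show ?thesis using s Ac gc[OF w] integral_iff by auto
  qed
  have diff: "(w \<ominus> x, w' \<ominus> x') \<in> fgraph Kb f F"
    if w: "(w, w') \<in> fgraph Kb f F" and x: "(x, x') \<in> fgraph Kb f F" for w w' x x'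
    using x
  proof (induction x x' rule: fgraph.induct)
    case zero
    then show ?case using w gc[OF w] by (simp add: a_minus_def)
  next
    case (lin x x' b p)
    have c: "w \<in> carrier R" "w' \<in> carrier R" "x \<in> carrier R" "x' \<in> carrier R" using gc lin(1) w by auto
    have c': "b \<in> carrier R" "p \<in> carrier R" "f b \<in> carrier R" using lin Kbc Fc fc by auto
    have "f ((\<ominus> \<one>) \<otimes> b) = (\<ominus> \<one>) \<otimes> f b"
      using f(3) subringE(3,5)[OF subfieldE(1)[OF K]] lin(2) by blast
    then have "f (\<ominus> b) = \<ominus> f b" using c' by (simp add: l_minus)
    moreover have "w \<ominus> (x \<oplus> b \<otimes> p) = (w \<ominus> x) \<oplus> (\<ominus> b) \<otimes> p"
      "w' \<ominus> (x' \<oplus> f b \<otimes> p) = (w' \<ominus> x') \<oplus> (\<ominus> f b) \<otimes> p" using c c' by algebra+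
    ultimately show ?case using fgraph.lin[OF lin(4) KbE(5)[OF lin(2)] lin(3)] by simp
  qed
  \<comment> \<open>Over \<open>p\<close> there are two graph values: one obtained from the span,
    which lies in \<open>Q\<close>, and \<open>p\<close> itself, because \<open>f\<close> fixes
    \<open>\<one>\<close>. Since the graph is a function they agree.\<close>
  obtain w' where w': "(p, w') \<in> fgraph Kb f Q" using kspan_fgraph[OF p(1)] by blast
  have "w' \<in> Q"
    using w' by (induction p w' rule: fgraph.induct) (use QE(2,3,5) f(1) in auto)
  have pc: "p \<in> carrier R" using p Fc by (simp add: F_def)
  have wF: "(p, w') \<in> fgraph Kb f F" using fgraph_mono[OF Q(2) w'] by (simp add: F_def)
  have "(\<zero> \<oplus> \<one> \<otimes> p, \<zero> \<oplus> f \<one> \<otimes> p) \<in> fgraph Kb f F"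
    using fgraph.lin[OF fgraph.zero KbE(3)] p(2) by (simp add: F_def)
  then have "(p, p) \<in> fgraph Kb f F" using pc f(4) by simp
  then have "(p \<ominus> p, w' \<ominus> p) \<in> fgraph Kb f F" using diff wF by blast
  then have "w' \<ominus> p = \<zero>" using zeroF pc by (simp add: a_minus_def r_neg)
  then have "w' = p" using gc[OF wF] r_right_minus_eq[of w' p] by simp
  then show ?thesis using \<open>w' \<in> Q\<close> by simp
qed

lemma kspan_closed:
  assumes "K \<subseteq> carrier R" "Q \<subseteq> carrier R" "w \<in> kspan K Q"
  shows "w \<in> carrier R"
  using assms(3) by induction (use assms in auto)

lemma kspan_subspace:
  assumes K: "subring K R" and Q: "Q \<subseteq> carrier R"
  shows "subalgebra K (kspan K Q) R"
proof (rule subspaceI[OF K])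
  note c = kspan_closed[OF subringE(1)[OF K] Q]
  show "kspan K Q \<subseteq> carrier R" "\<zero> \<in> kspan K Q" using c kspan.zero by auto
  fix x w assume x: "x \<in> kspan K Q"
  assume "w \<in> kspan K Q"
  then show "x \<oplus> w \<in> kspan K Q"
  proof induction
    case (lin w b p)
    have "w \<in> carrier R" "b \<in> carrier R" "p \<in> carrier R" "x \<in> carrier R"
      using lin x c Q subringE(1)[OF K] by auto
    then have "x \<oplus> (w \<oplus> b \<otimes> p) = (x \<oplus> w) \<oplus> b \<otimes> p" by algebra
    then show ?case using kspan.lin[OF lin(4,2,3)] by simp
  qed (use x c in auto)
next
  note c = kspan_closed[OF subringE(1)[OF K] Q]
  fix a w assume a: "a \<in> K" and "w \<in> kspan K Q"
  from this(2) show "a \<otimes> w \<in> kspan K Q"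
  proof induction
    case zero
    then show ?case using a subringE(1)[OF K] kspan.zero by auto
  next
    case (lin w b p)
    have "w \<in> carrier R" "b \<in> carrier R" "p \<in> carrier R" "a \<in> carrier R"
      using lin a c Q subringE(1)[OF K] by auto
    then have "a \<otimes> (w \<oplus> b \<otimes> p) = a \<otimes> w \<oplus> (a \<otimes> b) \<otimes> p" by algebra
    then show ?case using kspan.lin[OF lin(4) subringE(6)[OF K a lin(2)] lin(3)] by simp
  qed
qed

lemma kspan_incl:
  assumes "subring K R" "Q \<subseteq> carrier R"
  shows "Q \<subseteq> kspan K Q"
proof
  fix p assume p: "p \<in> Q"
  have "\<zero> \<oplus> \<one> \<otimes> p \<in> kspan K Q" by (rule kspan.lin[OF kspan.zero subringE(3)[OF assms(1)] p])
  then show "p \<in> kspan K Q" using p assms(2) by auto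
qed

lemma kspan_least:
  assumes "subalgebra K U R" "Q \<subseteq> U"
  shows "kspan K Q \<subseteq> U"
proof
  fix w assume "w \<in> kspan K Q"
  then show "w \<in> U" by induction (use subspaceE[OF assms(1)] assms(2) in auto)
qed

lemma kspan_mono: "subring K R \<Longrightarrow> Q' \<subseteq> carrier R \<Longrightarrow> Q \<subseteq> Q' \<Longrightarrow> kspan K Q \<subseteq> kspan K Q'"
  using kspan_least[OF kspan_subspace] kspan_incl by (meson order_trans)

lemma kspan_scale:
  assumes K: "subring K R" and Q: "Q \<subseteq> carrier R" and a: "a \<in> carrier R"
  shows "kspan K ((\<otimes>) a ` Q) = (\<otimes>) a ` kspan K Q"
proof
  note c = kspan_closed[OF subringE(1)[OF K] Q]
  have aQ: "(\<otimes>) a ` Q \<subseteq> carrier R" using Q a by auto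
  show "kspan K ((\<otimes>) a ` Q) \<subseteq> (\<otimes>) a ` kspan K Q"
    using kspan_incl[OF K Q] by (intro kspan_least subspace_scale[OF K kspan_subspace[OF K Q] a]) auto
  show "(\<otimes>) a ` kspan K Q \<subseteq> kspan K ((\<otimes>) a ` Q)"
  proof
    fix x assume "x \<in> (\<otimes>) a ` kspan K Q"
    then obtain w where "w \<in> kspan K Q" "x = a \<otimes> w" by auto
    from this(1) have "a \<otimes> w \<in> kspan K ((\<otimes>) a ` Q)"
    proof induction
      case zero
      then show ?case using a kspan.zero by auto
    next
      case (lin w b p)
      have "w \<in> carrier R" "b \<in> carrier R" "p \<in> carrier R" using lin c Q subringE(1)[OF K] by auto
      then have "a \<otimes> (w \<oplus> b \<otimes> p) = a \<otimes> w \<oplus> b \<otimes> (a \<otimes> p)" using a by algebra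
      then show ?case using kspan.lin[OF lin(4,2), of "a \<otimes> p"] lin(3) by simp
    qed
    then show "x \<in> kspan K ((\<otimes>) a ` Q)" using \<open>x = a \<otimes> w\<close> by simp
  qed
qed

lemma kspan_generate_ring:
  assumes K: "subring K R" and A: "subring A R"
  shows "kspan K A = generate_ring R (A \<union> K)" "subring (kspan K A) R"
proof -
  note AE = subringE[OF A] and KE = subringE[OF K]
  have sp: "subalgebra K (kspan K A) R" by (rule kspan_subspace[OF K AE(1)])
  note E = subspaceE[OF sp]
  have gc: "A \<union> K \<subseteq> carrier R" using AE KE by auto
  have multA: "w \<otimes> a \<in> kspan K A" if "w \<in> kspan K A" "a \<in> A" for w a
    using that(1)
  proof induction
    case zero
    then show ?case using that AE(1) kspan.zero by auto
  next
    case (lin w b p)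
    have "w \<in> carrier R" "b \<in> carrier R" "p \<in> carrier R" "a \<in> carrier R"
      using lin E(6) AE(1) KE(1) that by auto
    then have "(w \<oplus> b \<otimes> p) \<otimes> a = w \<otimes> a \<oplus> b \<otimes> (p \<otimes> a)" by algebra
    then show ?case using kspan.lin[OF lin(4,2) AE(6)[OF lin(3) that(2)]] by simp
  qed
  have mult: "w \<otimes> w' \<in> kspan K A" if "w' \<in> kspan K A" and w: "w \<in> kspan K A" for w w'
    using that(1)
  proof induction
    case zero
    then show ?case using w E(6) kspan.zero by auto
  next
    case (lin w' b p)
    have c: "w \<in> carrier R" "b \<in> carrier R" "p \<in> carrier R" "w' \<in> carrier R"
      using lin E(6) AE(1) KE(1) w by auto
    then have "w \<otimes> (w' \<oplus> b \<otimes> p) = w \<otimes> w' \<oplus> b \<otimes> (w \<otimes> p)" by algebra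
    moreover have "w \<otimes> w' \<oplus> b \<otimes> (w \<otimes> p) \<in> kspan K A" using E(3)[OF lin(4) E(5)[OF lin(2) multA[OF w lin(3)]]] .
    ultimately show ?case by simp
  qed
  have incl: "A \<subseteq> kspan K A" by (rule kspan_incl[OF K AE(1)])
  show sub: "subring (kspan K A) R"
    by (rule subringI) (use E incl AE(3) mult in auto)
  have "b \<in> kspan K A" if "b \<in> K" for b
    using kspan.lin[OF kspan.zero that AE(3)] that KE(1) by auto
  then have "generate_ring R (A \<union> K) \<subseteq> kspan K A"
    using generate_ring_min_subring1[OF gc sub] incl by auto
  moreover have "kspan K A \<subseteq> generate_ring R (A \<union> K)"
  proof (rule kspan_least)
    have g: "A \<union> K \<subseteq> generate_ring R (A \<union> K)" using generate_ring.incl[of _ "A \<union> K" R] by blast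
    show "subalgebra K (generate_ring R (A \<union> K)) R"
      by (rule subring_subspace[OF K generate_ring_is_subring[OF gc]]) (use g in auto)
    show "A \<subseteq> generate_ring R (A \<union> K)" using g by auto
  qed
  ultimately show "kspan K A = generate_ring R (A \<union> K)" by auto
qed

text \<open>A vector that makes a step strict cannot enter the extended span of the smaller space,
  since by \<open>kspan_contraction\<close> it would already lie in the smaller space.\<close>

lemma flag_kspan:
  assumes A: "subring A R" and K: "subfield K R" and Kb: "subfield Kb R" and sub: "K \<subseteq> A" "K \<subseteq> Kb"
    and emb: "tensor_embeds R K A Kb" and "flag K Y U n" "U \<subseteq> generate_field R A"
  shows "flag Kb (kspan Kb Y) (kspan Kb U) n"
  using assms(7,8)
proof induction
  have Kbs: "subring Kb R" using subfieldE(1)[OF Kb] .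
  case (flag_0 U)
  have "U \<subseteq> carrier R" using subspaceE(1)[OF flag_0(1)] .
  then show ?case using kspan_mono[OF Kbs _ flag_0(2)] kspan_subspace[OF Kbs] by (auto intro: flag.intros)
next
  have Kbs: "subring Kb R" using subfieldE(1)[OF Kb] .
  case (flag_Suc U n U')
  have c: "U' \<subseteq> carrier R" using subspaceE(1)[OF flag_Suc(2)] .
  obtain u where u: "u \<in> U'" "u \<notin> U" using flag_Suc(3) by auto
  have "u \<notin> kspan Kb U"
    using kspan_contraction[OF A K Kb sub emb _ _ _ , of U u] flagD[OF flag_Suc(1)] u flag_Suc(3,5) by auto
  moreover have "u \<in> kspan Kb U'" using kspan_incl[OF Kbs c] u by auto
  moreover have "kspan Kb U \<subseteq> kspan Kb U'" using kspan_mono[OF Kbs c] flag_Suc(3) by auto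
  ultimately show ?case using flag_Suc kspan_subspace[OF Kbs c] by (intro flag.flag_Suc) auto
qed

text \<open>A basis of the residue field lifts to \<open>P\<close> vector by vector. Over
  \<open>K\<close> each lift gives a strict step; over \<open>Kb\<close> each adjoins at most one
  dimension, which is the upper bound.\<close>

lemma residue_flag:
  assumes P: "is_local P" and K: "subfield K R" "K \<subseteq> P" and Kb: "subfield Kb R" "K \<subseteq> Kb"
    and deg: "residue_degree R K P d"
  shows "flag K (nonunits P) P d" "len_le Kb (kspan Kb (nonunits P)) (kspan Kb P) d"
proof -
  have Ps: "subring P R" using P by (simp add: is_local_def)
  have Pc: "\<And>x. x \<in> P \<Longrightarrow> x \<in> carrier R" using subringE(1)[OF Ps] by auto
  have Kbs: "subring Kb R" using subfieldE(1)[OF Kb(1)] .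
  let ?P = "R\<lparr>carrier := P\<rparr>"
  let ?m = "nonunits P"
  interpret P: cring ?P using cring_subring[OF Ps] .
  have "ideal ?m ?P"
    using is_local_maximal(2)[OF P] is_local_maximal(1)[OF P] theI'[of "\<lambda>I. maximalideal I ?P"]
    unfolding local_ring_def max_ideal_def by (metis maximalideal.axioms(1))
  then interpret m: ideal ?m ?P .
  let ?Q = "?P Quot ?m"
  interpret Q: ring ?Q using m.quotient_is_ring .
  let ?h = "\<lambda>x. ?m +>\<^bsub>?P\<^esub> x"
  interpret h: ring_hom_ring ?P ?Q ?h using m.rcos_ring_hom_ring .
  note mE = ideal_subringE[OF m.is_ideal]
  have ker: "?h x = ?m \<longleftrightarrow> x \<in> ?m" if "x \<in> P" for x
  proof
    have "abelian_subgroup ?m ?P"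
      using P.is_abelian_group m.additive_subgroup_axioms by (intro abelian_subgroupI3) auto
    then show "?h x = ?m \<Longrightarrow> x \<in> ?m" using abelian_subgroup.a_rcos_self[of ?m ?P x] that by auto
    show "x \<in> ?m \<Longrightarrow> ?h x = ?m" using P.a_rcos_zero[OF m.is_ideal] by simp
  qed
  have surj: "carrier ?Q = ?h ` P" by (auto simp: FactRing_def A_RCOSETS_def')
  have zero: "\<zero>\<^bsub>?Q\<^esub> = ?m" by (simp add: FactRing_def)
  have hadd: "?h (x \<oplus> y) = ?h x \<oplus>\<^bsub>?Q\<^esub> ?h y" if "x \<in> P" "y \<in> P" for x y using h.hom_add[of x y] that by simp
  have hmult: "?h (x \<otimes> y) = ?h x \<otimes>\<^bsub>?Q\<^esub> ?h y" if "x \<in> P" "y \<in> P" for x y using h.hom_mult[of x y] that by simp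
  have dim: "Q.dimension d (?h ` K) (carrier ?Q)"
    using deg unfolding residue_degree_def residue_field_def is_local_maximal(2)[OF P] .
  define pre where "pre E = {p \<in> P. ?h p \<in> E}" for E
  have "flag K ?m (pre E) n \<and> len_le Kb (kspan Kb ?m) (kspan Kb (pre E)) n"
    if "Q.dimension n (?h ` K) E" for n E
    using that
  proof (induction n "?h ` K" E rule: Q.dimension.induct)
    case zero_dim
    have "pre {\<zero>\<^bsub>?Q\<^esub>} = ?m" using ker mE(1) by (auto simp: pre_def zero)
    moreover have "subalgebra K ?m R"
    proof (rule subspaceI[OF subfieldE(1)[OF K(1)]])
      show "?m \<subseteq> carrier R" using mE(1) Pc by blast
      show "\<zero> \<in> ?m" by (rule mE(2))
      show "x \<oplus> y \<in> ?m" if "x \<in> ?m" "y \<in> ?m" for x y using mE(3) that by blast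
      show "c \<otimes> x \<in> ?m" if "c \<in> K" "x \<in> ?m" for c x using mE(4) that K(2) by blast
    qed
    then have "flag K ?m ?m 0" by (rule flag_0) simp
    ultimately show ?case using len_le_refl[of Kb "kspan Kb ?m"] by simp
  next
    case (Suc_dim v E n)
    then have IH: "flag K ?m (pre E) n" "len_le Kb (kspan Kb ?m) (kspan Kb (pre E)) n" by auto
    obtain w where w: "w \<in> P" "v = ?h w" using Suc_dim(1) surj by auto
    have wc: "w \<in> carrier R" using w Pc by simp
    have sp: "subalgebra K (pre E) R" using flagD[OF IH(1)] by simp
    \<comment> \<open>Preimages under the residue map commute with adjoining a vector, once the
      vector has been lifted.\<close>
    have eq: "pre (Q.line_extension (?h ` K) v E) = line_extension K w (pre E)"
    proof (intro equalityI subsetI)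
      fix p assume "p \<in> pre (Q.line_extension (?h ` K) v E)"
      then have p: "p \<in> P" "?h p \<in> Q.line_extension (?h ` K) v E" by (auto simp: pre_def)
      then obtain c e where ce: "c \<in> K" "e \<in> E" "?h p = ?h c \<otimes>\<^bsub>?Q\<^esub> v \<oplus>\<^bsub>?Q\<^esub> e"
        unfolding Q.line_extension_mem_iff by auto
      have cP: "c \<in> P" using ce K by auto
      have cw: "c \<otimes> w \<in> P" "\<ominus> (c \<otimes> w) \<in> P" using subringE(5,6)[OF Ps] cP w by auto
      have "E \<subseteq> carrier ?Q" using Suc_dim(3)
      proof (induction n "?h ` K" E rule: Q.dimension.induct)
        case (Suc_dim v E n)
        have "?h ` K \<subseteq> carrier ?Q" using surj K(2) by auto
        then show ?case using Q.line_extension_in_carrier Suc_dim by auto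
      qed auto
      then obtain p0 where p0: "p0 \<in> P" "e = ?h p0" using ce(2) surj by auto
      define r where "r = \<ominus> (c \<otimes> w) \<oplus> p"
      have rP: "r \<in> P" unfolding r_def by (rule subringE(7)[OF Ps cw(2) p(1)])
      have c: "p \<in> carrier R" "c \<otimes> w \<in> carrier R" using p cw Pc by auto
      have peq: "c \<otimes> w \<oplus> r = p" unfolding r_def using c by algebra
      have "?h (c \<otimes> w) \<oplus>\<^bsub>?Q\<^esub> ?h r = ?h (c \<otimes> w) \<oplus>\<^bsub>?Q\<^esub> ?h p0"
        using hadd[OF cw(1) rP] hmult[OF cP w(1)] ce(3) w(2) p0(2) unfolding peq by simp
      moreover have "?h x \<in> carrier ?Q" if "x \<in> P" for x using surj that by auto
      ultimately have "?h r = ?h p0"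
        using Q.add.l_cancel[of "?h (c \<otimes> w)" "?h r" "?h p0"] cw(1) p0(1) rP by simp
      then have "r \<in> pre E" using p0 ce(2) rP by (simp add: pre_def)
      then show "p \<in> line_extension K w (pre E)"
        unfolding line_extension_mem_iff using ce(1) peq[symmetric] by blast
    next
      fix p assume "p \<in> line_extension K w (pre E)"
      then obtain c p0 where cp: "c \<in> K" "p0 \<in> P" "?h p0 \<in> E" "p = c \<otimes> w \<oplus> p0"
        unfolding line_extension_mem_iff pre_def by auto
      have cP: "c \<in> P" using cp K by auto
      have cw: "c \<otimes> w \<in> P" using subringE(6)[OF Ps] cP w by auto
      have "?h p = ?h c \<otimes>\<^bsub>?Q\<^esub> v \<oplus>\<^bsub>?Q\<^esub> ?h p0" using cp w hadd[OF cw cp(2)] hmult[OF cP w(1)] by simp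
      then have "?h p \<in> Q.line_extension (?h ` K) v E" unfolding Q.line_extension_mem_iff using cp by blast
      then show "p \<in> pre (Q.line_extension (?h ` K) v E)" using cp cw subringE(7)[OF Ps] by (simp add: pre_def)
    qed
    note L = subspace_line_extension[OF K(1) sp wc]
    have "w \<notin> pre E" using Suc_dim(2) w by (simp add: pre_def)
    then have f: "flag K ?m (line_extension K w (pre E)) (Suc n)" using IH(1) L by (intro flag.flag_Suc) auto
    have preC: "pre E \<subseteq> carrier R" "line_extension K w (pre E) \<subseteq> carrier R"
      using subspaceE(1)[OF sp] subspaceE(1)[OF L(1)] by auto
    note Ls = subspace_line_extension[OF Kb(1) kspan_subspace[OF Kbs preC(1)] wc]
    have "kspan Kb (line_extension K w (pre E)) \<subseteq> line_extension Kb w (kspan Kb (pre E))"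
    proof (rule kspan_least[OF Ls(1)], rule subsetI)
      fix p assume "p \<in> line_extension K w (pre E)"
      then obtain c p0 where cp: "c \<in> K" "p0 \<in> pre E" "p = c \<otimes> w \<oplus> p0"
        unfolding line_extension_mem_iff by auto
      then have "c \<in> Kb" "p0 \<in> kspan Kb (pre E)" using Kb(2) kspan_incl[OF Kbs preC(1)] by auto
      then show "p \<in> line_extension Kb w (kspan Kb (pre E))" unfolding line_extension_mem_iff using cp(3) by blast
    qed
    then have "len_le Kb (kspan Kb (pre E)) (kspan Kb (line_extension K w (pre E))) 1"
      using len_le_mono[OF len_le_line_extension[OF Kb(1) kspan_subspace[OF Kbs preC(1)] wc] order_refl] by auto
    then have "len_le Kb (kspan Kb ?m) (kspan Kb (line_extension K w (pre E))) (n + 1)"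
      using flagD[OF IH(1)]
      by (intro len_le_trans[OF Kbs kspan_subspace[OF Kbs preC(1)] kspan_subspace[OF Kbs preC(2)] _ _ IH(2)]
            kspan_mono[OF Kbs] preC L(2)) auto
    then show ?case using f eq by simp
  qed
  from this[OF dim] have "flag K ?m (pre (carrier ?Q)) d \<and> len_le Kb (kspan Kb ?m) (kspan Kb (pre (carrier ?Q))) d" .
  moreover have "pre (carrier ?Q) = P" using surj by (auto simp: pre_def)
  ultimately show "flag K (nonunits P) P d" "len_le Kb (kspan Kb (nonunits P)) (kspan Kb P) d" by auto
qed

text \<open>Used with the zero ideal and with the maximal ideal of a valuation ring as \<open>N\<close>.\<close>

lemma algebraically_closed_root:
  assumes Kb: "subfield Kb R" and closed: "algebraically_closed (R\<lparr>carrier := Kb\<rparr>)"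
    and W: "subring W R" "Kb \<subseteq> W" and N: "N \<subseteq> W" "\<And>a b. a \<in> W \<Longrightarrow> b \<in> W \<Longrightarrow> a \<otimes> b \<in> N \<Longrightarrow> a \<in> N \<or> b \<in> N"
      "\<And>c. c \<in> Kb \<Longrightarrow> c \<noteq> \<zero> \<Longrightarrow> c \<notin> N"
    and u: "u \<in> W"
  shows "p \<in> carrier (Kb[X]) \<Longrightarrow> p \<noteq> [] \<Longrightarrow> eval p u \<in> N \<Longrightarrow> \<exists>b\<in>Kb. u \<ominus> b \<in> N"
proof (induction "length p" arbitrary: p rule: less_induct)
  case less
  have Kbs: "subring Kb R" using subfieldE(1)[OF Kb] .
  have Kbc: "\<And>x. x \<in> Kb \<Longrightarrow> x \<in> carrier R" using subringE(1)[OF Kbs] by auto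
  have Wc: "\<And>x. x \<in> W \<Longrightarrow> x \<in> carrier R" using subringE(1)[OF W(1)] by auto
  interpret C: algebraically_closed "R\<lparr>carrier := Kb\<rparr>" by (rule closed)
  interpret UP: domain "Kb[X]" using univ_poly_is_domain[OF Kbs] .
  have pK: "p \<in> carrier (poly_ring (R\<lparr>carrier := Kb\<rparr>))"
    using less.prems(1) univ_poly_consistent[OF Kbs] by simp
  have pset: "set p \<subseteq> Kb" "hd p \<noteq> \<zero>" using less.prems(1,2) by (auto simp: univ_poly_def polynomial_def)
  show ?case
  proof (cases "length p = 1")
    case True
    then obtain c where "p = [c]" by (cases p) auto
    then show ?thesis using less.prems(3) pset N(3)[of c] Kbc by auto
  next
    case False
    then have "degree p > 0" using less.prems(2) by (cases p) auto
    moreover have "C.splitted p" using C.roots_over_carrier[OF pK] .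
    ultimately have "C.roots p \<noteq> {#}" by (auto simp: C.splitted_def)
    then obtain b where "b \<in># C.roots p" by blast
    then have "C.is_root p b" using C.roots_mem_iff_is_root[OF pK] by blast
    then have b: "b \<in> Kb" "eval p b = \<zero>"
      using eval_consistent[OF Kbs] by (auto simp: C.is_root_def)
    have bc: "b \<in> carrier R" using b Kbc by simp
    have f: "[\<one>, \<ominus> b] \<in> carrier (Kb[X])"
      using b subringE(3,5)[OF Kbs] by (auto simp: univ_poly_def polynomial_def)
    have "[\<one>\<^bsub>R\<lparr>carrier := Kb\<rparr>\<^esub>, \<ominus>\<^bsub>R\<lparr>carrier := Kb\<rparr>\<^esub> b] pdivides\<^bsub>R\<lparr>carrier := Kb\<rparr>\<^esub> p"
      using C.is_root_imp_pdivides[OF pK \<open>C.is_root p b\<close>] .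
    then have "[\<one>, \<ominus> b] divides\<^bsub>Kb[X]\<^esub> p"
      using univ_poly_consistent[OF Kbs] a_inv_subring[OF Kbs b(1)] by (simp add: pdivides_def)
    then obtain q where q: "q \<in> carrier (Kb[X])" "p = [\<one>, \<ominus> b] \<otimes>\<^bsub>Kb[X]\<^esub> q" by (auto simp: factor_def)
    interpret H: ring_hom_ring "Kb[X]" R "\<lambda>p. eval p u" using eval_ring_hom[OF Kbs Wc[OF u]] .
    \<comment> \<open>Splitting off a linear factor: primeness of \<open>N\<close> either gives the
      desired root \<open>b\<close> or passes to the cofactor, which has smaller degree. A constant
      polynomial is excluded because nonzero constants avoid \<open>N\<close>.\<close>
    have ev: "eval p u = (u \<ominus> b) \<otimes> eval q u"
      using H.hom_mult[OF f q(1)] q(2) u Wc bc by (simp add: a_minus_def)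
    have qne: "q \<noteq> []" using q less.prems(2) UP.r_null[OF f] by (auto simp: univ_poly_zero)
    have "degree p = degree [\<one>, \<ominus> b] + degree q"
      using poly_mult_degree_eq[OF Kbs, of "[\<one>, \<ominus> b]" q] f q qne by (simp add: univ_poly_mult univ_poly_carrier)
    then have "length q < length p" using qne less.prems(2) by (cases p; cases q) auto
    moreover have "u \<ominus> b \<in> W" using u b W subringE(5,7)[OF W(1)] by (auto simp: a_minus_def)
    moreover have "eval q u \<in> W"
    proof -
      have "set q \<subseteq> W" using q(1) W(2) by (auto simp: univ_poly_def polynomial_def)
      then show ?thesis
        using ring.eval_in_carrier[OF subring_is_ring[OF W(1)], of q u] eval_consistent[OF W(1)] u by auto
    qed
    ultimately show ?thesis using N(2) less.prems(3) less.hyps[of q] q(1) qne b ev by metis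
  qed
qed

section \<open>Comparing lengths under multiplication by powers of an element\<close>

lemma len_le_pow:
  assumes K: "subring K R" and V: "subalgebra K V R" and x: "x \<in> carrier R" "x \<noteq> \<zero>"
    and sub: "(\<otimes>) x ` V \<subseteq> V" and le: "len_le K ((\<otimes>) x ` V) V d"
  shows "len_le K ((\<otimes>) (x [^] (j::nat)) ` V) V (j * d) \<and> (\<otimes>) (x [^] j) ` V \<subseteq> V"
proof (induction j)
  note E = subspaceE[OF V]
  case 0
  have "(\<otimes>) (x [^] (0::nat)) ` V = V" using E(6) by force
  then show ?case using len_le_refl[of K V] by simp
next
  note E = subspaceE[OF V]
  case (Suc j)
  let ?U = "(\<otimes>) (x [^] j) ` V"
  have U: "subalgebra K ?U R" by (rule subspace_scale[OF K V]) (use x in simp)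
  have eq: "(\<otimes>) (x [^] Suc j) ` V = (\<otimes>) (x [^] j) ` (\<otimes>) x ` V"
    unfolding image_image by (rule image_cong[OF refl]) (use x E(6) in \<open>simp add: m_assoc\<close>)
  have "(\<otimes>) x ` V \<subseteq> carrier R" using sub E(1) by (rule order_trans)
  then have "len_le K ((\<otimes>) (x [^] Suc j) ` V) ?U d"
    unfolding eq by (rule len_le_scale[OF K nat_pow_closed[OF x(1)] pow_nz[OF x] _ E(1) le])
  moreover have s: "(\<otimes>) (x [^] Suc j) ` V \<subseteq> ?U" unfolding eq using sub by (rule image_mono)
  ultimately have "len_le K ((\<otimes>) (x [^] Suc j) ` V) V (d + j * d)"
    using len_le_trans[OF K U V s _ _ conjunct1[OF Suc]] Suc by blast
  then show ?case using s Suc by auto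
qed

lemma flag_pow:
  assumes K: "subring K R" and B: "subalgebra K B R" and x: "x \<in> carrier R" "x \<noteq> \<zero>"
    and f: "flag K ((\<otimes>) x ` B) B e"
  shows "flag K ((\<otimes>) (x [^] (j::nat)) ` B) B (j * e)"
proof (induction j)
  note E = subspaceE[OF B]
  case 0
  have "(\<otimes>) (x [^] (0::nat)) ` B = B" using E(6) by force
  then show ?case using flag_0[OF B order_refl] by simp
next
  note E = subspaceE[OF B]
  case (Suc j)
  have eq: "(\<otimes>) (x [^] Suc j) ` B = (\<otimes>) (x [^] j) ` (\<otimes>) x ` B"
    unfolding image_image by (rule image_cong[OF refl]) (use x E(6) in \<open>simp add: m_assoc\<close>)
  have "flag K ((\<otimes>) (x [^] Suc j) ` B) ((\<otimes>) (x [^] j) ` B) e"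
    unfolding eq by (rule flag_scale[OF K nat_pow_closed[OF x(1)] pow_nz[OF x] f])
  then show ?case using flag_trans[OF _ Suc] by simp
qed

text \<open>The chain from \<open>x B\<close> to \<open>B\<close> repeats under multiplication by
  \<open>x\<close>, giving \<open>j * n\<close> steps from \<open>x [^] j\<close> times
  \<open>B\<close> up to \<open>B\<close>. The same interval is bounded by \<open>j * d\<close>
  steps in \<open>V\<close> plus the colength \<open>e\<close>, which does not grow with
  \<open>j\<close>.\<close>

lemma colength_bound:
  assumes K: "subring K R" and sp: "subalgebra K V R" "subalgebra K B R" and x: "x \<in> carrier R" "x \<noteq> \<zero>"
    and BV: "B \<subseteq> V" "len_le K B V e" and V: "(\<otimes>) x ` V \<subseteq> V" "len_le K ((\<otimes>) x ` V) V d"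
    and f: "flag K ((\<otimes>) x ` B) B n"
  shows "n \<le> d"
proof (rule ccontr)
  assume "\<not> n \<le> d"
  \<comment> \<open>Any \<open>j\<close> above \<open>e\<close> works: if \<open>n\<close> exceeded
    \<open>d\<close>, the inequality would give \<open>j \<le> e\<close>.\<close>
  define j where "j = Suc e"
  have xj: "x [^] j \<in> carrier R" "x [^] j \<noteq> \<zero>" using x by auto
  note lp = len_le_pow[OF K sp(1) x V, of j]
  have "len_le K ((\<otimes>) (x [^] j) ` B) ((\<otimes>) (x [^] j) ` V) e"
    by (rule len_le_scale[OF K xj subspaceE(1)[OF sp(2)] subspaceE(1)[OF sp(1)] BV(2)])
  then have "len_le K ((\<otimes>) (x [^] j) ` B) V (e + j * d)"
    using lp BV(1) by (intro len_le_trans[OF K subspace_scale[OF K sp(1) xj(1)] sp(1)]) auto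
  then have "j * n \<le> e + j * d" using len_leD[OF _ flag_pow[OF K sp(2) x f] BV(1)] by blast
  moreover have "j * Suc d \<le> j * n" using \<open>\<not> n \<le> d\<close> by (intro mult_le_mono2) simp
  ultimately show False by (simp add: j_def)
qed

lemma integral_closure_eq:
  assumes "\<one> \<in> A"
  shows "integral_closure_in R A (carrier R) = {x. integral_over A x}"
proof -
  have "(\<exists>f\<in>carrier (A[X]). f \<noteq> [] \<and> hd f = \<one> \<and> eval f x = \<zero>) \<longleftrightarrow> (\<exists>cs. set cs \<subseteq> A \<and> eval (\<one> # cs) x = \<zero>)"
    for x
  proof
    assume "\<exists>f\<in>carrier (A[X]). f \<noteq> [] \<and> hd f = \<one> \<and> eval f x = \<zero>"
    then obtain f where "f \<in> carrier (A[X])" "f \<noteq> []" "hd f = \<one>" "eval f x = \<zero>" by auto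
    then show "\<exists>cs. set cs \<subseteq> A \<and> eval (\<one> # cs) x = \<zero>"
      by (intro exI[of _ "tl f"]) (cases f; auto simp: univ_poly_def polynomial_def)
  next
    assume "\<exists>cs. set cs \<subseteq> A \<and> eval (\<one> # cs) x = \<zero>"
    then obtain cs where "set cs \<subseteq> A" "eval (\<one> # cs) x = \<zero>" by auto
    then show "\<exists>f\<in>carrier (A[X]). f \<noteq> [] \<and> hd f = \<one> \<and> eval f x = \<zero>"
      using assms by (intro bexI[of _ "\<one> # cs"]) (auto simp: univ_poly_def polynomial_def)
  qed
  then show ?thesis
    by (auto simp: integral_closure_in_def integral_over_def)
qed

end

section \<open>Discrete valuations\<close>

locale discrete_valuation = field R for R (structure) +
  fixes k :: "'a set" and v :: "'a \<Rightarrow> int"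
  assumes k: "subfield k R" and v: "normalized_discrete_valuation R k v"
begin

abbreviation V :: "'a set" where "V \<equiv> valuation_ring R v"

lemma v_mult:
  assumes "x \<in> carrier R" "x \<noteq> \<zero>" "y \<in> carrier R" "y \<noteq> \<zero>"
  shows "v (x \<otimes> y) = v x + v y"
  using v assms unfolding normalized_discrete_valuation_def by blast

lemma v_add:
  assumes "x \<in> carrier R" "x \<noteq> \<zero>" "y \<in> carrier R" "y \<noteq> \<zero>" "x \<oplus> y \<noteq> \<zero>"
  shows "min (v x) (v y) \<le> v (x \<oplus> y)"
  using v assms unfolding normalized_discrete_valuation_def by blast

lemma v_const: "c \<in> k \<Longrightarrow> c \<noteq> \<zero> \<Longrightarrow> v c = 0"
  using v unfolding normalized_discrete_valuation_def by blast

lemma v_surj: "\<exists>x\<in>carrier R - {\<zero>}. v x = n"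
proof -
  have "n \<in> v ` (carrier R - {\<zero>})" using v unfolding normalized_discrete_valuation_def by blast
  then show ?thesis by auto
qed

lemma v_one: "v \<one> = 0"
  using v_mult[of \<one> \<one>] by simp

lemma v_inv:
  assumes "x \<in> carrier R" "x \<noteq> \<zero>"
  shows "v (inv x) = - v x"
  using v_mult[of x "inv x"] assms v_one by simp

lemma v_pow: "x \<in> carrier R \<Longrightarrow> x \<noteq> \<zero> \<Longrightarrow> v (x [^] (n::nat)) = int n * v x"
  by (induction n) (simp_all add: v_one v_mult algebra_simps)

lemma k_carrier: "k \<subseteq> carrier R"
  using subfieldE(3)[OF k] .

lemma V_iff: "x \<in> V \<longleftrightarrow> x \<in> carrier R \<and> (x = \<zero> \<or> 0 \<le> v x)"
  by (simp add: valuation_ring_def)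

lemma V_mult: "x \<in> V \<Longrightarrow> y \<in> V \<Longrightarrow> x \<otimes> y \<in> V"
  by (cases "x = \<zero> \<or> y = \<zero>") (auto simp: V_iff v_mult)

lemma k_V: "k \<subseteq> V"
proof
  fix x assume "x \<in> k"
  then show "x \<in> V" using k_carrier v_const[of x] by (cases "x = \<zero>") (auto simp: V_iff)
qed

lemma V_subring: "subring V R"
proof (rule subringI)
  show "\<ominus> h \<in> V" if "h \<in> V" for h
  proof -
    have "\<ominus> \<one> \<in> V" using k_V subringE(3,5)[OF subfieldE(1)[OF k]] by blast
    then have "\<ominus> \<one> \<otimes> h \<in> V" using that by (rule V_mult)
    then show ?thesis using that by (simp add: V_iff l_minus)
  qed
  show "h1 \<oplus> h2 \<in> V" if "h1 \<in> V" "h2 \<in> V" for h1 h2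
    using that v_add[of h1 h2] by (cases "h1 = \<zero> \<or> h2 = \<zero> \<or> h1 \<oplus> h2 = \<zero>") (auto simp: V_iff)
  show "h1 \<otimes> h2 \<in> V" if "h1 \<in> V" "h2 \<in> V" for h1 h2
    using that by (rule V_mult)
qed (auto simp: V_iff v_one)

lemma V_valring: "valring V"
  unfolding valring_def using V_subring by (auto simp: V_iff v_inv)

lemma nonunits_V_iff: "x \<in> nonunits V \<longleftrightarrow> x \<in> carrier R \<and> (x = \<zero> \<or> 0 < v x)"
  by (cases "x \<in> carrier R \<and> x \<noteq> \<zero>") (auto simp: nonunits_def V_iff v_inv)

lemma const_notin_nonunits: "c \<in> k \<Longrightarrow> c \<noteq> \<zero> \<Longrightarrow> c \<notin> nonunits V"
  by (simp add: nonunits_V_iff v_const)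

lemma scale_V:
  assumes "x \<in> carrier R" "x \<noteq> \<zero>" "y \<in> carrier R" "y \<noteq> \<zero>" "v y \<le> v x"
  shows "(\<otimes>) x ` V \<subseteq> (\<otimes>) y ` V"
proof
  fix z assume "z \<in> (\<otimes>) x ` V"
  then obtain u where u: "u \<in> V" "z = x \<otimes> u" by auto
  have "inv y \<otimes> x \<in> V" using assms by (simp add: V_iff v_mult v_inv)
  then have "inv y \<otimes> x \<otimes> u \<in> V" using u(1) by (rule V_mult)
  moreover have "z = y \<otimes> (inv y \<otimes> x \<otimes> u)"
    using u assms by (simp add: V_iff m_assoc)
  ultimately show "z \<in> (\<otimes>) y ` V" by blast
qed

lemma V_subspace: "subalgebra k V R"
  by (rule subring_subspace[OF subfieldE(1)[OF k] V_subring k_V])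

lemma nonunits_V_subspace: "subalgebra k (nonunits V) R"
proof (rule subspaceI[OF subfieldE(1)[OF k]])
  show "\<zero> \<in> nonunits V" by (rule nonunits_zero[OF V_subring])
  show "x \<oplus> y \<in> nonunits V" if "x \<in> nonunits V" "y \<in> nonunits V" for x y
    using that by (rule nonunits_add[OF V_valring])
  show "c \<otimes> x \<in> nonunits V" if "c \<in> k" "x \<in> nonunits V" for c x
    using that k_V by (intro nonunits_mult[OF V_subring]) auto
qed (auto simp: nonunits_V_iff)

text \<open>For a uniformizer \<open>t\<close>, the hypothesis on residues makes \<open>V\<close>
  modulo \<open>t V\<close> one-dimensional over \<open>k\<close>; and \<open>x V\<close> equals
  \<open>t [^] d\<close> times \<open>V\<close> because the values agree.\<close>

lemma len_le_scale_V:
  assumes residue: "\<And>u. u \<in> V \<Longrightarrow> \<exists>b\<in>k. u \<ominus> b \<in> nonunits V"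
    and x: "x \<in> carrier R" "x \<noteq> \<zero>" and d: "v x = int d"
  shows "len_le k ((\<otimes>) x ` V) V d"
proof -
  obtain t where t: "t \<in> carrier R" "t \<noteq> \<zero>" "v t = 1" using v_surj[of 1] by auto
  note kR = subfieldE(1)[OF k]
  have tV: "subalgebra k ((\<otimes>) t ` V) R" by (rule subspace_scale[OF kR V_subspace t(1)])
  have "V \<subseteq> line_extension k \<one> ((\<otimes>) t ` V)"
  proof
    fix u assume u: "u \<in> V"
    obtain b where b: "b \<in> k" "u \<ominus> b \<in> nonunits V" using residue[OF u] by auto
    have c: "u \<in> carrier R" "b \<in> carrier R" using u b k_carrier by (auto simp: V_iff)
    have "inv t \<otimes> w \<in> V" if "w \<in> nonunits V" for w
      using that t by (cases "w = \<zero>") (auto simp: V_iff nonunits_V_iff v_mult v_inv)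
    then have "inv t \<otimes> (u \<ominus> b) \<in> V" using b(2) .
    moreover have "t \<otimes> (inv t \<otimes> (u \<ominus> b)) = u \<ominus> b" using t c by simp
    ultimately have "u \<ominus> b \<in> (\<otimes>) t ` V" by (metis image_eqI)
    moreover have "u = b \<otimes> \<one> \<oplus> (u \<ominus> b)" using c by algebra
    ultimately show "u \<in> line_extension k \<one> ((\<otimes>) t ` V)"
      using b(1) unfolding line_extension_mem_iff by blast
  qed
  then have "len_le k ((\<otimes>) t ` V) V 1"
    by (rule len_le_mono[OF len_le_line_extension[OF k tV one_closed] order_refl]) simp
  moreover have "(\<otimes>) t ` V \<subseteq> V" using t by (auto simp: V_iff intro!: V_mult)
  ultimately have "len_le k ((\<otimes>) (t [^] d) ` V) V d"
    using len_le_pow[OF kR V_subspace t(1,2), of 1 d] by simp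
  then show ?thesis
    by (rule len_le_mono[OF _ scale_V]) (use x t d in \<open>simp_all add: v_pow\<close>)
qed

end

section \<open>Points of geometrically integral curves\<close>

locale curve_point = field R for R (structure) +
  fixes K Kb F A q P :: "'a set" and S :: "'a set" and C :: "'a set set" and v :: "'a \<Rightarrow> int"
  assumes K: "subfield K R" and Kb: "subfield Kb R" and K_Kb: "K \<subseteq> Kb"
    and algebraic_Kb: "\<And>x. x \<in> Kb \<Longrightarrow> (algebraic over K) x"
    and closed: "algebraically_closed (R\<lparr>carrier := Kb\<rparr>)"
    and C: "geometrically_integral_curve R K Kb F C"
    and S: "finite S" "S \<subseteq> carrier R" and A_def: "A = generate_ring R (K \<union> S)"
    and F: "generate_field R A = F" and model: "affine_model R A \<subseteq> C"
    and q: "primeideal q (R\<lparr>carrier := A\<rparr>)" and P_def: "P = localization_at R A q"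
    and valuation: "normalized_discrete_valuation R Kb v"
    and unique_place: "{Q \<in> normalization R Kb (carrier R) (base_change R K Kb F C). lies_over R Q P} = {valuation_ring R v}"

sublocale curve_point \<subseteq> discrete_valuation R Kb v
  by (intro discrete_valuation.intro discrete_valuation_axioms.intro field_axioms Kb valuation)

context curve_point
begin

lemma K_subring: "subring K R" and Kb_subring: "subring Kb R"
  using subfieldE(1) K Kb by auto

lemma K_carrier: "K \<subseteq> carrier R"
  using subringE(1)[OF K_subring] .

lemma A_subring: "subring A R"
  unfolding A_def using generate_ring_is_subring K_carrier S by simp

lemma A_carrier: "A \<subseteq> carrier R"
  using subringE(1)[OF A_subring] .

lemma K_A: "K \<subseteq> A" and S_A: "S \<subseteq> A"
  using generate_ringE(2)[of "K \<union> S" A] K_carrier S A_def by auto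

lemma A_chart: "A \<in> affine_charts R K F C"
  unfolding affine_charts_def fin_gen_algebra_def using S A_def F model by auto

lemma A_embeds: "tensor_embeds R K A Kb"
  using C A_chart unfolding geometrically_integral_curve_def by blast

lemma compositum: "generate_field R (F \<union> Kb) = carrier R"
  using C unfolding geometrically_integral_curve_def by blast

lemma C_curve: "curve R K F C"
  using C unfolding geometrically_integral_curve_def by blast

lemma F_carrier: "F \<subseteq> carrier R"
  unfolding F[symmetric] by (rule generate_field_incl[OF A_carrier])

lemma subfield_eq_carrier:
  assumes E: "subfield E R" "A \<subseteq> E" "Kb \<subseteq> E"
  shows "E = carrier R"
proof -
  have "F \<subseteq> E" unfolding F[symmetric] by (rule generate_field_min_subfield1[OF A_carrier E(1,2)])
  then have "generate_field R (F \<union> Kb) \<subseteq> E"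
    using E F_carrier k_carrier by (intro generate_field_min_subfield1) auto
  then show ?thesis using compositum subfieldE(3)[OF E(1)] by auto
qed

text \<open>The coordinate ring of the base-changed chart. Defined as a span, it is directly a space
  for length counts; \<open>B_eq\<close> recovers its description as a generated ring.\<close>

definition B :: "'a set" where "B = kspan Kb A"

lemma B_eq: "B = generate_ring R (A \<union> Kb)" and B_subring: "subring B R"
  using kspan_generate_ring[OF Kb_subring A_subring] by (auto simp: B_def)

lemma B_carrier: "B \<subseteq> carrier R"
  using subringE(1)[OF B_subring] .

lemma A_B: "A \<subseteq> B" and Kb_B: "Kb \<subseteq> B"
  using generate_ringE(2)[of "A \<union> Kb" B] A_carrier k_carrier B_eq by auto

lemma B_field: "generate_field R B = carrier R"
  using generate_fieldE(1,2)[OF B_carrier refl] A_B Kb_B by (intro subfield_eq_carrier) auto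

lemma B_least:
  assumes W: "subring W R" "Kb \<subseteq> W" "S \<subseteq> W"
  shows "B \<subseteq> W"
proof -
  have "A \<subseteq> W"
    unfolding A_def using W K_Kb K_carrier S by (intro generate_ring_min_subring1) auto
  then show ?thesis
    unfolding B_eq using W A_carrier k_carrier by (intro generate_ring_min_subring1) auto
qed

lemma B_fin_gen: "fin_gen_algebra R Kb B"
proof -
  have c: "Kb \<union> S \<subseteq> carrier R" using k_carrier S by simp
  have "B = generate_ring R (Kb \<union> S)"
  proof
    show "B \<subseteq> generate_ring R (Kb \<union> S)"
      using generate_ringE(1,2)[OF c refl] by (intro B_least) auto
    show "generate_ring R (Kb \<union> S) \<subseteq> B"
      using generate_ring_min_subring1[OF c B_subring] Kb_B S_A A_B by auto
  qed
  then show ?thesis unfolding fin_gen_algebra_def using S by auto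
qed

lemma B_chart: "B \<in> affine_charts R Kb (carrier R) (base_change R K Kb F C)"
proof -
  have "affine_model R B \<subseteq> base_change R K Kb F C"
    unfolding base_change_def B_eq using A_chart by blast
  then show ?thesis using B_fin_gen B_field by (simp add: affine_charts_def[of R Kb])
qed

definition O_B :: "'a set" where "O_B = {x. integral_over B x}"

lemma O_B_iff: "x \<in> O_B \<longleftrightarrow> x \<in> carrier R \<and> (\<forall>W. valring W \<and> B \<subseteq> W \<longrightarrow> x \<in> W)"
  unfolding O_B_def mem_Collect_eq by (rule integral_over_iff_valring[OF B_subring])

lemma O_B_subring: "subring O_B R"
proof (rule subringI)
  show "h1 \<oplus> h2 \<in> O_B" "h1 \<otimes> h2 \<in> O_B" if "h1 \<in> O_B" "h2 \<in> O_B" for h1 h2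
    using that subringE(6,7)[OF valringE(1)] unfolding O_B_iff by blast+
  show "\<ominus> h \<in> O_B" if "h \<in> O_B" for h
    using that subringE(5)[OF valringE(1)] a_inv_closed unfolding O_B_iff by blast
  show "\<one> \<in> O_B" using subringE(3)[OF valringE(1)] one_closed unfolding O_B_iff by blast
  show "O_B \<subseteq> carrier R" using O_B_iff by blast
qed

lemma B_O_B: "B \<subseteq> O_B"
  using B_carrier by (auto simp only: O_B_iff)

lemma O_B_eq: "O_B = integral_closure_in R B (carrier R)"
  using integral_closure_eq[of B] subringE(3)[OF B_subring] by (simp add: O_B_def)

lemmas P_props = localization_props[OF A_subring q, folded P_def]

lemma P_carrier: "P \<subseteq> carrier R"
  using subringE(1)[OF P_props(1)] .

lemma P_F: "P \<subseteq> F"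
proof
  fix x assume "x \<in> P"
  then obtain a s where *: "a \<in> A" "s \<in> A - q" "x = a \<otimes> inv s"
    unfolding P_def localization_at_def by auto
  have E: "subfield F R" "A \<subseteq> F" using generate_fieldE(1,2)[OF A_carrier F[symmetric]] .
  have "s \<noteq> \<zero>" using * P_props(9) by auto
  then have "inv s \<in> F" using subfield_m_inv(1)[OF E(1)] * E(2) by auto
  then show "x \<in> F" using * E subringE(6)[OF subfieldE(1)[OF E(1)]] by auto
qed

lemma K_P: "K \<subseteq> P"
  using K_A P_props(2) by auto

text \<open>\<open>W\<close> dominates a point of the normalization over \<open>P\<close>, which must be \<open>V\<close>.\<close>

lemma normalization_point_below:
  assumes W: "valring W" "B \<subseteq> W" "P \<subseteq> W" "nonunits P \<subseteq> nonunits W"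
  shows "V \<subseteq> W"
proof -
  have OW: "O_B \<subseteq> W" using W(1,2) O_B_iff by blast
  \<comment> \<open>The point of the normalization is the localization of \<open>O_B\<close> at the
    center of \<open>W\<close>.\<close>
  define q' where "q' = nonunits W \<inter> O_B"
  have q': "primeideal q' (R\<lparr>carrier := O_B\<rparr>)"
    unfolding q'_def by (rule prime_nonunits[OF W(1) O_B_subring OW])
  define Q where "Q = localization_at R O_B q'"
  note Q = localization_props[OF O_B_subring q', folded Q_def]
  have s: "inv s \<in> W" "s \<noteq> \<zero>" "s \<in> carrier R" if "s \<in> O_B - q'" for s
  proof -
    have "s \<in> W" "s \<notin> nonunits W" using that OW by (auto simp: q'_def)
    then show "inv s \<in> W" "s \<noteq> \<zero>" using unitsD by auto
    show "s \<in> carrier R" using that by (simp add: O_B_iff)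
  qed
  have QW: "Q \<subseteq> W"
  proof
    fix x assume "x \<in> Q"
    then obtain s where s': "x \<in> carrier R" "s \<in> O_B - q'" "s \<otimes> x \<in> O_B" unfolding Q(5) by auto
    have "inv s \<otimes> (s \<otimes> x) \<in> W" using s(1)[OF s'(2)] s'(3) OW subringE(6)[OF valringE(1)[OF W(1)]] by auto
    then show "x \<in> W" using s(2,3)[OF s'(2)] s'(1) by simp
  qed
  have AO: "A \<subseteq> O_B" using A_B B_O_B by auto
  \<comment> \<open>An element of \<open>A\<close> outside \<open>q\<close> is invertible in
    \<open>P\<close>, hence in \<open>W\<close>, so it avoids the center of \<open>W\<close>; this
    gives the inclusion of \<open>P\<close> in the new local ring.\<close>
  have notq: "s \<in> O_B - q'" if "s \<in> A - q" for s
  proof -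
    have s0: "s \<noteq> \<zero>" using that P_props(9) by auto
    have "s \<in> carrier R" using that A_carrier by auto
    moreover have "\<one> \<in> A" using subringE(3)[OF A_subring] .
    ultimately have "inv s \<in> P" using that s0 unfolding P_props(5)
      by (auto intro!: bexI[of _ s])
    then have "s \<notin> nonunits W" using inv_nonunit[of s W] W(3) s0 by auto
    then show ?thesis using that AO by (auto simp: q'_def)
  qed
  have PQ: "P \<subseteq> Q"
  proof
    fix x assume "x \<in> P"
    then obtain s where "x \<in> carrier R" "s \<in> A - q" "s \<otimes> x \<in> A" unfolding P_props(5) by auto
    then show "x \<in> Q" unfolding Q(5) using notq AO by blast
  qed
  have "nonunits P \<subseteq> nonunits Q"
  proof
    fix x assume x: "x \<in> nonunits P"
    have "x \<in> Q" using x PQ by (auto simp: nonunits_def)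
    moreover have "x = \<zero> \<or> inv x \<notin> Q" using x W(4) inv_nonunit[of x W] QW by blast
    ultimately show "x \<in> nonunits Q" by (simp add: nonunits_def)
  qed
  then have "lies_over R Q P"
    using lies_over_iff[OF P_props(3) Q(3)] nonunits_inter[OF PQ] PQ by simp
  moreover have "Q \<in> normalization R Kb (carrier R) (base_change R K Kb F C)"
    unfolding normalization_def affine_model_def
    using B_chart q' Q_def O_B_eq by auto
  ultimately have "Q = V" using unique_place by auto
  then show ?thesis using QW by simp
qed

lemma V_over: "P \<subseteq> V" "nonunits V \<inter> P = nonunits P"
proof -
  have "lies_over R V P" using unique_place by auto
  then have "P \<subseteq> V \<and> nonunits V \<inter> P = nonunits P"
    using lies_over_iff[OF P_props(3) valring_is_local[OF V_valring]] by simp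
  then show "P \<subseteq> V" "nonunits V \<inter> P = nonunits P" by auto
qed

end

section \<open>Integrality of the valuation ring over the point\<close>

context field
begin

lemma local_unit:
  assumes P: "is_local P" and m: "m \<in> extended_ideal P (nonunits P)"
  shows "\<one> \<ominus> m \<noteq> \<zero> \<and> inv (\<one> \<ominus> m) \<in> P"
proof -
  have Ps: "subring P R" using P by (simp add: is_local_def)
  note E = subringE[OF Ps]
  have mP: "m \<in> nonunits P"
    using m
  proof induction
    case zero
    show ?case by (rule nonunits_zero[OF Ps])
  next
    case (lin i w h)
    have "i \<otimes> w \<in> nonunits P" using nonunits_mult'[OF Ps lin(1,2)] .
    then show ?case using lin P by (simp add: is_local_def)
  qed
  then have m': "m \<in> P" "m \<in> carrier R" using E(1) by (auto simp: nonunits_def)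
  have "\<one> \<ominus> m \<in> P" using E(3,5,7) m'(1) by (simp add: a_minus_def)
  moreover have "\<one> \<ominus> m \<notin> nonunits P"
  proof
    assume "\<one> \<ominus> m \<in> nonunits P"
    then have "(\<one> \<ominus> m) \<oplus> m \<in> nonunits P" using mP P by (simp add: is_local_def)
    moreover have "(\<one> \<ominus> m) \<oplus> m = \<one>" using m'(2) by algebra
    ultimately show False using one_notin_nonunits[OF Ps] by simp
  qed
  ultimately show ?thesis using unitsD by blast
qed

text \<open>A single factor \<open>s\<close> suffices, although clearing denominators in an integral
  equation usually costs powers: when \<open>u \<notin> W\<close>, dividing by
  \<open>u [^] (length cs - 1)\<close> makes \<open>u\<close> a combination of the coefficients with
  nonnegative powers of \<open>inv u\<close>, which lie in \<open>W\<close>.\<close>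

lemma integral_clear_denominators:
  assumes W: "valring W" and s: "s \<in> W" and u: "u \<in> carrier R" and cs: "set cs \<subseteq> carrier R"
    and int: "eval (\<one> # cs) u = \<zero>" and clear: "\<And>c. c \<in> set cs \<Longrightarrow> s \<otimes> c \<in> W"
  shows "s \<otimes> u \<in> W"
proof (cases "u \<in> W")
  note E = subringE[OF valringE(1)[OF W]]
  case True
  then show ?thesis using s E(6) by simp
next
  note E = subringE[OF valringE(1)[OF W]]
  case False
  have u0: "u \<noteq> \<zero>" "inv u \<in> W" using valringE(2)[OF W u False] by auto
  have sc: "s \<in> carrier R" using s E(1) by auto
  obtain w where w: "w \<in> W" "eval (map ((\<otimes>) s) cs) u \<otimes> u = w \<otimes> u [^] length cs"
    using eval_inverse_in[OF valringE(1)[OF W] u u0, of "map ((\<otimes>) s) cs"] clear by auto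
  have wc: "w \<in> carrier R" using w(1) E(1) by auto
  have ec: "eval cs u \<in> carrier R" using eval_in_carrier[OF cs u] .
  have un: "u [^] length cs \<in> carrier R" "u [^] length cs \<noteq> \<zero>" using u u0 by auto
  have "u [^] length cs \<oplus> eval cs u = \<zero>" using int un by (simp add: eval_Cons)
  then have "eval cs u = \<ominus> (u [^] length cs)" using un ec by (metis a_comm minus_equality)
  then have "(s \<otimes> \<ominus> (u [^] length cs)) \<otimes> u = w \<otimes> u [^] length cs"
    using w(2) by (simp add: eval_map_mult[OF cs sc u])
  moreover have "(s \<otimes> \<ominus> (u [^] length cs)) \<otimes> u = (\<ominus> (s \<otimes> u)) \<otimes> u [^] length cs"
    using sc un u by algebra
  ultimately have "\<ominus> (s \<otimes> u) = w" using un wc sc u m_rcancel[of "u [^] length cs" "\<ominus> (s \<otimes> u)" w] by simp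
  then have "s \<otimes> u = \<ominus> w" using sc u by (metis m_closed minus_minus)
  then show ?thesis using E(5)[OF w(1)] by simp
qed

end

context curve_point
begin

lemma V_integral:
  assumes u: "u \<in> V"
  shows "integral_over P u"
proof (rule ccontr)
  assume n: "\<not> integral_over P u"
  have uc: "u \<in> carrier R" using u by (simp add: V_iff)
  have NP: "nonunits P \<subseteq> P" by (auto simp: nonunits_def)
  obtain W where W: "valring W" "P \<subseteq> W" "nonunits P \<subseteq> nonunits W" "u \<notin> W"
    using not_integral_valring[OF P_props(1) NP local_unit[OF P_props(3)] uc n] by blast
  \<comment> \<open>This is where algebraicity of \<open>Kb\<close> over \<open>K\<close> enters: a
    valuation ring containing \<open>K\<close> contains every element algebraic over
    \<open>K\<close>, so \<open>W\<close> lies above the base change as well.\<close>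
  have "Kb \<subseteq> W"
    using algebraic_valring[OF W(1) K] K_P W(2) algebraic_Kb k_carrier by blast
  moreover have "S \<subseteq> W" using S_A P_props(2) W(2) by simp
  ultimately have "B \<subseteq> W" using B_least valringE(1)[OF W(1)] by blast
  then have "V \<subseteq> W" using normalization_point_below W by blast
  then show False using u W(4) by auto
qed

text \<open>An integral equation over \<open>P\<close> has finitely many coefficients, which have a
  common denominator in \<open>A - q\<close>. So every element of \<open>V\<close> is a fraction
  with numerator in \<open>O_B\<close> and denominator from \<open>A - q\<close>.\<close>

lemma V_denominator:
  assumes u: "u \<in> V"
  shows "\<exists>s\<in>A - q. s \<otimes> u \<in> O_B"
proof -
  have uc: "u \<in> carrier R" using u by (simp add: V_iff)
  obtain cs where cs: "set cs \<subseteq> P" "eval (\<one> # cs) u = \<zero>"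
    using V_integral[OF u] by (auto simp: integral_over_def)
  have csc: "set cs \<subseteq> carrier R" using cs(1) P_carrier by auto
  have "\<exists>s\<in>A - q. \<forall>c\<in>set cs. s \<otimes> c \<in> A"
  proof (rule common_denominator[OF A_subring _ csc])
    show "\<exists>s\<in>A - q. s \<otimes> c \<in> A" if "c \<in> set cs" for c
      using that cs(1) P_props(5) by blast
  qed (use P_props(7,8) subringE(6)[OF A_subring] in auto)
  then obtain s where s: "s \<in> A - q" "\<And>c. c \<in> set cs \<Longrightarrow> s \<otimes> c \<in> A" by auto
  have "s \<otimes> u \<in> W" if W: "valring W" "B \<subseteq> W" for W
  proof (rule integral_clear_denominators[OF W(1) _ uc csc cs(2)])
    show "s \<in> W" using s(1) A_B W(2) by auto
    show "s \<otimes> c \<in> W" if "c \<in> set cs" for c using s(2)[OF that] A_B W(2) by auto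
  qed
  then have "s \<otimes> u \<in> O_B" using O_B_iff s(1) A_carrier uc by auto
  then show ?thesis using s(1) by auto
qed

lemma Kb_algebraically_closed:
  assumes x: "x \<in> carrier R" "(algebraic over Kb) x"
  shows "x \<in> Kb"
proof -
  obtain p where p: "p \<in> carrier (Kb[X])" "p \<noteq> []" "eval p x = \<zero>"
    using algebraicE[OF Kb_subring x] .
  have "\<exists>b\<in>Kb. x \<ominus> b \<in> {\<zero>}"
    by (rule algebraically_closed_root[OF Kb closed carrier_is_subring k_carrier _ _ _ x(1) p(1,2)])
      (use p(3) integral_iff in auto)
  then obtain b where b: "b \<in> Kb" "x \<ominus> b = \<zero>" by auto
  then have "x = b" using x(1) k_carrier r_right_minus_eq[of x b] by auto
  then show ?thesis using b by simp
qed

lemma integral_over_subfield_algebraic: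
  assumes E: "subfield E R" and x: "integral_over E x"
  shows "(algebraic over E) x"
proof -
  obtain cs where "set cs \<subseteq> E" "eval (\<one> # cs) x = \<zero>" using x by (auto simp: integral_over_def)
  then show ?thesis
    using algebraic_over_subset_root[OF subfieldE(1)[OF E] subringE(3)[OF subfieldE(1)[OF E]] one_not_zero] by blast
qed

section \<open>Finite colength of the span of the local ring\<close>

text \<open>Normalization is carried out over \<open>K\<close>, where the dimension of the curve
  bounds the transcendence degree. Its valuation-theoretic conclusion then applies unchanged to
  rings containing \<open>Kb\<close>, and the generators become algebraic over \<open>Kb(y)\<close>,
  so the degree is finite.\<close>

lemma chart_function_field:
  "\<exists>y\<in>A. function_field R Kb y \<and> (\<forall>W. valring W \<longrightarrow> Kb \<subseteq> W \<longrightarrow> y \<in> W \<longrightarrow> B \<subseteq> W)"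
proof -
  have "\<exists>y\<in>generate_ring R (K \<union> S). \<forall>W. valring W \<and> K \<subseteq> W \<and> y \<in> W \<longrightarrow> S \<subseteq> W"
    by (rule noether_normalization_curve[OF K S])
      (rule curve_transcendence_degree[OF C_curve K S A_def model], simp_all add: A_def)
  then obtain y where y: "y \<in> A" "\<And>W. valring W \<Longrightarrow> K \<subseteq> W \<Longrightarrow> y \<in> W \<Longrightarrow> S \<subseteq> W"
    unfolding A_def by blast
  have yc: "y \<in> carrier R" using y(1) A_carrier by auto
  have over: "B \<subseteq> W" if W: "valring W" "Kb \<subseteq> W" "y \<in> W" for W
    using B_least[OF valringE(1)[OF W(1)] W(2)] y(2)[OF W(1) _ W(3)] K_Kb W(2) by blast
  have S_alg: "(algebraic over E) s" if E: "subfield E R" "Kb \<subseteq> E" "y \<in> E" and s: "s \<in> S" for E s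
  proof (rule integral_over_subfield_algebraic[OF E(1)])
    have "s \<in> W" if W: "valring W" "E \<subseteq> W" for W
      using over[OF W(1)] E(2,3) W(2) s S_A A_B by blast
    then show "integral_over E s"
      using integral_over_iff_valring[OF subfieldE(1)[OF E(1)]] s S by auto
  qed
  \<comment> \<open>If \<open>y\<close> were constant, all generators would be, and the ambient
    field would reduce to \<open>Kb\<close>; but \<open>v\<close> vanishes on nonzero constants and
    takes the value \<open>1\<close> somewhere.\<close>
  have yK: "y \<notin> Kb"
  proof
    assume yk: "y \<in> Kb"
    have "S \<subseteq> Kb" using S_alg[OF Kb order_refl yk] Kb_algebraically_closed S by auto
    then have "B \<subseteq> Kb" using B_least[OF Kb_subring order_refl] by simp
    then have "Kb = carrier R" using subfield_eq_carrier[OF Kb] A_B by simp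
    moreover obtain t where "t \<in> carrier R" "t \<noteq> \<zero>" "v t = 1" using v_surj[of 1] by auto
    ultimately show False using v_const[of t] by simp
  qed
  define E where "E = generate_field R (insert y Kb)"
  have ic: "insert y Kb \<subseteq> carrier R" using yc k_carrier by simp
  have E: "subfield E R" "insert y Kb \<subseteq> E" using generate_fieldE(1,2)[OF ic E_def] .
  obtain xs where xs: "set xs = S" using finite_list[OF S(1)] by auto
  have xc: "set xs \<subseteq> carrier R" using xs S by simp
  have alg: "\<And>x. x \<in> set xs \<Longrightarrow> (algebraic over E) x"
    using S_alg[OF E(1)] E(2) xs by auto
  let ?M = "finite_extension E xs"
  have M: "subfield ?M R" using finite_extension_is_subfield[OF E(1) xc alg] .
  have EM: "E \<subseteq> ?M" using finite_extension_incl[OF subfieldE(3)[OF E(1)] xc] .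
  moreover have "S \<subseteq> ?M" using finite_extension_mem[OF subfieldE(1)[OF E(1)] xc] xs by simp
  ultimately have "B \<subseteq> ?M" using E(2) by (intro B_least subfieldE(1)[OF M]) auto
  then have "?M = carrier R" using subfield_eq_carrier[OF M] A_B Kb_B by simp
  then have fd: "finite_dimension E (carrier R)"
    using finite_extension_finite_dimension(1)[OF E(1) xc alg] by simp
  have "function_field R Kb y"
    by (intro function_field.intro function_field_axioms.intro field_axioms Kb Kb_algebraically_closed yc yK)
      (use fd in \<open>simp_all add: E_def\<close>)
  then show ?thesis using y(1) over by blast
qed

text \<open>The valuation rings containing \<open>Kb\<close> and \<open>y\<close> are exactly those
  containing \<open>B\<close>, so the ring \<open>O_fin\<close> of the function field is the
  integral closure of \<open>B\<close>.\<close>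

lemma B_colength: "\<exists>e. len_le Kb B O_B e"
proof -
  obtain y where y: "y \<in> A" "function_field R Kb y"
    "\<And>W. valring W \<Longrightarrow> Kb \<subseteq> W \<Longrightarrow> y \<in> W \<Longrightarrow> B \<subseteq> W"
    using chart_function_field by blast
  interpret ff: function_field R Kb y by (rule y(2))
  have yB: "y \<in> B" using y(1) A_B by auto
  have "ff.O_fin = O_B"
  proof (intro equalityI subsetI)
    fix x assume "x \<in> ff.O_fin"
    then show "x \<in> O_B" unfolding ff.O_fin_def O_B_iff using Kb_B yB by blast
  next
    fix x assume "x \<in> O_B"
    then show "x \<in> ff.O_fin" unfolding ff.O_fin_def O_B_iff using y(3) by blast
  qed
  then show ?thesis using ff.finite_colength[OF B_subring Kb_B yB B_field] B_O_B by simp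
qed

lemma kspan_P: "subalgebra Kb (kspan Kb P) R" "kspan Kb P \<subseteq> V"
  using kspan_subspace[OF Kb_subring P_carrier] kspan_least[OF V_subspace V_over(1)] by auto

lemma O_B_subspace: "subalgebra Kb O_B R"
  using subring_subspace[OF Kb_subring O_B_subring] Kb_B B_O_B by auto

text \<open>A chain between the span of \<open>P\<close> and \<open>V\<close> has finitely many
  witnesses, and a common denominator \<open>s\<close> from \<open>A - q\<close> multiplies them
  into \<open>O_B\<close>. Scaled by \<open>s\<close>, it becomes a chain between \<open>B\<close>
  and \<open>O_B\<close>, whose length is already bounded.\<close>

lemma P_colength: "\<exists>e. len_le Kb (kspan Kb P) V e"
proof -
  obtain e where e: "len_le Kb B O_B e" using B_colength by auto
  have "m \<le> e" if f: "flag Kb (kspan Kb P) U m" and U: "U \<subseteq> V" for U m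
  proof -
    obtain T where T: "finite T" "T \<subseteq> U"
      "\<And>Z. subalgebra Kb Z R \<Longrightarrow> T \<subseteq> Z \<Longrightarrow> flag Kb (kspan Kb P \<inter> Z) (U \<inter> Z) m"
      using flag_finite_support[OF f] by blast
    have Tc: "T \<subseteq> carrier R" using T(2) U V_iff by blast
    have "\<exists>s\<in>A - q. \<forall>t\<in>T. s \<otimes> t \<in> O_B"
    proof (rule common_denominator[OF A_subring T(1) Tc])
      show "\<exists>s\<in>A - q. s \<otimes> t \<in> O_B" if "t \<in> T" for t
        using V_denominator that T(2) U by blast
      show "a \<otimes> b \<in> O_B" if "a \<in> A" "b \<in> O_B" for a b
        using that A_B B_O_B subringE(6)[OF O_B_subring] by blast
    qed (use P_props(7,8) in auto)
    then obtain s where s: "s \<in> A - q" "\<And>t. t \<in> T \<Longrightarrow> s \<otimes> t \<in> O_B" by auto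
    have sc: "s \<in> carrier R" "s \<noteq> \<zero>" using s(1) A_carrier P_props(9) by auto
    \<comment> \<open>The part of the field that \<open>s\<close> multiplies into
      \<open>O_B\<close>. It contains the witnesses, so cutting the chain with it loses no step; the
      scaled chain starts above \<open>B\<close> because \<open>B\<close> divided by
      \<open>s\<close> lies in the span of \<open>P\<close>.\<close>
    define Z where "Z = (\<otimes>) (inv s) ` O_B"
    have Z_iff: "x \<in> Z \<longleftrightarrow> x \<in> carrier R \<and> s \<otimes> x \<in> O_B" for x
    proof
      assume "x \<in> Z"
      then show "x \<in> carrier R \<and> s \<otimes> x \<in> O_B" using sc by (auto simp: Z_def O_B_iff)
    next
      assume "x \<in> carrier R \<and> s \<otimes> x \<in> O_B"
      then show "x \<in> Z" unfolding Z_def using sc by (intro image_eqI[of _ _ "s \<otimes> x"]) auto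
    qed
    have Z: "subalgebra Kb Z R"
      unfolding Z_def using subspace_scale[OF Kb_subring O_B_subspace] sc by simp
    have "T \<subseteq> Z" using s(2) Tc Z_iff by auto
    then have fl: "flag Kb ((\<otimes>) s ` (kspan Kb P \<inter> Z)) ((\<otimes>) s ` (U \<inter> Z)) m"
      using flag_scale[OF Kb_subring sc] T(3)[OF Z] by blast
    have "(\<otimes>) (inv s) ` A \<subseteq> P"
    proof
      fix x assume "x \<in> (\<otimes>) (inv s) ` A"
      then show "x \<in> P" unfolding P_props(5) using s(1) sc A_carrier
        by (auto intro!: bexI[of _ s])
    qed
    then have "kspan Kb ((\<otimes>) (inv s) ` A) \<subseteq> kspan Kb P" by (rule kspan_mono[OF Kb_subring P_carrier])
    then have sA: "(\<otimes>) (inv s) ` B \<subseteq> kspan Kb P"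
      unfolding B_def using kspan_scale[OF Kb_subring A_carrier inv_nz(1)[OF sc]] by simp
    have "B \<subseteq> (\<otimes>) s ` (kspan Kb P \<inter> Z)"
    proof
      fix x assume x: "x \<in> B"
      then have xc: "x \<in> carrier R" "x \<in> O_B" using B_carrier B_O_B by auto
      have "inv s \<otimes> x \<in> kspan Kb P" using sA x by auto
      moreover have "inv s \<otimes> x \<in> Z" using xc by (simp add: Z_def)
      ultimately show "x \<in> (\<otimes>) s ` (kspan Kb P \<inter> Z)"
        using sc xc by (intro image_eqI[of _ _ "inv s \<otimes> x"]) auto
    qed
    moreover have "(\<otimes>) s ` (U \<inter> Z) \<subseteq> O_B" using Z_iff by auto
    ultimately show ?thesis using len_leD[OF e flag_mono_bot[OF fl]] by blast
  qed
  then show ?thesis unfolding len_le_def by blast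
qed

end

section \<open>Regularity from a principal maximal ideal\<close>

lemma (in field) principal_genideal:
  assumes P: "subring P R" and I: "ideal I (R\<lparr>carrier := P\<rparr>)" and a: "a \<in> I" "I \<subseteq> (\<otimes>) a ` P"
  shows "I = genideal (R\<lparr>carrier := P\<rparr>) {a}"
proof -
  interpret P: ring "R\<lparr>carrier := P\<rparr>" by (rule subring_is_ring[OF P])
  have aP: "{a} \<subseteq> carrier (R\<lparr>carrier := P\<rparr>)" using a(1) ideal_subringE(1)[OF I] by auto
  show ?thesis
  proof
    show "genideal (R\<lparr>carrier := P\<rparr>) {a} \<subseteq> I"
      by (rule P.genideal_minimal[OF I]) (use a in auto)
    note G = ideal_subringE[OF P.genideal_ideal[OF aP]]
    show "I \<subseteq> genideal (R\<lparr>carrier := P\<rparr>) {a}"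
    proof
      fix x assume "x \<in> I"
      then obtain w where w: "w \<in> P" "x = a \<otimes> w" using a(2) by auto
      have "a \<in> carrier R" "w \<in> carrier R" using aP w subringE(1)[OF P] by auto
      then have "x = w \<otimes> a" using w(2) m_comm by simp
      then show "x \<in> genideal (R\<lparr>carrier := P\<rparr>) {a}"
        using G(4)[OF w(1)] P.genideal_self[OF aP] by auto
    qed
  qed
qed

context discrete_valuation
begin

text \<open>If neither element is a unit, both are divisible by the generator \<open>x\<close>.
  Dividing it out lowers the value of \<open>a\<close> by \<open>v x > 0\<close>, so the descent
  ends with a unit, which divides everything.\<close>

lemma dominated_comparable:
  assumes P: "is_local P" "P \<subseteq> V" and dom: "nonunits V \<inter> P = nonunits P"
    and x: "x \<in> nonunits P" "x \<noteq> \<zero>" and principal: "nonunits P = (\<otimes>) x ` P"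
  shows "a \<in> P \<Longrightarrow> a \<noteq> \<zero> \<Longrightarrow> b \<in> P \<Longrightarrow> b \<noteq> \<zero> \<Longrightarrow> b \<in> (\<otimes>) a ` P \<or> a \<in> (\<otimes>) b ` P"
proof (induction "nat (v a)" arbitrary: a b rule: less_induct)
  case less
  have Ps: "subring P R" using P(1) by (simp add: is_local_def)
  note E = subringE[OF Ps]
  have unit: "c \<in> (\<otimes>) u ` P" if "u \<in> P" "u \<notin> nonunits P" "c \<in> P" for u c
  proof -
    have u: "u \<noteq> \<zero>" "inv u \<in> P" "u \<in> carrier R" "c \<in> carrier R" using unitsD[OF that(1,2)] that E(1) by auto
    then show ?thesis using E(6)[OF u(2) that(3)] by (intro image_eqI[of _ _ "inv u \<otimes> c"]) auto
  qed
  show ?case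
  proof (cases "a \<in> nonunits P \<and> b \<in> nonunits P")
    case False
    then show ?thesis using unit less.prems by blast
  next
    case True
    then obtain a' b' where ab: "a' \<in> P" "a = x \<otimes> a'" "b' \<in> P" "b = x \<otimes> b'" using principal by blast
    have c: "x \<in> carrier R" "a' \<in> carrier R" "b' \<in> carrier R"
      using x ab E(1) by (auto simp: nonunits_def)
    have nz: "a' \<noteq> \<zero>" "b' \<noteq> \<zero>" using ab less.prems c by auto
    have "x \<in> nonunits V" using x(1) dom by auto
    then have "0 < v x" using x(2) nonunits_V_iff by simp
    moreover have "0 \<le> v a'" using ab(1) P(2) nz V_iff by auto
    ultimately have "nat (v a') < nat (v a)" using ab(2) v_mult[OF c(1) x(2) c(2) nz(1)] by simp
    then have "b' \<in> (\<otimes>) a' ` P \<or> a' \<in> (\<otimes>) b' ` P" using less.hyps ab nz by blast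
    then show ?thesis
    proof
      assume "b' \<in> (\<otimes>) a' ` P"
      then obtain w where "w \<in> P" "b' = a' \<otimes> w" by auto
      then have "b = a \<otimes> w" "w \<in> P" using ab c E(1) by (auto simp: m_assoc)
      then show ?thesis by auto
    next
      assume "a' \<in> (\<otimes>) b' ` P"
      then obtain w where "w \<in> P" "a' = b' \<otimes> w" by auto
      then have "a = b \<otimes> w" "w \<in> P" using ab c E(1) by (auto simp: m_assoc)
      then show ?thesis by auto
    qed
  qed
qed

text \<open>Comparability makes each nonzero ideal principal, generated by an element of least
  value, so \<open>P\<close> is Noetherian. The chain from zero to the maximal ideal, together with
  the upper bound, makes the dimension equal to the number of generators.\<close>

lemma dominated_regular:
  assumes P: "is_local P" "P \<subseteq> V" and dom: "nonunits V \<inter> P = nonunits P"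
    and x: "x \<in> nonunits P" "x \<noteq> \<zero>" and principal: "nonunits P = (\<otimes>) x ` P"
    and dim: "krull_dim (R\<lparr>carrier := P\<rparr>) \<le> 1"
  shows "regular_local_ring (R\<lparr>carrier := P\<rparr>)"
proof -
  have Ps: "subring P R" using P(1) by (simp add: is_local_def)
  note E = subringE[OF Ps]
  interpret P: ring "R\<lparr>carrier := P\<rparr>" by (rule subring_is_ring[OF Ps])
  have "\<exists>G\<subseteq>carrier (R\<lparr>carrier := P\<rparr>). finite G \<and> I = genideal (R\<lparr>carrier := P\<rparr>) G"
    if I: "ideal I (R\<lparr>carrier := P\<rparr>)" for I
  proof -
    note IE = ideal_subringE[OF I]
    have "\<exists>a\<in>I. I \<subseteq> (\<otimes>) a ` P"
    proof (cases "I = {\<zero>}")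
      case True
      then show ?thesis using E(2) by force
    next
      case False
      define a where "a = arg_min (\<lambda>a. nat (v a)) (\<lambda>a. a \<in> I - {\<zero>})"
      have "\<exists>c. c \<in> I - {\<zero>}" using False IE(2) by auto
      then obtain c where "c \<in> I - {\<zero>}" by auto
      then have a: "a \<in> I - {\<zero>}" "\<And>b. b \<in> I - {\<zero>} \<Longrightarrow> nat (v a) \<le> nat (v b)"
        unfolding a_def
        using arg_min_nat_lemma[of "\<lambda>a. a \<in> I - {\<zero>}" c "\<lambda>a. nat (v a)"] by auto
      have aP: "a \<in> P" "a \<in> carrier R" "a \<noteq> \<zero>" using a(1) IE(1) E(1) by auto
      have "b \<in> (\<otimes>) a ` P" if b: "b \<in> I" for b
      proof (cases "b = \<zero>")
        case True
        then show ?thesis using E(2) aP by (intro image_eqI[of _ _ \<zero>]) auto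
      next
        case False
        have bP: "b \<in> P" "b \<in> carrier R" using b IE(1) E(1) by auto
        consider "b \<in> (\<otimes>) a ` P" | "a \<in> (\<otimes>) b ` P"
          using dominated_comparable[OF P dom x principal aP(1,3) bP(1) False] by blast
        then show ?thesis
        proof cases
          case 2
          then obtain w where w: "w \<in> P" "a = b \<otimes> w" by auto
          have wc: "w \<in> carrier R" "w \<noteq> \<zero>" using w aP bP E(1) by auto
          have "0 \<le> v b" "0 \<le> v a" using bP aP P(2) False V_iff by auto
          \<comment> \<open>Minimality of the value of \<open>a\<close> shows that the quotient
            \<open>w\<close> has no positive value; domination then makes it a unit of
            \<open>P\<close> itself, so \<open>a\<close> also divides \<open>b\<close>.\<close>
          then have "v w \<le> 0"
            using v_mult[OF bP(2) False wc] w(2) a(2)[of b] b False by simp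
          then have "w \<notin> nonunits V" using wc(2) nonunits_V_iff by simp
          then have "w \<notin> nonunits P" using dom by auto
          then have "inv w \<in> P" using unitsD(2)[OF w(1)] by simp
          then show ?thesis using w wc bP by (intro image_eqI[of _ _ "inv w"]) auto
        qed
      qed
      then show ?thesis using a(1) by blast
    qed
    then obtain a where a: "a \<in> I" "I \<subseteq> (\<otimes>) a ` P" by auto
    then show ?thesis using principal_genideal[OF Ps I a] IE(1)
      by (intro exI[of _ "{a}"]) auto
  qed
  then have noeth: "noetherian_ring (R\<lparr>carrier := P\<rparr>)" by (rule P.noetherian_ringI)
  have prime: "primeideal (nonunits P) (R\<lparr>carrier := P\<rparr>)"
    using prime_nonunits[OF V_valring Ps P(2)] dom by simp
  define c where "c i = (if i = 0 then {\<zero>} else nonunits P)" for i :: nat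
  have "primeideal (c i) (R\<lparr>carrier := P\<rparr>)" for i
    using prime prime_zero[OF Ps] by (simp add: c_def)
  moreover have "c i \<subset> c (Suc i)" if "i < 1" for i
    using that x nonunits_zero[OF Ps] by (auto simp: c_def)
  ultimately have "enat 1 \<le> krull_dim (R\<lparr>carrier := P\<rparr>)"
    unfolding krull_dim_def by (intro Sup_upper) blast
  then have dim1: "krull_dim (R\<lparr>carrier := P\<rparr>) = enat 1" using dim by (simp add: one_enat_def)
  have "nonunits P = genideal (R\<lparr>carrier := P\<rparr>) {x}"
    using principal_genideal[OF Ps primeideal.axioms(1)[OF prime] x(1)] principal by simp
  then show ?thesis
    unfolding regular_local_ring_def
    using noeth is_local_maximal[OF P(1)] dim1 x(1)
    by (auto intro!: exI[of _ "{x}"] simp: nonunits_def)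
qed

end

section \<open>The residue field and the final length comparison\<close>

context curve_point
begin

lemma nonunits_P_subspace: "subalgebra K (nonunits P) R" and P_subspace: "subalgebra K P R"
proof -
  show "subalgebra K P R" by (rule subring_subspace[OF K_subring P_props(1) K_P])
  show "subalgebra K (nonunits P) R"
  proof (rule subspaceI[OF K_subring])
    show "nonunits P \<subseteq> carrier R" using P_carrier by (auto simp: nonunits_def)
    show "\<zero> \<in> nonunits P" by (rule nonunits_zero[OF P_props(1)])
    show "a \<oplus> b \<in> nonunits P" if "a \<in> nonunits P" "b \<in> nonunits P" for a b
      using that P_props(3) by (simp add: is_local_def)
    show "c \<otimes> a \<in> nonunits P" if "c \<in> K" "a \<in> nonunits P" for c a
      using that K_P by (intro nonunits_mult[OF P_props(1)]) auto
  qed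
qed

lemma kspan_nonunits_P: "kspan Kb (nonunits P) \<subseteq> nonunits V"
  using kspan_least[OF nonunits_V_subspace] V_over(2) by blast

text \<open>The length of \<open>V\<close> over its maximal ideal is at most \<open>d + e\<close>,
  through the span of \<open>P\<close>. If the residue class of \<open>u\<close> were not in
  \<open>Kb\<close>, no nonzero polynomial over the algebraically closed \<open>Kb\<close> could
  vanish on it, and \<open>d + e + 1\<close> powers of \<open>u\<close> would form too long a
  chain.\<close>

lemma residue_field_V:
  assumes deg: "residue_degree R K P d" and u: "u \<in> V"
  shows "\<exists>b\<in>Kb. u \<ominus> b \<in> nonunits V"
proof (rule ccontr)
  assume none: "\<not> ?thesis"
  obtain e where e: "len_le Kb (kspan Kb P) V e" using P_colength by auto
  have NP: "nonunits P \<subseteq> P" by (auto simp: nonunits_def)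
  have "len_le Kb (kspan Kb (nonunits P)) (kspan Kb P) d"
    by (rule residue_flag(2)[OF P_props(3) K K_P Kb K_Kb deg])
  then have "len_le Kb (kspan Kb (nonunits P)) V (d + e)"
    using len_le_trans[OF Kb_subring kspan_P(1) V_subspace kspan_mono[OF Kb_subring P_carrier NP] kspan_P(2) _ e]
    by blast
  then have len: "len_le Kb (nonunits V) V (d + e)"
    using len_le_mono kspan_nonunits_P by blast
  have uc: "u \<in> carrier R" using u V_iff by simp
  have evV: "eval p u \<in> V" if "set p \<subseteq> Kb" for p
    using that k_V u ring.eval_in_carrier[OF subring_is_ring[OF V_subring], of p u] eval_consistent[OF V_subring]
    by auto
  have NV: "nonunits V \<subseteq> V" by (auto simp: nonunits_def)
  have "\<exists>Z'. flag Kb (nonunits V) Z' (d + e + 1) \<and>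
    (\<forall>x\<in>Z'. \<exists>z\<in>nonunits V. \<exists>p. set p \<subseteq> Kb \<and> length p \<le> d + e + 1 \<and> x = z \<oplus> eval p u \<otimes> \<one>)"
  proof (rule flag_powers[OF Kb nonunits_V_subspace uc one_closed])
    fix c cs assume c: "c \<in> Kb" "c \<noteq> \<zero>" "set cs \<subseteq> Kb"
    show "eval (c # cs) u \<otimes> \<one> \<notin> nonunits V"
    proof
      assume z: "eval (c # cs) u \<otimes> \<one> \<in> nonunits V"
      have cc: "set (c # cs) \<subseteq> carrier R" using c k_carrier by auto
      have z': "eval (c # cs) u \<in> nonunits V" using z eval_in_carrier[OF cc uc] r_one by simp
      have p: "c # cs \<in> carrier (Kb[X])" using c by (auto simp: univ_poly_def polynomial_def)
      have "\<exists>b\<in>Kb. u \<ominus> b \<in> nonunits V"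
        by (rule algebraically_closed_root[OF Kb closed V_subring k_V NV nonunits_prime[OF V_subring]
              const_notin_nonunits u p _ z']) auto
      then show False using none by simp
    qed
  qed
  then obtain Z' where Z': "flag Kb (nonunits V) Z' (d + e + 1)"
    "\<And>x. x \<in> Z' \<Longrightarrow> \<exists>z\<in>nonunits V. \<exists>p. set p \<subseteq> Kb \<and> x = z \<oplus> eval p u \<otimes> \<one>" by blast
  have "Z' \<subseteq> V"
  proof
    fix x assume "x \<in> Z'"
    then obtain z p where zp: "z \<in> nonunits V" "set p \<subseteq> Kb" "x = z \<oplus> eval p u \<otimes> \<one>" using Z'(2) by blast
    have "eval p u \<otimes> \<one> \<in> V" using evV[OF zp(2)] V_mult subringE(3)[OF V_subring] by blast
    then show "x \<in> V" using zp NV subringE(7)[OF V_subring] by blast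
  qed
  then show False using len_leD[OF len Z'(1)] by simp
qed

theorem regular_at_point:
  assumes deg: "residue_degree R K P d" and d: "int d \<in> value_semigroup R v P"
    and dim: "krull_dim (R\<lparr>carrier := P\<rparr>) \<le> 1"
  shows "regular_local_ring (R\<lparr>carrier := P\<rparr>)"
proof -
  obtain x where x': "x \<in> P - {\<zero>}" "int d = v x" using d unfolding value_semigroup_def by (rule imageE)
  then have x: "x \<in> P" "x \<noteq> \<zero>" "v x = int d" by auto
  have xc: "x \<in> carrier R" using x P_carrier by auto
  note residue = residue_flag[OF P_props(3) K K_P Kb K_Kb deg]
  note oneP = subringE(3)[OF P_props(1)]
  \<comment> \<open>Separates the spans by \<open>\<one>\<close>, which proves that \<open>d\<close>
    is positive. Hence \<open>x\<close> has positive value and belongs to the maximal ideal of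
    \<open>P\<close>, not merely to \<open>P\<close>.\<close>
  have "kspan Kb (nonunits P) \<subset> kspan Kb P"
  proof -
    have NP: "nonunits P \<subseteq> P" by (auto simp: nonunits_def)
    have "\<one> \<in> kspan Kb P" using kspan_incl[OF Kb_subring P_carrier] oneP by auto
    moreover have "\<one> \<notin> kspan Kb (nonunits P)"
      using kspan_nonunits_P one_notin_nonunits[OF V_subring] by auto
    ultimately show ?thesis using kspan_mono[OF Kb_subring P_carrier NP] by blast
  qed
  moreover have "subalgebra Kb (kspan Kb (nonunits P)) R"
    using kspan_subspace[OF Kb_subring subspaceE(1)[OF nonunits_P_subspace]] .
  ultimately have "flag Kb (kspan Kb (nonunits P)) (kspan Kb P) (Suc 0)"
    using flag_Suc[OF flag_0] kspan_P(1) by blast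
  then have "0 < d" using len_leD[OF residue(2)] by fastforce
  then have "x \<in> nonunits V" using x xc nonunits_V_iff by simp
  then have xN: "x \<in> nonunits P" using x(1) V_over(2) by auto
  have sub: "(\<otimes>) x ` P \<subseteq> nonunits P"
    using nonunits_mult'[OF P_props(1) xN] by auto
  have xP: "subalgebra K ((\<otimes>) x ` P) R" by (rule subspace_scale[OF K_subring P_subspace xc])
  have "(\<otimes>) x ` P = nonunits P"
  proof (rule ccontr)
    assume "(\<otimes>) x ` P \<noteq> nonunits P"
    then have "flag K ((\<otimes>) x ` P) (nonunits P) (Suc 0)"
      using flag_Suc[OF flag_0[OF xP order_refl] nonunits_P_subspace] sub by blast
    then have f: "flag K ((\<otimes>) x ` P) P (Suc 0 + d)" using flag_trans residue(1) by blast
    have "P \<subseteq> generate_field R A" using P_F F by simp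
    then have "flag Kb (kspan Kb ((\<otimes>) x ` P)) (kspan Kb P) (Suc 0 + d)"
      by (rule flag_kspan[OF A_subring K Kb K_A K_Kb A_embeds f])
    then have fk: "flag Kb ((\<otimes>) x ` kspan Kb P) (kspan Kb P) (Suc 0 + d)"
      using kspan_scale[OF Kb_subring P_carrier xc] by simp
    obtain e where e: "len_le Kb (kspan Kb P) V e" using P_colength by auto
    have xV: "(\<otimes>) x ` V \<subseteq> V" using x V_over(1) V_mult by auto
    have "len_le Kb ((\<otimes>) x ` V) V d"
      by (rule len_le_scale_V[OF residue_field_V[OF deg] xc x(2,3)])
    then have "Suc 0 + d \<le> d"
      using colength_bound[OF Kb_subring V_subspace kspan_P(1) xc x(2) kspan_P(2) e xV _ fk] by blast
    then show False by simp
  qed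
  then show ?thesis
    using dominated_regular[OF P_props(3) V_over xN x(2) _ dim] by simp
qed

end

theorem proposition3p6:
  fixes L :: "('a, 'm) ring_scheme"
    and K Kb F :: "'a set"
    and p d :: nat
    and C :: "'a set set"
    and P PK Pt :: "'a set"
    and v :: "'a \<Rightarrow> int"
  assumes "field L" and "subfield Kb L"
    and "algebraic_closure (L\<lparr>carrier := Kb\<rparr>) K"
    and "group.ord (add_monoid L) \<one>\<^bsub>L\<^esub> = p" and "p > 0"
    and "\<not> perfect_field (L\<lparr>carrier := Kb\<rparr>) K"
    and "separably_closed (L\<lparr>carrier := Kb\<rparr>) K"
    and "geometrically_integral_curve L K Kb F C"
    and "closed_point C P"
    and "PK \<in> base_change L K Kb F C" and "lies_over L PK P"
    and "\<not> regular_local_ring (L\<lparr>carrier := PK\<rparr>)"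
    and "{Q \<in> normalization L Kb (carrier L) (base_change L K Kb F C). lies_over L Q P} = {Pt}"
    and "normalized_discrete_valuation L Kb v" and "valuation_ring L v = Pt"
    and "residue_degree L K P d" and "int d \<in> value_semigroup L v P"
  shows "regular_local_ring (L\<lparr>carrier := P\<rparr>)"
proof -
  interpret field L by (rule assms(1))
  interpret Kb: algebraic_closure "L\<lparr>carrier := Kb\<rparr>" K by (rule assms(3))
  note Kb_subring = subfieldE(1)[OF assms(2)]
  have K_Kb: "K \<subseteq> Kb" using subfieldE(3)[OF Kb.subfield_axioms] by simp
  have "subfield K L"
  proof (rule subfield_iff(1))
    have "field ((L\<lparr>carrier := Kb\<rparr>)\<lparr>carrier := K\<rparr>)"
      using Kb.subfield_iff(2)[OF Kb.subfield_axioms] .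
    then show "field (L\<lparr>carrier := K\<rparr>)" by simp
    show "K \<subseteq> carrier L" using K_Kb subringE(1)[OF Kb_subring] by simp
  qed
  have algebraic: "(algebraic over K) x" if x: "x \<in> Kb" for x
  proof -
    obtain f where f: "f \<in> carrier (univ_poly (L\<lparr>carrier := Kb\<rparr>) K)" "f \<noteq> []" "Kb.eval f x = \<zero>\<^bsub>L\<^esub>"
      using Kb.algebraicE[OF Kb.subring_axioms _ Kb.algebraic_extension] x by auto
    show ?thesis using f univ_poly_consistent[OF Kb_subring] eval_consistent[OF Kb_subring]
      by (intro algebraicI[of f]) auto
  qed
  have curve: "curve L K F C" using assms(8) by (simp add: geometrically_integral_curve_def)
  have PC: "P \<in> C" using assms(9) by (simp add: closed_point_def)
  then obtain A where A: "A \<in> affine_charts L K F C" "P \<in> affine_model L A"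
    using curve unfolding curve_def by blast
  then obtain S q where S: "finite S" "S \<subseteq> carrier L" "A = generate_ring L (K \<union> S)"
    and A': "generate_field L A = F" "affine_model L A \<subseteq> C"
    and q: "primeideal q (L\<lparr>carrier := A\<rparr>)" "P = localization_at L A q"
    unfolding affine_charts_def fin_gen_algebra_def affine_model_def by blast
  interpret curve_point L K Kb F A q P S C v
  proof (intro curve_point.intro curve_point_axioms.intro)
    show "algebraically_closed (L\<lparr>carrier := Kb\<rparr>)" by (rule Kb.algebraically_closed_axioms)
    show "{Q \<in> normalization L Kb (carrier L) (base_change L K Kb F C). lies_over L Q P} = {valuation_ring L v}"
      using assms(13,15) by simp
  qed (fact assms \<open>subfield K L\<close> K_Kb algebraic S A' q)+
  have "krull_dim (L\<lparr>carrier := P\<rparr>) \<le> (SUP P \<in> C. krull_dim (L\<lparr>carrier := P\<rparr>))"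
    using PC by (intro SUP_upper)
  also have "\<dots> = 1" using curve by (simp add: curve_def)
  finally show ?thesis by (rule regular_at_point[OF assms(16,17)])
qed

end
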